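(* Let $n\ge1$ and let $R$ be a commutative ring which contains $\frac12$. Let $e_{r;n}$ denote the $r$th elementary symmetric function in $M_1^2,\ldots,M_n^2$, where $M_1,\dots,M_n\in RS_n^-$ are the odd Jucys–Murphy elements. Then the even center of $RS_n^-$ is generated, as an $R$-algebra, by the elements $e_{r;n}$ with $r=1,\ldots,n$; likewise it is generated, as an $R$-algebra, by the top-degree terms of the elements $e_{r;n}$ with $r=1,\ldots,n$.
   Context: Double cover: $\widetilde S_n$ is the group generated by $t_1,\dots,t_{n-1},z$ with relations: $z$ central, $z^2=1$, $t_i^2=z$, $t_it_{i+1}t_i=t_{i+1}t_it_{i+1}$, $t_jt_i=zt_it_j$ for $|i-j|>1$. There are natural embeddings $\widetilde S_n\subset\widetilde S_{n+1}$. Cycles: in $\widetilde S_{n+1}$ put $x_i=t_it_{i+1}\cdots t_{n-1}t_nt_{n-1}\cdots t_{i+1}t_i$ for $1\le i\le n$ (so $x_n=t_n$). For distinct $i_1,\dots,i_m\in\{1,\dots,n\}$ with $m\ge2$ put $[i_1,\dots,i_m]=x_{i_1}x_{i_m}x_{i_{m-1}}\cdots x_{i_2}x_{i_1}$. This element lies in $\widetilde S_n$, does not depend on $n$, and maps to the cycle $(i_1,\dots,i_m)$ under $\widetilde S_n\to S_n$, $t_i\mapsto(i,i+1)$, $z\mapsto 1$ (permutations multiplied right to left). Spin group algebra: $RS_n^-=R\widetilde S_n/\langle z+1\rangle$, a superalgebra with every $t_i$ odd. Its even center is the set of its even central elements. The odd Jucys–Murphy elements are $M_k=\sum_{i=1}^{k-1}[i,k]\in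 RS_n^-$ for $1\le k\le n$ (so $M_1=0$), and $e_{r;n}=\sum_{1\le i_1<\cdots<i_r\le n}M_{i_1}^2\cdots M_{i_r}^2$ lies in the even center. Degrees: for a partition $\lambda=(\lambda_1,\dots,\lambda_\ell)$ with all parts even and $|\lambda|+\ell(\lambda)\le n$ (where $|\lambda|$ is the sum of the parts and $\ell(\lambda)$ the number of parts), let $d_\lambda(n)\in RS_n^-$ be the image of the sum of all elements of $\widetilde S_n$ that are products of disjoint cycles $[i_1,\dots,i_{\lambda_1+1}][j_1,\dots,j_{\lambda_2+1}]\cdots[k_1,\dots,k_{\lambda_\ell+1}]$. These $d_\lambda(n)$ form an $R$-basis of the even center, and $d_\lambda(n)$ is given degree $|\lambda|$. All $d_\lambda(n)$ occurring in $e_{r;n}$ have degree at most $2r$; the top-degree term of $e_{r;n}$ is its degree-$2r$ component, i.e. the sum of the terms of its expansion in the basis $d_\lambda(n)$ with $|\lambda|=2r$. *)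

theory Defs
  imports "HOL-Algebra.QuotRing" "HOL-Algebra.Generated_Rings"
begin

section \<open>Groups given by generators and relations\<close>

text \<open>
  A letter \<open>(g, True)\<close> stands for the generator \<open>g\<close> and \<open>(g, False)\<close> for its formal inverse.
  A relation \<open>u = v\<close> between positive words is the pair \<open>(u, v)\<close>.
\<close>

type_synonym 'g word = "('g \<times> bool) list"

definition pos_word :: "'g list \<Rightarrow> 'g word" where
  "pos_word w = map (\<lambda>g. (g, True)) w"

definition words :: "'g set \<Rightarrow> 'g word set" where
  "words S = lists (S \<times> UNIV)"

inductive_set word_cong :: "'g set \<Rightarrow> ('g list \<times> 'g list) set \<Rightarrow> ('g word \<times> 'g word) set"
  for S :: "'g set" and E :: "('g list \<times> 'g list) set" where
  refl: "w \<in> words S \<Longrightarrow> (w, w) \<in> word_cong S E"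
| sym: "(v, w) \<in> word_cong S E \<Longrightarrow> (w, v) \<in> word_cong S E"
| trans: "(u, v) \<in> word_cong S E \<Longrightarrow> (v, w) \<in> word_cong S E \<Longrightarrow> (u, w) \<in> word_cong S E"
| cancel: "u \<in> words S \<Longrightarrow> v \<in> words S \<Longrightarrow> g \<in> S \<Longrightarrow>
    (u @ [(g, b), (g, \<not> b)] @ v, u @ v) \<in> word_cong S E"
| relation: "u \<in> words S \<Longrightarrow> v \<in> words S \<Longrightarrow> (p, q) \<in> E \<Longrightarrow>
    (u @ pos_word p @ v, u @ pos_word q @ v) \<in> word_cong S E"

definition presented_group :: "'g set \<Rightarrow> ('g list \<times> 'g list) set \<Rightarrow> 'g word set monoid" where
  "presented_group S E =
    \<lparr>carrier = words S // word_cong S E,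
     mult = (\<lambda>A B. word_cong S E `` {u @ v |u v. u \<in> A \<and> v \<in> B}),
     one = word_cong S E `` {[]}\<rparr>"


section \<open>The double cover of the symmetric group\<close>

datatype gen = Gen_t nat | Gen_z

type_synonym cover = "gen word set"

definition cover_gens :: "nat \<Rightarrow> gen set" where
  "cover_gens n = insert Gen_z {Gen_t i |i. 1 \<le> i \<and> i < n}"

definition cover_rels :: "nat \<Rightarrow> (gen list \<times> gen list) set" where
  "cover_rels n =
      {([Gen_z, Gen_z], [])}
    \<union> {([Gen_z, Gen_t i], [Gen_t i, Gen_z]) |i. 1 \<le> i \<and> i < n}
    \<union> {([Gen_t i, Gen_t i], [Gen_z]) |i. 1 \<le> i \<and> i < n}
    \<union> {([Gen_t i, Gen_t (i + 1), Gen_t i], [Gen_t (i + 1), Gen_t i, Gen_t (i + 1)]) |i.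
         1 \<le> i \<and> i + 1 < n}
    \<union> {([Gen_t j, Gen_t i], [Gen_z, Gen_t i, Gen_t j]) |i j.
         1 \<le> i \<and> i < n \<and> 1 \<le> j \<and> j < n \<and> (i + 1 < j \<or> j + 1 < i)}"

definition cover_group :: "nat \<Rightarrow> cover monoid" where
  "cover_group n = presented_group (cover_gens n) (cover_rels n)"

text \<open>The element of \<open>cover_group n\<close> represented by a positive word in its generators.\<close>

definition cover_elem :: "nat \<Rightarrow> gen list \<Rightarrow> cover" where
  "cover_elem n w = word_cong (cover_gens n) (cover_rels n) `` {pos_word w}"

text \<open>The natural embedding of \<open>cover_group n\<close> into \<open>cover_group (n + 1)\<close>: the class of a word
  goes to the class of the same word.\<close>

definition embed :: "nat \<Rightarrow> cover \<Rightarrow> cover" where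
  "embed n A = word_cong (cover_gens (n + 1)) (cover_rels (n + 1)) `` A"

definition x_word :: "nat \<Rightarrow> nat \<Rightarrow> gen list" where
  "x_word n i = map Gen_t ([i..<n] @ [n] @ rev [i..<n])"

text \<open>The lifted cycle \<open>[i\<^sub>1, \<dots>, i\<^sub>m]\<close> for \<open>m \<ge> 2\<close> and distinct \<open>i\<^sub>1, \<dots>, i\<^sub>m \<in> {1..n}\<close>:
  the product \<open>x\<^bsub>i\<^sub>1\<^esub> x\<^bsub>i\<^sub>m\<^esub> \<dots> x\<^bsub>i\<^sub>2\<^esub> x\<^bsub>i\<^sub>1\<^esub>\<close> is formed in \<open>cover_group (n + 1)\<close>, where it lies in the
  image of \<open>cover_group n\<close>, and is regarded as an element of the latter.\<close>

definition lifted_cycle :: "nat \<Rightarrow> nat list \<Rightarrow> cover" where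
  "lifted_cycle n is =
     inv_into (carrier (cover_group n)) (embed n)
       (cover_elem (n + 1)
         (x_word n (hd is) @ concat (map (x_word n) (rev (tl is))) @ x_word n (hd is)))"

text \<open>\<open>z\<close> is even and every \<open>t\<^sub>i\<close> is odd.\<close>

definition even_elems :: "nat \<Rightarrow> cover set" where
  "even_elems n = {A \<in> carrier (cover_group n).
     \<exists>w\<in>A. even (length (filter (\<lambda>l. fst l \<noteq> Gen_z) w))}"


section \<open>The spin group algebra\<close>

text \<open>
  Coefficients have sort \<open>{comm_ring, comm_monoid_mult}\<close>, that is, they form an arbitrary
  commutative ring with unit; the class \<open>comm_ring_1\<close> would in addition demand \<open>0 \<noteq> 1\<close>.
\<close>

definition delta :: "'g \<Rightarrow> 'r::{comm_ring, comm_monoid_mult} \<Rightarrow> 'g \<Rightarrow> 'r" where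
  "delta g r = (\<lambda>h. if h = g then r else 0)"

definition group_algebra ::
    "('g, 'm) monoid_scheme \<Rightarrow> ('g \<Rightarrow> 'r::{comm_ring, comm_monoid_mult}) ring" where
  "group_algebra G =
    \<lparr>carrier = {f. finite {g. f g \<noteq> 0} \<and> {g. f g \<noteq> 0} \<subseteq> carrier G},
     mult = (\<lambda>f h g. \<Sum>(a, b) \<in> {(a, b). f a \<noteq> 0 \<and> h b \<noteq> 0 \<and> a \<otimes>\<^bsub>G\<^esub> b = g}. f a * h b),
     one = delta \<one>\<^bsub>G\<^esub> 1,
     zero = (\<lambda>_. 0),
     add = (\<lambda>f h g. f g + h g)\<rparr>"

type_synonym 'r spin = "(cover \<Rightarrow> 'r) set"

definition spin_ideal :: "nat \<Rightarrow> (cover \<Rightarrow> 'r::{comm_ring, comm_monoid_mult}) set" where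
  "spin_ideal n = (let A = group_algebra (cover_group n)
     in Idl\<^bsub>A\<^esub> {delta (cover_elem n [Gen_z]) 1 \<oplus>\<^bsub>A\<^esub> \<one>\<^bsub>A\<^esub>})"

definition spin_algebra :: "nat \<Rightarrow> 'r::{comm_ring, comm_monoid_mult} spin ring" where
  "spin_algebra n = group_algebra (cover_group n) Quot spin_ideal n"

definition spin_proj :: "nat \<Rightarrow> (cover \<Rightarrow> 'r::{comm_ring, comm_monoid_mult}) \<Rightarrow> 'r spin" where
  "spin_proj n f = spin_ideal n +>\<^bsub>group_algebra (cover_group n)\<^esub> f"

definition spin_of :: "nat \<Rightarrow> cover \<Rightarrow> 'r::{comm_ring, comm_monoid_mult} spin" where
  "spin_of n g = spin_proj n (delta g 1)"

text \<open>The structure map of the \<open>R\<close>-algebra; scalar multiplication by \<open>r\<close> is multiplication by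
  \<open>scalar n r\<close>.\<close>

definition scalar :: "nat \<Rightarrow> 'r::{comm_ring, comm_monoid_mult} \<Rightarrow> 'r spin" where
  "scalar n r = spin_proj n (delta \<one>\<^bsub>cover_group n\<^esub> r)"

definition even_part :: "nat \<Rightarrow> 'r::{comm_ring, comm_monoid_mult} spin set" where
  "even_part n = spin_proj n `
     {f \<in> carrier (group_algebra (cover_group n)). {g. f g \<noteq> 0} \<subseteq> even_elems n}"

definition even_center :: "nat \<Rightarrow> 'r::{comm_ring, comm_monoid_mult} spin set" where
  "even_center n = {x \<in> even_part n.
     \<forall>y\<in>carrier (spin_algebra n). x \<otimes>\<^bsub>spin_algebra n\<^esub> y = y \<otimes>\<^bsub>spin_algebra n\<^esub> x}"

definition generated_algebra ::
    "nat \<Rightarrow> 'r::{comm_ring, comm_monoid_mult} spin set \<Rightarrow> 'r spin set" where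
  "generated_algebra n S = generate_ring (spin_algebra n) (range (scalar n) \<union> S)"


section \<open>Odd Jucys-Murphy elements\<close>

definition jm :: "nat \<Rightarrow> nat \<Rightarrow> 'r::{comm_ring, comm_monoid_mult} spin" where
  "jm n k = (\<Oplus>\<^bsub>spin_algebra n\<^esub>i\<in>{1..<k}. spin_of n (lifted_cycle n [i, k]))"

text \<open>The ambient algebra is not commutative, so the monomials are formed in increasing order of
  the indices.\<close>

definition elem_sym :: "nat \<Rightarrow> nat \<Rightarrow> 'r::{comm_ring, comm_monoid_mult} spin" where
  "elem_sym r n = (\<Oplus>\<^bsub>spin_algebra n\<^esub>I\<in>{I. I \<subseteq> {1..n} \<and> card I = r}.
     foldr (\<lambda>i y. (jm n i [^]\<^bsub>spin_algebra n\<^esub> (2::nat)) \<otimes>\<^bsub>spin_algebra n\<^esub> y)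
       (sorted_list_of_set I) \<one>\<^bsub>spin_algebra n\<^esub>)"


section \<open>The basis of the even center and degrees\<close>

text \<open>Partitions are weakly decreasing lists of positive numbers.\<close>

definition even_partitions :: "nat \<Rightarrow> nat list set" where
  "even_partitions n = {l. sorted_wrt (\<ge>) l \<and> (\<forall>p\<in>set l. 0 < p \<and> even p) \<and>
     sum_list l + length l \<le> n}"

definition cycle_products :: "nat list \<Rightarrow> nat \<Rightarrow> cover set" where
  "cycle_products l n =
     {foldr (\<lambda>c g. lifted_cycle n c \<otimes>\<^bsub>cover_group n\<^esub> g) cs \<one>\<^bsub>cover_group n\<^esub> |cs.
        map length cs = map Suc l \<and> distinct (concat cs) \<and> set (concat cs) \<subseteq> {1..n}}"

definition d_elem :: "nat list \<Rightarrow> nat \<Rightarrow> 'r::{comm_ring, comm_monoid_mult} spin" where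
  "d_elem l n = (\<Oplus>\<^bsub>spin_algebra n\<^esub>g\<in>cycle_products l n. spin_of n g)"

definition d_comb ::
    "nat \<Rightarrow> nat list set \<Rightarrow> (nat list \<Rightarrow> 'r::{comm_ring, comm_monoid_mult}) \<Rightarrow> 'r spin" where
  "d_comb n L c =
     (\<Oplus>\<^bsub>spin_algebra n\<^esub>l\<in>L. scalar n (c l) \<otimes>\<^bsub>spin_algebra n\<^esub> d_elem l n)"

text \<open>Meaningful on the even center, of which the elements \<open>d_elem l n\<close> form a basis.\<close>

definition d_coeffs ::
    "nat \<Rightarrow> 'r::{comm_ring, comm_monoid_mult} spin \<Rightarrow> nat list \<Rightarrow> 'r" where
  "d_coeffs n x = (THE c. (\<forall>l. l \<notin> even_partitions n \<longrightarrow> c l = 0) \<and>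
     x = d_comb n (even_partitions n) c)"

definition degree_component ::
    "nat \<Rightarrow> nat \<Rightarrow> 'r::{comm_ring, comm_monoid_mult} spin \<Rightarrow> 'r spin" where
  "degree_component n k x = d_comb n {l \<in> even_partitions n. sum_list l = k} (d_coeffs n x)"

definition top_term :: "nat \<Rightarrow> nat \<Rightarrow> 'r::{comm_ring, comm_monoid_mult} spin" where
  "top_term r n = degree_component n (2 * r) (elem_sym r n)"

end

theory Submission
  imports Defs "HOL-Combinatorics.Cycles"
begin

text \<open>An even central element has no coefficient on a lifted permutation with a cycle of even length:
it commutes with that cycle, which anticommutes with the lifted permutation, and \<open>2\<close> is invertible. The remaining
classes are those of products of lifted odd cycles, so the \<open>d\<^sub>\<lambda>\<close> form a basis of the even center, where
linear independence rests on the spin representation separating \<open>z\<close> from \<open>1\<close>.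

The squares \<open>M\<^sub>k\<^sup>2\<close> commute, and a product of transpositions \<open>[i,k]\<close> sharing the entry \<open>k\<close> is a cycle up to
sign. Counting minimal factorizations into transpositions shows that the monomial symmetric function of
type \<open>\<mu>\<close> in the \<open>M\<^sub>k\<^sup>2\<close> is \<open>\<plusminus>d\<^sub>\<lambda>\<close> with \<open>\<lambda> = 2\<mu>\<close> plus terms \<open>d\<^sub>\<nu>\<close> which either have the same degree and fewer parts or
have lower degree. Monomial symmetric functions are reduced to products of the \<open>e\<^sub>r\<close> by the usual triangular
argument, and replacing \<open>e\<^sub>r\<close> by its top-degree term changes products only in lower degree. So one induction
on the degree and the number of parts covers both generating sets.\<close>


subsection \<open>Presented groups\<close>

text \<open>Only 2 is known to be invertible, so the triangular argument can afford no
  multiplicities: leading coefficients must be exactly 1 or -1. They are, because every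
  transposition \<open>[i, k]\<close> in a monomial has i < k. If the choices made for the
  \<open>M_k\<close> multiply minimally to a product of disjoint cycles, one for each k used, then k
  is the largest entry of its cycle and the order of the choices is forced; each cycle contributes
  one sign.

  The e_r are central because the lifted \<open>(j, j+1)\<close> exchanges \<open>M_j\<close> and
  \<open>M_(j+1)\<close> up to sign and a correction by the unit, and the corrections cancel in the
  sum and in the product of the two squares.

  Cosets are poor objects to compute with. The algebra is therefore represented faithfully by
  additive operators on functions on the group, which form a type class ring: g acts as translation
  by g times the idempotent (1 - z)/2. The unit becomes an idempotent \<open>eps\<close> that need
  not be the operator \<open>1\<close>, which is why products carry a trailing \<open>eps\<close>.
  There degree is bounded by the number of transpositions in a word, a bound that is visibly
  additive under products.\<close>

lemma words_Nil [simp]: "[] \<in> words S"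
  by (simp add: words_def)

lemma words_append [simp]: "u @ v \<in> words S \<longleftrightarrow> u \<in> words S \<and> v \<in> words S"
  by (simp add: words_def)

lemma words_Cons [simp]: "l # w \<in> words S \<longleftrightarrow> fst l \<in> S \<and> w \<in> words S"
  by (cases l) (simp add: words_def)

lemma words_pos_word [simp]: "pos_word p \<in> words S \<longleftrightarrow> set p \<subseteq> S"
  by (induction p) (auto simp: pos_word_def)

lemma pos_word_append: "pos_word (u @ v) = pos_word u @ pos_word v"
  by (simp add: pos_word_def)

definition inverse_word :: "'g word \<Rightarrow> 'g word" where
  "inverse_word w = rev (map (\<lambda>(g, b). (g, \<not> b)) w)"

text \<open>The assumption keeps rewriting inside \<open>words S\<close>, so that
  \<open>word_cong S E\<close> is an equivalence relation on that set.\<close>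

locale presentation =
  fixes S :: "'g set" and E :: "('g list \<times> 'g list) set"
  assumes rels: "(p, q) \<in> E \<Longrightarrow> set p \<subseteq> S \<and> set q \<subseteq> S"
begin

abbreviation "cong \<equiv> word_cong S E"
abbreviation "cls w \<equiv> word_cong S E `` {w}"

lemma cong_words: "(u, v) \<in> cong \<Longrightarrow> u \<in> words S \<and> v \<in> words S"
  by (induction rule: word_cong.induct) (use rels in auto)

lemma equiv_cong: "equiv (words S) cong"
  by (intro equivI refl_onI symI transI subsetI)
    (auto intro: word_cong.intros dest: cong_words)

text \<open>Only the basic rewriting steps of \<open>word_cong\<close> come with a context;
  induction carries the context through symmetry and transitivity. This makes concatenation of
  classes well defined.\<close>

lemma cong_context:
  "(u, v) \<in> cong \<Longrightarrow> a \<in> words S \<Longrightarrow> b \<in> words S \<Longrightarrow> (a @ u @ b, a @ v @ b) \<in> cong"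
proof (induction rule: word_cong.induct)
  case (refl w)
  then show ?case by (auto intro: word_cong.refl)
next
  case (sym v w)
  then show ?case by (auto intro: word_cong.sym)
next
  case (trans u v w)
  then show ?case by (auto intro: word_cong.trans)
next
  case (cancel u v g c)
  then show ?case using word_cong.cancel[of "a @ u" S "v @ b" g c E] by simp
next
  case (relation u v p q)
  then show ?case using word_cong.relation[of "a @ u" S "v @ b" p q E] by simp
qed

lemma cong_append:
  assumes "(u, u') \<in> cong" "(v, v') \<in> cong" shows "(u @ v, u' @ v') \<in> cong"
proof -
  have "(u @ v, u' @ v) \<in> cong"
    using cong_context[OF assms(1), of "[]" v] cong_words[OF assms(2)] by simp
  moreover have "(u' @ v, u' @ v') \<in> cong"
    using cong_context[OF assms(2), of u' "[]"] cong_words[OF assms(1)] by simp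
  ultimately show ?thesis by (rule word_cong.trans)
qed

lemma cls_eq_iff: "u \<in> words S \<Longrightarrow> v \<in> words S \<Longrightarrow> cls u = cls v \<longleftrightarrow> (u, v) \<in> cong"
  by (rule eq_equiv_class_iff[OF equiv_cong])

lemma cls_eqI: "(u, v) \<in> cong \<Longrightarrow> cls u = cls v"
  by (rule equiv_class_eq[OF equiv_cong])

lemma in_cls: "w \<in> words S \<Longrightarrow> w \<in> cls w"
  by (rule equiv_class_self[OF equiv_cong])

lemma carrier_presented: "carrier (presented_group S E) = cls ` words S"
  by (auto simp: presented_group_def quotient_def)

lemma one_presented: "\<one>\<^bsub>presented_group S E\<^esub> = cls []"
  by (simp add: presented_group_def)

lemma mult_presented:
  assumes "u \<in> words S" "v \<in> words S"
  shows "cls u \<otimes>\<^bsub>presented_group S E\<^esub> cls v = cls (u @ v)"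
proof -
  have "cong `` {a @ b |a b. a \<in> cls u \<and> b \<in> cls v} = cls (u @ v)" (is "cong `` ?A = _")
  proof (intro equalityI subsetI)
    fix x assume "x \<in> cong `` ?A"
    then obtain a b where ab: "(u, a) \<in> cong" "(v, b) \<in> cong" "(a @ b, x) \<in> cong" by auto
    then show "x \<in> cls (u @ v)" using word_cong.trans[OF cong_append[OF ab(1,2)] ab(3)] by simp
  next
    fix x assume "x \<in> cls (u @ v)"
    then show "x \<in> cong `` ?A" using in_cls assms by blast
  qed
  then show ?thesis by (simp add: presented_group_def)
qed

lemma inverse_word_words [simp]: "inverse_word w \<in> words S \<longleftrightarrow> w \<in> words S"
  unfolding inverse_word_def by (induction w) auto

lemma inverse_word_cong: "w \<in> words S \<Longrightarrow> (inverse_word w @ w, []) \<in> cong"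
proof (induction w)
  case Nil
  then show ?case by (simp add: inverse_word_def word_cong.refl)
next
  case (Cons l w)
  obtain g b where l: "l = (g, b)" by fastforce
  have "(inverse_word w @ [(g, \<not> b), (g, \<not> \<not> b)] @ w, inverse_word w @ w) \<in> cong"
    using Cons.prems l by (intro word_cong.cancel) auto
  moreover have "inverse_word (l # w) = inverse_word w @ [(g, \<not> b)]"
    by (simp add: l inverse_word_def)
  ultimately show ?case
    using Cons l word_cong.trans by fastforce
qed

lemma group_presented: "group (presented_group S E)"
proof (rule groupI)
  fix x y assume "x \<in> carrier (presented_group S E)" "y \<in> carrier (presented_group S E)"
  then show "x \<otimes>\<^bsub>presented_group S E\<^esub> y \<in> carrier (presented_group S E)"
    by (auto simp: carrier_presented mult_presented)
next
  show "\<one>\<^bsub>presented_group S E\<^esub> \<in> carrier (presented_group S E)"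
    by (simp add: carrier_presented one_presented)
next
  fix x assume "x \<in> carrier (presented_group S E)"
  then obtain w where w: "w \<in> words S" "x = cls w" by (auto simp: carrier_presented)
  have "cls (inverse_word w) \<otimes>\<^bsub>presented_group S E\<^esub> x = \<one>\<^bsub>presented_group S E\<^esub>"
    using w by (simp add: mult_presented one_presented cls_eqI inverse_word_cong)
  then show "\<exists>y\<in>carrier (presented_group S E). y \<otimes>\<^bsub>presented_group S E\<^esub> x = \<one>\<^bsub>presented_group S E\<^esub>"
    using w by (auto simp: carrier_presented)
qed (auto simp: carrier_presented mult_presented one_presented)

text \<open>Congruence is generated by rewriting inside a context, and a multiplicative function
  sees the context only through its values. This is the mapping property of the presentation, used
  for permutations, parities and Clifford operators.\<close>

lemma word_cong_invariant:
  fixes F :: "'g word \<Rightarrow> 'm"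
  assumes "\<And>u v. F (u @ v) = f (F u) (F v)"
    and "\<And>g b. g \<in> S \<Longrightarrow> F [(g, b), (g, \<not> b)] = F []"
    and "\<And>p q. (p, q) \<in> E \<Longrightarrow> F (pos_word p) = F (pos_word q)"
    and "(u, v) \<in> cong"
  shows "F u = F v"
  using assms(4)
proof (induction rule: word_cong.induct)
  case (cancel u v g b)
  have "F (u @ [(g, b), (g, \<not> b)] @ v) = F (u @ [] @ v)"
    unfolding assms(1) using cancel by (simp only: assms(2))
  then show ?case by simp
next
  case (relation u v p q)
  then show ?case unfolding assms(1) by (simp only: assms(3))
qed auto

end


subsection \<open>Generators, permutations and parities in the double cover\<close>

lemma cover_presentation: "presentation (cover_gens n) (cover_rels n)"
  by unfold_locales (auto simp: cover_gens_def cover_rels_def)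

interpretation cov: presentation "cover_gens n" "cover_rels n" for n
  by (rule cover_presentation)

interpretation cov: group "cover_group n" for n
  unfolding cover_group_def by (rule cov.group_presented)

abbreviation cover_mult :: "cover \<Rightarrow> nat \<Rightarrow> cover \<Rightarrow> cover" ("(_ \<cdot>\<^bsub>_\<^esub>/ _)" [70, 0, 71] 70) where
  "a \<cdot>\<^bsub>n\<^esub> b \<equiv> a \<otimes>\<^bsub>cover_group n\<^esub> b"

definition cls :: "nat \<Rightarrow> gen word \<Rightarrow> cover" where
  "cls n w = word_cong (cover_gens n) (cover_rels n) `` {w}"

definition tt :: "nat \<Rightarrow> nat \<Rightarrow> cover" where
  "tt n i = cover_elem n [Gen_t i]"

definition zz :: "nat \<Rightarrow> cover" where
  "zz n = cover_elem n [Gen_z]"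

lemma Gen_z_in [simp]: "Gen_z \<in> cover_gens n"
  and Gen_t_in [simp]: "Gen_t i \<in> cover_gens n \<longleftrightarrow> 1 \<le> i \<and> i < n"
  by (auto simp: cover_gens_def)

lemma carrier_cover: "carrier (cover_group n) = cls n ` words (cover_gens n)"
  by (simp add: cover_group_def cov.carrier_presented cls_def image_def)

lemma one_cover: "\<one>\<^bsub>cover_group n\<^esub> = cls n []"
  by (simp add: cover_group_def cov.one_presented cls_def)

lemma mult_cover:
  "u \<in> words (cover_gens n) \<Longrightarrow> v \<in> words (cover_gens n) \<Longrightarrow> cls n u \<cdot>\<^bsub>n\<^esub> cls n v = cls n (u @ v)"
  by (simp add: cover_group_def cov.mult_presented cls_def)

lemma cover_elem_cls: "cover_elem n w = cls n (pos_word w)"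
  by (simp add: cover_elem_def cls_def)

lemma cover_elem_append:
  "set u \<subseteq> cover_gens n \<Longrightarrow> set v \<subseteq> cover_gens n \<Longrightarrow>
    cover_elem n (u @ v) = cover_elem n u \<cdot>\<^bsub>n\<^esub> cover_elem n v"
  by (simp add: cover_elem_cls mult_cover pos_word_append)

lemma cover_elem_closed [simp]: "set u \<subseteq> cover_gens n \<Longrightarrow> cover_elem n u \<in> carrier (cover_group n)"
  by (auto simp: cover_elem_cls carrier_cover)

lemma tt_closed [simp]: "1 \<le> i \<Longrightarrow> i < n \<Longrightarrow> tt n i \<in> carrier (cover_group n)"
  and zz_closed [simp]: "zz n \<in> carrier (cover_group n)"
  by (simp_all add: tt_def zz_def)

lemma cover_elem_rel:
  assumes "(p, q) \<in> cover_rels n" shows "cover_elem n p = cover_elem n q"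
proof -
  have "([] @ pos_word p @ [], [] @ pos_word q @ []) \<in> word_cong (cover_gens n) (cover_rels n)"
    using assms by (intro word_cong.relation) auto
  then show ?thesis by (simp add: cover_elem_def cov.cls_eqI)
qed

lemma cover_elem_Cons:
  "g \<in> cover_gens n \<Longrightarrow> set w \<subseteq> cover_gens n \<Longrightarrow> w \<noteq> [] \<Longrightarrow>
    cover_elem n (g # w) = cover_elem n [g] \<cdot>\<^bsub>n\<^esub> cover_elem n w"
  using cover_elem_append[of "[g]" n w] by simp

lemma zz_zz: "zz n \<cdot>\<^bsub>n\<^esub> zz n = \<one>\<^bsub>cover_group n\<^esub>"
  using cover_elem_rel[of "[Gen_z, Gen_z]" "[]" n]
  by (simp add: cover_elem_Cons zz_def cover_rels_def one_cover cover_elem_cls[of n "[]"] pos_word_def)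

lemma tt_tt: "1 \<le> i \<Longrightarrow> i < n \<Longrightarrow> tt n i \<cdot>\<^bsub>n\<^esub> tt n i = zz n"
  using cover_elem_rel[of "[Gen_t i, Gen_t i]" "[Gen_z]" n]
  by (simp add: cover_elem_Cons tt_def zz_def cover_rels_def)

lemma zz_tt: "1 \<le> i \<Longrightarrow> i < n \<Longrightarrow> zz n \<cdot>\<^bsub>n\<^esub> tt n i = tt n i \<cdot>\<^bsub>n\<^esub> zz n"
  using cover_elem_rel[of "[Gen_z, Gen_t i]" "[Gen_t i, Gen_z]" n]
  by (simp add: cover_elem_Cons tt_def zz_def cover_rels_def)

lemma tt_braid: "1 \<le> i \<Longrightarrow> i + 1 < n \<Longrightarrow>
    tt n i \<cdot>\<^bsub>n\<^esub> (tt n (i+1) \<cdot>\<^bsub>n\<^esub> tt n i) = tt n (i+1) \<cdot>\<^bsub>n\<^esub> (tt n i \<cdot>\<^bsub>n\<^esub> tt n (i+1))"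
  using cover_elem_rel[of "[Gen_t i, Gen_t (i+1), Gen_t i]" "[Gen_t (i+1), Gen_t i, Gen_t (i+1)]" n]
  by (simp add: cover_elem_Cons tt_def zz_def cover_rels_def)

lemma tt_far: "1 \<le> i \<Longrightarrow> i < n \<Longrightarrow> 1 \<le> j \<Longrightarrow> j < n \<Longrightarrow> i + 1 < j \<or> j + 1 < i \<Longrightarrow>
    tt n j \<cdot>\<^bsub>n\<^esub> tt n i = zz n \<cdot>\<^bsub>n\<^esub> (tt n i \<cdot>\<^bsub>n\<^esub> tt n j)"
  using cover_elem_rel[of "[Gen_t j, Gen_t i]" "[Gen_z, Gen_t i, Gen_t j]" n]
  by (simp add: cover_elem_Cons tt_def zz_def cover_rels_def)

lemma cls_letter:
  assumes "g \<in> cover_gens n"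
  shows "cls n [(g, True)] = cover_elem n [g]" "cls n [(g, False)] = inv\<^bsub>cover_group n\<^esub> cover_elem n [g]"
proof -
  show 1: "cls n [(g, True)] = cover_elem n [g]" by (simp add: cover_elem_cls pos_word_def)
  have "([] @ [(g, False), (g, \<not> False)] @ [], [] @ []) \<in> word_cong (cover_gens n) (cover_rels n)"
    using assms by (intro word_cong.cancel) auto
  then have "cls n [(g, False), (g, True)] = \<one>\<^bsub>cover_group n\<^esub>"
    by (simp add: cls_def one_cover cov.cls_eqI)
  then have "cls n [(g, False)] \<cdot>\<^bsub>n\<^esub> cls n [(g, True)] = \<one>\<^bsub>cover_group n\<^esub>"
    using assms by (simp add: mult_cover)
  moreover have "cls n [(g, b)] \<in> carrier (cover_group n)" for b
    using assms by (auto simp: carrier_cover)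
  ultimately show "cls n [(g, False)] = inv\<^bsub>cover_group n\<^esub> cover_elem n [g]"
    using 1 cov.inv_equality by metis
qed

lemma inv_zz: "inv\<^bsub>cover_group n\<^esub> zz n = zz n"
  by (simp add: cov.inv_equality zz_zz)

lemma inv_tt: "1 \<le> i \<Longrightarrow> i < n \<Longrightarrow> inv\<^bsub>cover_group n\<^esub> tt n i = tt n i \<cdot>\<^bsub>n\<^esub> zz n"
  by (rule cov.inv_equality) (metis cov.m_assoc tt_closed zz_closed zz_tt tt_tt zz_zz, simp_all)

text \<open>Inverse letters need no case of their own: \<open>z\<close> is its own inverse and the
  inverse of \<open>t_i\<close> is \<open>t_i z\<close>.\<close>

lemma cover_induct [consumes 1, case_names one zz tt]:
  assumes "A \<in> carrier (cover_group n)" "P \<one>\<^bsub>cover_group n\<^esub>"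
    and z: "\<And>A. A \<in> carrier (cover_group n) \<Longrightarrow> P A \<Longrightarrow> P (A \<cdot>\<^bsub>n\<^esub> zz n)"
    and t: "\<And>A i. A \<in> carrier (cover_group n) \<Longrightarrow> P A \<Longrightarrow> 1 \<le> i \<Longrightarrow> i < n \<Longrightarrow> P (A \<cdot>\<^bsub>n\<^esub> tt n i)"
  shows "P A"
proof -
  have "P (cls n w)" if "w \<in> words (cover_gens n)" for w
    using that
  proof (induction w rule: rev_induct)
    case Nil
    then show ?case using assms(2) by (simp add: one_cover)
  next
    case (snoc l w)
    obtain g b where l: "l = (g, b)" by fastforce
    have g: "g \<in> cover_gens n" and w: "w \<in> words (cover_gens n)" using snoc.prems l by auto
    have eq: "cls n (w @ [l]) = cls n w \<cdot>\<^bsub>n\<^esub> cls n [(g, b)]" using snoc.prems l by (simp add: mult_cover)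
    have c: "cls n w \<in> carrier (cover_group n)" using w by (auto simp: carrier_cover)
    consider "g = Gen_z" | i where "g = Gen_t i" "1 \<le> i" "i < n" using g by (auto simp: cover_gens_def)
    then show ?case
    proof cases
      case 1
      then have "cls n [(g, b)] = zz n"
        using cls_letter[OF g] inv_zz by (cases b) (auto simp: zz_def)
      then show ?thesis unfolding eq using z[OF c] snoc w by simp
    next
      case 2
      then have "cls n [(g, b)] = tt n i \<or> cls n [(g, b)] = tt n i \<cdot>\<^bsub>n\<^esub> zz n"
        using cls_letter[OF g] inv_tt by (cases b) (auto simp: tt_def)
      moreover have "cls n w \<cdot>\<^bsub>n\<^esub> (tt n i \<cdot>\<^bsub>n\<^esub> zz n) = cls n w \<cdot>\<^bsub>n\<^esub> tt n i \<cdot>\<^bsub>n\<^esub> zz n"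
        using c 2 by (simp add: cov.m_assoc)
      moreover have P: "P (cls n w \<cdot>\<^bsub>n\<^esub> tt n i)" using t c snoc.IH w 2 by simp
      moreover have "P (cls n w \<cdot>\<^bsub>n\<^esub> tt n i \<cdot>\<^bsub>n\<^esub> zz n)" using z[OF _ P] c 2 by simp
      ultimately show ?thesis unfolding eq by metis
    qed
  qed
  then show ?thesis using assms(1) by (auto simp: carrier_cover)
qed

lemma zz_central: "A \<in> carrier (cover_group n) \<Longrightarrow> zz n \<cdot>\<^bsub>n\<^esub> A = A \<cdot>\<^bsub>n\<^esub> zz n"
proof (induction rule: cover_induct)
  case (tt A i)
  then show ?case by (metis cov.m_assoc tt_closed zz_closed zz_tt)
next
  case (zz A)
  then show ?case by (metis cov.m_assoc zz_closed)
qed simp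

fun gen_perm :: "gen \<Rightarrow> nat \<Rightarrow> nat" where
  "gen_perm Gen_z = id"
| "gen_perm (Gen_t i) = transpose i (i + 1)"

text \<open>The exponent of a letter is ignored, since every generator acts by an
  involution.\<close>

definition word_perm :: "gen word \<Rightarrow> nat \<Rightarrow> nat" where
  "word_perm w = foldr (\<lambda>l f. gen_perm (fst l) \<circ> f) w id"

definition word_par :: "gen word \<Rightarrow> bool" where
  "word_par w = odd (length (filter (\<lambda>l. fst l \<noteq> Gen_z) w))"

text \<open>On the classes in \<open>carrier (cover_group n)\<close> the representative chosen below is irrelevant.\<close>

definition cperm :: "cover \<Rightarrow> nat \<Rightarrow> nat" where
  "cperm A = word_perm (SOME w. w \<in> A)"

definition cpar :: "cover \<Rightarrow> bool" where
  "cpar A = word_par (SOME w. w \<in> A)"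

lemma word_perm_append: "word_perm (u @ v) = word_perm u \<circ> word_perm v"
proof -
  have "foldr (\<lambda>l f. gen_perm (fst l) \<circ> f) u g = foldr (\<lambda>l f. gen_perm (fst l) \<circ> f) u id \<circ> g" for g
    by (induction u) (auto simp: o_assoc)
  then show ?thesis unfolding word_perm_def by (simp add: foldr_append)
qed

lemma word_par_append: "word_par (u @ v) = (word_par u \<noteq> word_par v)"
  by (auto simp: word_par_def)

lemma transpose_braid:
  fixes i :: nat
  shows "transpose i (Suc i) \<circ> (transpose (Suc i) (Suc (Suc i)) \<circ> transpose i (Suc i)) =
    transpose (Suc i) (Suc (Suc i)) \<circ> (transpose i (Suc i) \<circ> transpose (Suc i) (Suc (Suc i)))"
  by (auto simp: fun_eq_iff transpose_def)

lemma transpose_far: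
  fixes i j :: nat
  assumes "Suc i < j \<or> Suc j < i"
  shows "transpose j (Suc j) \<circ> transpose i (Suc i) = transpose i (Suc i) \<circ> transpose j (Suc j)"
  using assms by (auto simp: fun_eq_iff transpose_def)

lemma word_perm_cong:
  assumes "(u, v) \<in> word_cong (cover_gens n) (cover_rels n)" shows "word_perm u = word_perm v"
proof (rule cov.word_cong_invariant[where f = "(\<circ>)", OF word_perm_append _ _ assms])
  fix g b assume "g \<in> cover_gens n"
  then show "word_perm [(g, b), (g, \<not> b)] = word_perm []"
    by (cases g) (auto simp: word_perm_def)
next
  fix p q assume "(p, q) \<in> cover_rels n"
  then show "word_perm (pos_word p) = word_perm (pos_word q)"
    using transpose_braid transpose_far by (auto simp: cover_rels_def word_perm_def pos_word_def)
qed

lemma word_par_cong: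
  assumes "(u, v) \<in> word_cong (cover_gens n) (cover_rels n)" shows "word_par u = word_par v"
proof (rule cov.word_cong_invariant[where f = "(\<noteq>)", OF word_par_append _ _ assms])
  fix g b assume "g \<in> cover_gens n"
  then show "word_par [(g, b), (g, \<not> b)] = word_par []"
    by (cases g) (auto simp: word_par_def)
next
  fix p q assume "(p, q) \<in> cover_rels n"
  then show "word_par (pos_word p) = word_par (pos_word q)"
    by (auto simp: cover_rels_def word_par_def pos_word_def)
qed

lemma some_in_cls:
  assumes "w \<in> words (cover_gens n)"
  shows "(w, SOME w'. w' \<in> cls n w) \<in> word_cong (cover_gens n) (cover_rels n)"
proof -
  have "w \<in> cls n w" using cov.in_cls[OF assms] by (simp add: cls_def)
  then have "(SOME w'. w' \<in> cls n w) \<in> cls n w" by (rule someI)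
  then show ?thesis by (simp add: cls_def)
qed

lemma cperm_cls: "w \<in> words (cover_gens n) \<Longrightarrow> cperm (cls n w) = word_perm w"
  unfolding cperm_def using some_in_cls word_perm_cong by metis

lemma cpar_cls: "w \<in> words (cover_gens n) \<Longrightarrow> cpar (cls n w) = word_par w"
  unfolding cpar_def using some_in_cls word_par_cong by metis

lemma cperm_mult [simp]:
  "A \<in> carrier (cover_group n) \<Longrightarrow> B \<in> carrier (cover_group n) \<Longrightarrow> cperm (A \<cdot>\<^bsub>n\<^esub> B) = cperm A \<circ> cperm B"
  by (auto simp: carrier_cover mult_cover cperm_cls word_perm_append)

lemma cpar_mult [simp]:
  "A \<in> carrier (cover_group n) \<Longrightarrow> B \<in> carrier (cover_group n) \<Longrightarrow> cpar (A \<cdot>\<^bsub>n\<^esub> B) = (cpar A \<noteq> cpar B)"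
  by (auto simp: carrier_cover mult_cover cpar_cls word_par_append)

lemma cperm_one [simp]: "cperm \<one>\<^bsub>cover_group n\<^esub> = id"
  and cpar_one [simp]: "\<not> cpar \<one>\<^bsub>cover_group n\<^esub>"
  by (simp_all add: one_cover cperm_cls cpar_cls word_perm_def word_par_def)

lemma cperm_zz [simp]: "cperm (zz n) = id"
  and cpar_zz [simp]: "\<not> cpar (zz n)"
  by (simp_all add: zz_def cover_elem_cls cperm_cls cpar_cls word_perm_def word_par_def pos_word_def)

lemma cperm_tt [simp]: "1 \<le> i \<Longrightarrow> i < n \<Longrightarrow> cperm (tt n i) = transpose i (i + 1)"
  and cpar_tt [simp]: "1 \<le> i \<Longrightarrow> i < n \<Longrightarrow> cpar (tt n i)"
  by (simp_all add: tt_def cover_elem_cls cperm_cls cpar_cls word_perm_def word_par_def pos_word_def)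

lemma cperm_permutes: "A \<in> carrier (cover_group n) \<Longrightarrow> cperm A permutes {1..n}"
proof (induction rule: cover_induct)
  case (tt A i)
  then have "transpose i (i + 1) permutes {1..n}" by (intro permutes_swap_id) auto
  then have "cperm A \<circ> transpose i (i + 1) permutes {1..n}"
    using tt.IH by (rule permutes_compose)
  then show ?case using tt(1,2,3) by (simp only: cperm_mult cperm_tt tt_closed)
qed (auto simp: permutes_id[unfolded id_def] id_def)

text \<open>Parity is constant on classes, so the existential over representatives in
  \<open>even_elems\<close> can be tested on any one of them.\<close>

lemma even_elems_eq: "even_elems n = {A \<in> carrier (cover_group n). \<not> cpar A}"
proof -
  have "(\<exists>w\<in>cls n v. even (length (filter (\<lambda>l. fst l \<noteq> Gen_z) w))) \<longleftrightarrow> \<not> word_par v" if "v \<in> words (cover_gens n)" for v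
    using that word_par_cong[of v _ n] cov.in_cls[OF that] unfolding cls_def word_par_def by blast
  then show ?thesis
    unfolding even_elems_def carrier_cover using cpar_cls by blast
qed


subsection \<open>The ring of additive operators on functions\<close>

text \<open>Operators get a type of their own so that type class ring laws apply; the Clifford
  operators and the group translations both live in it. Scalars enter as operators
  \<open>sc r\<close>, and additivity is what left distributivity of composition requires.\<close>

typedef (overloaded) ('a, 'r::ab_group_add) endo =
  "{F :: ('a \<Rightarrow> 'r) \<Rightarrow> 'a \<Rightarrow> 'r. \<forall>u v. F (\<lambda>x. u x + v x) = (\<lambda>x. F u x + F v x)}"
  morphisms app Endo
  by (rule exI[of _ "\<lambda>u. u"]) simp

lemma app_add: "app F (\<lambda>x. u x + v x) x = app F u x + app F v x"
  using app[of F] by simp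

lemma app_add': "app F (\<lambda>x. u x + v x) = (\<lambda>x. app F u x + app F v x)"
  by (rule ext) (rule app_add)

lemma endo_eqI: "(\<And>v x. app F v x = app G v x) \<Longrightarrow> F = G"
  by (metis app_inject ext)

instantiation endo :: (type, ab_group_add) "{ring, monoid_mult}"
begin

definition "0 = Endo (\<lambda>v x. 0)"
definition "1 = Endo (\<lambda>v. v)"
definition "F + G = Endo (\<lambda>v x. app F v x + app G v x)"
definition "F - G = Endo (\<lambda>v x. app F v x - app G v x)"
definition "- F = Endo (\<lambda>v x. - app F v x)"
definition "F * G = Endo (\<lambda>v. app F (app G v))"

lemma app_0 [simp]: "app 0 v x = 0"
  and app_1 [simp]: "app 1 v = v"
  and app_plus [simp]: "app (F + G) v x = app F v x + app G v x"
  and app_diff [simp]: "app (F - G) v x = app F v x - app G v x"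
  and app_uminus [simp]: "app (- F) v x = - app F v x"
  and app_times [simp]: "app (F * G) v = app F (app G v)"
  unfolding zero_endo_def one_endo_def plus_endo_def minus_endo_def uminus_endo_def times_endo_def
  by (subst Endo_inverse; simp add: app_add' algebra_simps; fail)+

instance
proof
  fix a b c :: "('a, 'b) endo"
  have *: "app a (\<lambda>x. app b v x + app c v x) x = app a (app b v) x + app a (app c v) x" for v x
    by (rule app_add)
  show "a * (b + c) = a * b + a * c"
  proof (rule endo_eqI)
    fix v x
    have "app (b + c) v = (\<lambda>x. app b v x + app c v x)" by (rule ext) simp
    then show "app (a * (b + c)) v x = app (a * b + a * c) v x" using * by simp
  qed
qed (rule endo_eqI; simp add: algebra_simps)+

end

lemma app_sum: "app (sum F A) v x = (\<Sum>i\<in>A. app (F i) v x)"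
  by (induction A rule: infinite_finite_induct) auto

definition sc :: "'r::comm_ring \<Rightarrow> ('a, 'r) endo" where
  "sc r = Endo (\<lambda>v x. r * v x)"

lemma app_sc [simp]: "app (sc r) v x = r * v x"
  unfolding sc_def by (subst Endo_inverse) (simp_all add: algebra_simps)

lemma sc_add: "sc (r + s) = sc r + sc s"
  and sc_0: "sc 0 = 0"
  and sc_minus: "sc (- r) = - sc r"
  and sc_mult: "sc (r * s) = sc r * sc s"
  by (auto intro!: endo_eqI simp: algebra_simps fun_eq_iff)

lemma sc_1: "sc (1::'r::{comm_ring, comm_monoid_mult}) = 1"
  by (auto intro!: endo_eqI)

lemma sc_sum: "sc (sum f A) = (\<Sum>i\<in>A. sc (f i))"
  by (induction A rule: infinite_finite_induct) (auto simp: sc_0 sc_add)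


subsection \<open>The spin representation: the central element \<open>z\<close> is not trivial\<close>

definition flip :: "nat \<Rightarrow> nat set \<Rightarrow> nat set" where
  "flip i A = (if i \<in> A then A - {i} else insert i A)"

text \<open>Fock space signs: the parity of the number of elements below \<open>i\<close> makes
  different generators anticommute, and the further dependence on \<open>i \<in> A\<close> makes
  each generator square to -1. Only elements below \<open>i\<close> are counted, so \<open>A\<close>
  may be infinite.\<close>

definition cliff_sign :: "nat \<Rightarrow> nat set \<Rightarrow> real" where
  "cliff_sign i A = (if even (card {a \<in> A. a < i}) \<longleftrightarrow> i \<in> A then 1 else -1)"

lemma flip_flip [simp]: "flip i (flip i A) = A"
  by (auto simp: flip_def)

lemma flip_commute: "flip i (flip j A) = flip j (flip i A)"
  by (auto simp: flip_def)

lemma cliff_sign_flip_same: "cliff_sign i (flip i A) = - cliff_sign i A"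
proof -
  have "{a \<in> flip i A. a < i} = {a \<in> A. a < i}" by (auto simp: flip_def)
  then show ?thesis by (auto simp: cliff_sign_def flip_def)
qed

lemma cliff_sign_flip_greater: "i < j \<Longrightarrow> cliff_sign i (flip j A) = cliff_sign i A"
proof -
  assume "i < j"
  then have "{a \<in> flip j A. a < i} = {a \<in> A. a < i}" by (auto simp: flip_def)
  then show ?thesis using \<open>i < j\<close> by (auto simp: cliff_sign_def flip_def)
qed

lemma cliff_sign_flip_less: "i < j \<Longrightarrow> cliff_sign j (flip i A) = - cliff_sign j A"
proof -
  assume "i < j"
  have "even (card {a \<in> flip i A. a < j}) \<longleftrightarrow> odd (card {a \<in> A. a < j})"
  proof (cases "i \<in> A")
    case True
    then have eq: "{a \<in> A. a < j} = insert i {a \<in> flip i A. a < j}" using \<open>i < j\<close> by (auto simp: flip_def)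
    show ?thesis unfolding eq using True by (subst card_insert_disjoint) (auto simp: flip_def)
  next
    case False
    then have eq: "{a \<in> flip i A. a < j} = insert i {a \<in> A. a < j}" using \<open>i < j\<close> by (auto simp: flip_def)
    show ?thesis unfolding eq using False by (subst card_insert_disjoint) auto
  qed
  then show ?thesis using \<open>i < j\<close> by (auto simp: cliff_sign_def flip_def)
qed

definition cliff :: "nat \<Rightarrow> (nat set, real) endo" where
  "cliff i = Endo (\<lambda>v A. cliff_sign i A * v (flip i A))"

lemma app_cliff [simp]: "app (cliff i) v A = cliff_sign i A * v (flip i A)"
  unfolding cliff_def by (subst Endo_inverse) (simp_all add: algebra_simps)

lemma cliff_sq: "cliff i * cliff i = - 1"
proof (rule endo_eqI)
  fix v A
  have "cliff_sign i A * cliff_sign i A = 1" by (simp add: cliff_sign_def)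
  then show "app (cliff i * cliff i) v A = app (- 1) v A"
    by (simp add: cliff_sign_flip_same flip: mult.assoc)
qed

lemma cliff_anticommute:
  assumes "i \<noteq> j" shows "cliff j * cliff i = - (cliff i * cliff j)"
proof (rule endo_eqI)
  fix v A
  show "app (cliff j * cliff i) v A = app (- (cliff i * cliff j)) v A"
    using assms by (cases "i < j")
      (simp_all add: cliff_sign_flip_greater cliff_sign_flip_less flip_commute[of i j] not_less)
qed

text \<open>The normalised vector e_i - e_(i+1) in the Clifford algebra: neighbours meet at the
  angle that the braid relation demands, while distant ones are orthogonal and hence
  anticommute.\<close>

definition cliff_t :: "nat \<Rightarrow> (nat set, real) endo" where
  "cliff_t i = sc (1 / sqrt 2) * (cliff i - cliff (i + 1))"

lemma sc_commute_cliff: "x * sc (r::real) = sc r * x" if "x = cliff i"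
  using that by (auto intro!: endo_eqI)

lemma cliff_t_mult:
  "(sc (r::real) * (cliff i - cliff j)) * (sc s * x) = sc (r * s) * ((cliff i - cliff j) * x)"
proof -
  have "(cliff i - cliff j) * sc s = sc s * (cliff i - cliff j)"
    by (simp add: algebra_simps sc_commute_cliff)
  then have "sc r * ((cliff i - cliff j) * sc s) * x = sc r * (sc s * (cliff i - cliff j)) * x" by simp
  then show ?thesis by (simp add: sc_mult mult.assoc)
qed

lemma cliff_diff_sq: "(cliff i - cliff (i+1)) * (cliff i - cliff (i+1)) = - 1 - 1"
  by (simp add: left_diff_distrib right_diff_distrib cliff_sq cliff_anticommute[of i "Suc i"])

lemma cliff_t_sq: "cliff_t i * cliff_t i = - 1"
proof -
  have "sc (1 / 2 :: real) + sc (1 / 2) = (1 :: (nat set, real) endo)"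
    by (simp add: sc_1 flip: sc_add)
  then show ?thesis
    unfolding cliff_t_def cliff_t_mult cliff_diff_sq
    by (simp add: right_diff_distrib) (metis diff_conv_add_uminus minus_add_distrib)
qed

text \<open>The hypotheses say that \<open>u\<close> and \<open>v\<close> square to -2 and have
  anticommutator 2. Both sides then reduce to 2u + 2v.\<close>

lemma braid_of_angle:
  fixes u v :: "'a::{ring, monoid_mult}"
  assumes "u * u = - 1 - 1" "v * v = - 1 - 1" "v * u = 1 + 1 - u * v"
  shows "u * (v * u) = v * (u * v)"
proof -
  have "u * (v * u) = u + u - (u * u) * v"
    unfolding assms(3) by (simp add: right_diff_distrib distrib_left mult.assoc)
  also have "\<dots> = u + u + v + v" unfolding assms(1) by (simp add: left_diff_distrib)
  finally have 1: "u * (v * u) = u + u + v + v" .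
  have "u * v = 1 + 1 - v * u" using assms(3) by simp
  then have "v * (u * v) = v + v - (v * v) * u"
    by (simp add: right_diff_distrib distrib_left mult.assoc)
  also have "\<dots> = v + v + u + u" unfolding assms(2) by (simp add: left_diff_distrib)
  finally show ?thesis using 1 by (simp add: add.assoc add.commute add.left_commute)
qed

lemma cliff_t_braid:
  "cliff_t i * (cliff_t (i+1) * cliff_t i) = cliff_t (i+1) * (cliff_t i * cliff_t (i+1))"
proof -
  have "(cliff (i+1) - cliff (i+1+1)) * (cliff i - cliff (i+1)) =
      1 + 1 - (cliff i - cliff (i+1)) * (cliff (i+1) - cliff (i+1+1))"
    by (simp add: left_diff_distrib right_diff_distrib cliff_sq cliff_anticommute[of i "Suc i"]
      cliff_anticommute[of i "Suc (Suc i)"] cliff_anticommute[of "Suc i" "Suc (Suc i)"])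
  from braid_of_angle[OF cliff_diff_sq cliff_diff_sq this] show ?thesis
    unfolding cliff_t_def cliff_t_mult by (simp only: )
qed

lemma cliff_t_far:
  assumes "i + 1 < j \<or> j + 1 < i" shows "cliff_t j * cliff_t i = - (cliff_t i * cliff_t j)"
proof -
  have *: "i \<noteq> j" "Suc i \<noteq> j" "i \<noteq> Suc j" using assms by auto
  have "(cliff j - cliff (j+1)) * (cliff i - cliff (i+1)) = - ((cliff i - cliff (i+1)) * (cliff j - cliff (j+1)))"
    using * by (simp add: algebra_simps cliff_anticommute[of i j] cliff_anticommute[of "Suc i" j]
      cliff_anticommute[of i "Suc j"] cliff_anticommute[of "Suc i" "Suc j"])
  then show ?thesis unfolding cliff_t_def cliff_t_mult by simp
qed

text \<open>Since \<open>cliff_t i\<close> squares to -1, its inverse is its negative.\<close>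

definition spin_letter :: "gen \<times> bool \<Rightarrow> (nat set, real) endo" where
  "spin_letter l = (case fst l of Gen_z \<Rightarrow> - 1 | Gen_t i \<Rightarrow> if snd l then cliff_t i else - cliff_t i)"

text \<open>Words are evaluated in the Clifford representation, where \<open>z\<close> acts as -1.
  The claim concerns the group alone, so real scalars serve for every coefficient ring.\<close>

lemma zz_neq_one: "zz n \<noteq> \<one>\<^bsub>cover_group n\<^esub>"
proof
  assume "zz n = \<one>\<^bsub>cover_group n\<^esub>"
  then have "([(Gen_z, True)], []) \<in> word_cong (cover_gens n) (cover_rels n)"
    by (simp add: zz_def cover_elem_def one_cover cls_def pos_word_def cov.cls_eq_iff)
  then have "prod_list (map spin_letter [(Gen_z, True)]) = prod_list (map spin_letter [])"
  proof (rule cov.word_cong_invariant[where f = "(*)", rotated -1])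
    fix g b assume "g \<in> cover_gens n"
    then show "prod_list (map spin_letter [(g, b), (g, \<not> b)]) = prod_list (map spin_letter [])"
      by (cases g) (auto simp: spin_letter_def cliff_t_sq)
  next
    fix p q assume "(p, q) \<in> cover_rels n"
    then show "prod_list (map spin_letter (pos_word p)) = prod_list (map spin_letter (pos_word q))"
      by (auto simp: cover_rels_def spin_letter_def pos_word_def cliff_t_sq
          intro!: cliff_t_braid[simplified] cliff_t_far)
  qed simp
  then have "app (- 1 :: (nat set, real) endo) (\<lambda>_. 1) {} = app 1 (\<lambda>_. 1) {}"
    by (simp add: spin_letter_def)
  then show False by simp
qed


subsection \<open>The elements \<open>x\<^sub>i\<close> and the embeddings\<close>

text \<open>Powers of \<open>z\<close> are indexed by truth values, so that collecting signs becomes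
  exclusive or of parities.\<close>

definition zs :: "nat \<Rightarrow> bool \<Rightarrow> cover" where
  "zs n b = (if b then zz n else \<one>\<^bsub>cover_group n\<^esub>)"

lemma zs_closed [simp]: "zs n b \<in> carrier (cover_group n)"
  by (simp add: zs_def)

lemma zs_False [simp]: "zs n False = \<one>\<^bsub>cover_group n\<^esub>" and zs_True [simp]: "zs n True = zz n"
  by (simp_all add: zs_def)

lemma cperm_zs [simp]: "cperm (zs n b) = id" and cpar_zs [simp]: "\<not> cpar (zs n b)"
  by (simp_all add: zs_def)

lemma zs_central: "A \<in> carrier (cover_group n) \<Longrightarrow> A \<cdot>\<^bsub>n\<^esub> zs n b = zs n b \<cdot>\<^bsub>n\<^esub> A"
  by (simp add: zs_def zz_central)

lemma zs_left: "A \<in> carrier (cover_group n) \<Longrightarrow> B \<in> carrier (cover_group n) \<Longrightarrow>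
    A \<cdot>\<^bsub>n\<^esub> (zs n b \<cdot>\<^bsub>n\<^esub> B) = zs n b \<cdot>\<^bsub>n\<^esub> (A \<cdot>\<^bsub>n\<^esub> B)"
  using zs_central[of A n b] by (simp flip: cov.m_assoc)

lemma zs_zs: "zs n b \<cdot>\<^bsub>n\<^esub> zs n c = zs n (b \<noteq> c)"
  by (simp add: zs_def zz_zz)

lemma zs_zs_left: "A \<in> carrier (cover_group n) \<Longrightarrow> zs n b \<cdot>\<^bsub>n\<^esub> (zs n c \<cdot>\<^bsub>n\<^esub> A) = zs n (b \<noteq> c) \<cdot>\<^bsub>n\<^esub> A"
  by (simp add: zs_zs flip: cov.m_assoc)

lemma zz_left: "A \<in> carrier (cover_group n) \<Longrightarrow> B \<in> carrier (cover_group n) \<Longrightarrow>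
    A \<cdot>\<^bsub>n\<^esub> (zz n \<cdot>\<^bsub>n\<^esub> B) = zz n \<cdot>\<^bsub>n\<^esub> (A \<cdot>\<^bsub>n\<^esub> B)"
  using zs_left[of A n B True] by simp

lemma zz_zz_left: "A \<in> carrier (cover_group n) \<Longrightarrow> zz n \<cdot>\<^bsub>n\<^esub> (zz n \<cdot>\<^bsub>n\<^esub> A) = A"
  by (simp add: zz_zz flip: cov.m_assoc)

definition xx :: "nat \<Rightarrow> nat \<Rightarrow> cover" where
  "xx n i = cover_elem (Suc n) (x_word n i)"

lemma set_x_word: "1 \<le> i \<Longrightarrow> i \<le> n \<Longrightarrow> set (x_word n i) \<subseteq> cover_gens (Suc n)"
  by (auto simp: x_word_def cover_gens_def)

lemma xx_closed [simp]: "1 \<le> i \<Longrightarrow> i \<le> n \<Longrightarrow> xx n i \<in> carrier (cover_group (Suc n))"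
  unfolding xx_def by (intro cover_elem_closed set_x_word)

lemma xx_last: "xx n n = tt (Suc n) n"
  by (simp add: xx_def tt_def x_word_def)

lemma xx_step:
  assumes "1 \<le> i" "i < n"
  shows "xx n i = tt (Suc n) i \<cdot>\<^bsub>Suc n\<^esub> (xx n (Suc i) \<cdot>\<^bsub>Suc n\<^esub> tt (Suc n) i)"
proof -
  have "x_word n i = [Gen_t i] @ x_word n (Suc i) @ [Gen_t i]"
    using assms by (simp add: x_word_def upt_conv_Cons)
  then show ?thesis unfolding xx_def tt_def
    using assms set_x_word[of "Suc i" n]
    by (simp add: cover_elem_append del: append_Cons append_Nil)
qed

lemma transpose_conj_Suc:
  fixes i n :: nat
  assumes "i < n" shows "transpose i (Suc i) \<circ> (transpose (Suc i) (Suc n) \<circ> transpose i (Suc i)) = transpose i (Suc n)"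
  using assms by (auto simp: fun_eq_iff transpose_def)

text \<open>Instances of \<open>zz_left\<close> for single generators, safe as rewrite rules: the
  general rule would keep exchanging two copies of \<open>zz\<close>.\<close>

lemma zz_past:
  shows "1 \<le> i \<Longrightarrow> i < n \<Longrightarrow> B \<in> carrier (cover_group n) \<Longrightarrow>
      tt n i \<cdot>\<^bsub>n\<^esub> (zz n \<cdot>\<^bsub>n\<^esub> B) = zz n \<cdot>\<^bsub>n\<^esub> (tt n i \<cdot>\<^bsub>n\<^esub> B)"
    and "1 \<le> j \<Longrightarrow> j \<le> m \<Longrightarrow> C \<in> carrier (cover_group (Suc m)) \<Longrightarrow>
      xx m j \<cdot>\<^bsub>Suc m\<^esub> (zz (Suc m) \<cdot>\<^bsub>Suc m\<^esub> C) = zz (Suc m) \<cdot>\<^bsub>Suc m\<^esub> (xx m j \<cdot>\<^bsub>Suc m\<^esub> C)"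
  by (intro zz_left; simp)+

lemma zz_past_end:
  shows "1 \<le> i \<Longrightarrow> i < n \<Longrightarrow> tt n i \<cdot>\<^bsub>n\<^esub> zz n = zz n \<cdot>\<^bsub>n\<^esub> tt n i"
    and "1 \<le> j \<Longrightarrow> j \<le> m \<Longrightarrow> xx m j \<cdot>\<^bsub>Suc m\<^esub> zz (Suc m) = zz (Suc m) \<cdot>\<^bsub>Suc m\<^esub> xx m j"
  by (simp_all add: zz_central)

text \<open>All three facts follow the same recursion, which places \<open>x_(i+1)\<close> between
  two copies of \<open>t_i\<close>; the square collects \<open>z\<close> three times.\<close>

lemma xx_perm_par:
  assumes "1 \<le> i" "i \<le> n"
  shows "cperm (xx n i) = transpose i (Suc n) \<and> cpar (xx n i) \<and> xx n i \<cdot>\<^bsub>Suc n\<^esub> xx n i = zz (Suc n)"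
  using assms(2,1)
proof (induction rule: inc_induct)
  case base
  then show ?case by (simp add: xx_last tt_tt)
next
  case (step i)
  let ?t = "tt (Suc n) i" and ?y = "xx n (Suc i)"
  have y: "?y \<cdot>\<^bsub>Suc n\<^esub> (?y \<cdot>\<^bsub>Suc n\<^esub> a) = zz (Suc n) \<cdot>\<^bsub>Suc n\<^esub> a" if "a \<in> carrier (cover_group (Suc n))" for a
    using that step by (simp flip: cov.m_assoc)
  have t: "?t \<cdot>\<^bsub>Suc n\<^esub> (?t \<cdot>\<^bsub>Suc n\<^esub> a) = zz (Suc n) \<cdot>\<^bsub>Suc n\<^esub> a" if "a \<in> carrier (cover_group (Suc n))" for a
    using that step by (simp add: tt_tt flip: cov.m_assoc)
  have "xx n i \<cdot>\<^bsub>Suc n\<^esub> xx n i = zz (Suc n)"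
    using step by (simp add: xx_step cov.m_assoc t y zz_past zz_zz_left tt_tt)
  then show ?case using step transpose_conj_Suc[of i n] by (simp add: xx_step)
qed

lemma cperm_xx [simp]: "1 \<le> i \<Longrightarrow> i \<le> n \<Longrightarrow> cperm (xx n i) = transpose i (Suc n)"
  and cpar_xx [simp]: "1 \<le> i \<Longrightarrow> i \<le> n \<Longrightarrow> cpar (xx n i)"
  and xx_xx: "1 \<le> i \<Longrightarrow> i \<le> n \<Longrightarrow> xx n i \<cdot>\<^bsub>Suc n\<^esub> xx n i = zz (Suc n)"
  using xx_perm_par by auto

lemma xx_xx_left: "1 \<le> i \<Longrightarrow> i \<le> n \<Longrightarrow> A \<in> carrier (cover_group (Suc n)) \<Longrightarrow>
    xx n i \<cdot>\<^bsub>Suc n\<^esub> (xx n i \<cdot>\<^bsub>Suc n\<^esub> A) = zz (Suc n) \<cdot>\<^bsub>Suc n\<^esub> A"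
  by (simp add: xx_xx flip: cov.m_assoc)

text \<open>Passing the three factors \<open>s\<close>, \<open>y\<close>, \<open>s\<close> costs
  \<open>z\<close> three times, which is \<open>z\<close>.\<close>

lemma anticommute_conj:
  assumes [simp]: "t \<in> carrier (cover_group m)" "s \<in> carrier (cover_group m)" "y \<in> carrier (cover_group m)"
    and ts: "t \<cdot>\<^bsub>m\<^esub> s = zz m \<cdot>\<^bsub>m\<^esub> (s \<cdot>\<^bsub>m\<^esub> t)" and ty: "t \<cdot>\<^bsub>m\<^esub> y = zz m \<cdot>\<^bsub>m\<^esub> (y \<cdot>\<^bsub>m\<^esub> t)"
  shows "t \<cdot>\<^bsub>m\<^esub> (s \<cdot>\<^bsub>m\<^esub> (y \<cdot>\<^bsub>m\<^esub> s)) = zz m \<cdot>\<^bsub>m\<^esub> ((s \<cdot>\<^bsub>m\<^esub> (y \<cdot>\<^bsub>m\<^esub> s)) \<cdot>\<^bsub>m\<^esub> t)"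
proof -
  have "t \<cdot>\<^bsub>m\<^esub> (s \<cdot>\<^bsub>m\<^esub> a) = zz m \<cdot>\<^bsub>m\<^esub> (s \<cdot>\<^bsub>m\<^esub> (t \<cdot>\<^bsub>m\<^esub> a))" if "a \<in> carrier (cover_group m)" for a
    using ts that by (metis assms(1,2) cov.m_assoc cov.m_closed zz_closed)
  moreover have "t \<cdot>\<^bsub>m\<^esub> (y \<cdot>\<^bsub>m\<^esub> a) = zz m \<cdot>\<^bsub>m\<^esub> (y \<cdot>\<^bsub>m\<^esub> (t \<cdot>\<^bsub>m\<^esub> a))" if "a \<in> carrier (cover_group m)" for a
    using ty that by (metis assms(1,3) cov.m_assoc cov.m_closed zz_closed)
  ultimately show ?thesis
    by (simp add: ts cov.m_assoc zz_left[of t] zz_left[of s] zz_left[of y] zz_zz_left)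
qed

text \<open>If \<open>j\<close> is \<open>i\<close> or \<open>i - 1\<close>, unfolding
  \<open>x_j\<close> once and collecting squares is enough. The case \<open>j = i + 1\<close>
  unfolds \<open>x_i\<close> twice, uses the braid relation and the claim for
  \<open>x_(i+2)\<close>; the distant case unfolds once and uses \<open>x_(i+1)\<close>. Hence the
  induction on \<open>n - i\<close>.\<close>

lemma tt_xx:
  assumes "1 \<le> i" "i \<le> n" "1 \<le> j" "j < n"
  shows "tt (Suc n) j \<cdot>\<^bsub>Suc n\<^esub> xx n i =
    zz (Suc n) \<cdot>\<^bsub>Suc n\<^esub> (xx n (transpose j (Suc j) i) \<cdot>\<^bsub>Suc n\<^esub> tt (Suc n) j)"
  using assms
proof (induction "n - i" arbitrary: i j rule: less_induct)
  case less
  let ?N = "Suc n"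
  have tt2: "tt ?N k \<cdot>\<^bsub>?N\<^esub> (tt ?N k \<cdot>\<^bsub>?N\<^esub> a) = zz ?N \<cdot>\<^bsub>?N\<^esub> a"
    if "a \<in> carrier (cover_group ?N)" "1 \<le> k" "k < ?N" for a k
    using that by (simp add: tt_tt flip: cov.m_assoc)
  consider "i = Suc j" | "i = j" | "j = Suc i" | "j \<noteq> i" "i \<noteq> Suc j" "j \<noteq> Suc i" by blast
  then show ?case
  proof cases
    case 1
    then show ?thesis using less.prems xx_step[of j n]
      by (simp add: cov.m_assoc tt_tt zz_past_end zz_past zz_zz_left tt2)
  next
    case 2
    then show ?thesis using less.prems xx_step[of j n]
      by (simp add: cov.m_assoc tt2)
  next
    case 3
    let ?t = "tt ?N i" and ?s = "tt ?N (Suc i)" and ?y = "xx n (Suc (Suc i))"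
    have x: "xx n i = ?t \<cdot>\<^bsub>?N\<^esub> (?s \<cdot>\<^bsub>?N\<^esub> (?y \<cdot>\<^bsub>?N\<^esub> (?s \<cdot>\<^bsub>?N\<^esub> ?t)))"
      using less.prems 3 by (simp add: xx_step cov.m_assoc)
    have b: "?t \<cdot>\<^bsub>?N\<^esub> (?s \<cdot>\<^bsub>?N\<^esub> ?t) = ?s \<cdot>\<^bsub>?N\<^esub> (?t \<cdot>\<^bsub>?N\<^esub> ?s)"
      using tt_braid[of i ?N] less.prems 3 by simp
    then have b': "?s \<cdot>\<^bsub>?N\<^esub> (?t \<cdot>\<^bsub>?N\<^esub> (?s \<cdot>\<^bsub>?N\<^esub> a)) = ?t \<cdot>\<^bsub>?N\<^esub> (?s \<cdot>\<^bsub>?N\<^esub> (?t \<cdot>\<^bsub>?N\<^esub> a))"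
      if "a \<in> carrier (cover_group ?N)" for a
      using that less.prems 3 by (simp add: b flip: cov.m_assoc)
    have "?t \<cdot>\<^bsub>?N\<^esub> ?y = zz ?N \<cdot>\<^bsub>?N\<^esub> (?y \<cdot>\<^bsub>?N\<^esub> ?t)"
      using less.prems 3 less.hyps[of "Suc (Suc i)" i] by (simp add: transpose_def)
    then have y: "?t \<cdot>\<^bsub>?N\<^esub> (?y \<cdot>\<^bsub>?N\<^esub> a) = zz ?N \<cdot>\<^bsub>?N\<^esub> (?y \<cdot>\<^bsub>?N\<^esub> (?t \<cdot>\<^bsub>?N\<^esub> a))"
      if "a \<in> carrier (cover_group ?N)" for a
      using that less.prems 3 by (simp flip: cov.m_assoc)
    show ?thesis using less.prems 3
      by (simp add: x cov.m_assoc b' y zz_past) (simp add: b flip: cov.m_assoc)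
  next
    case 4
    then have tr: "transpose j (Suc j) i = i" by (simp add: transpose_def)
    show ?thesis
    proof (cases "i = n")
      case True
      then show ?thesis using tt_far[of n ?N j] 4 less.prems tr by (simp add: xx_last)
    next
      case False
      have "tt ?N j \<cdot>\<^bsub>?N\<^esub> xx n (Suc i) = zz ?N \<cdot>\<^bsub>?N\<^esub> (xx n (Suc i) \<cdot>\<^bsub>?N\<^esub> tt ?N j)"
        using less.hyps[of "Suc i"] less.prems False 4 by (simp add: transpose_def)
      moreover have "tt ?N j \<cdot>\<^bsub>?N\<^esub> tt ?N i = zz ?N \<cdot>\<^bsub>?N\<^esub> (tt ?N i \<cdot>\<^bsub>?N\<^esub> tt ?N j)"
        using tt_far[of i ?N j] less.prems 4 False by (simp add: less_Suc_eq_le) linarith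
      ultimately show ?thesis
        using less.prems False tr xx_step[of i n] anticommute_conj[of "tt ?N j" ?N "tt ?N i" "xx n (Suc i)"]
        by simp
    qed
  qed
qed

lemma word_cong_mono: "word_cong (cover_gens n) (cover_rels n) \<subseteq> word_cong (cover_gens (Suc n)) (cover_rels (Suc n))"
proof (rule subrelI)
  have g: "words (cover_gens n) \<subseteq> words (cover_gens (Suc n))"
    unfolding words_def by (intro lists_mono) (auto simp: cover_gens_def)
  have E: "cover_rels n \<subseteq> cover_rels (Suc n)" by (auto simp: cover_rels_def)
  fix u v assume "(u, v) \<in> word_cong (cover_gens n) (cover_rels n)"
  then show "(u, v) \<in> word_cong (cover_gens (Suc n)) (cover_rels (Suc n))"
  proof (induction rule: word_cong.induct)
    case (cancel u v g b)
    then show ?case using g by (intro word_cong.cancel) (auto simp: cover_gens_def)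
  next
    case (relation u v p q)
    then show ?case using g E by (intro word_cong.relation) auto
  qed (use g in \<open>auto intro: word_cong.intros\<close>)
qed

lemma words_cover_Suc: "w \<in> words (cover_gens n) \<Longrightarrow> w \<in> words (cover_gens (Suc n))"
  by (auto simp: words_def cover_gens_def)

lemma embed_cls: "w \<in> words (cover_gens n) \<Longrightarrow> embed n (cls n w) = cls (Suc n) w"
  unfolding embed_def cls_def using word_cong_mono[of n] cov.in_cls[of w n]
  by (auto intro: word_cong.trans)

lemma embed_closed [simp]: "A \<in> carrier (cover_group n) \<Longrightarrow> embed n A \<in> carrier (cover_group (Suc n))"
  by (auto simp: carrier_cover embed_cls words_cover_Suc)

lemma embed_mult: "A \<in> carrier (cover_group n) \<Longrightarrow> B \<in> carrier (cover_group n) \<Longrightarrow>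
    embed n (A \<cdot>\<^bsub>n\<^esub> B) = embed n A \<cdot>\<^bsub>Suc n\<^esub> embed n B"
  by (auto simp: carrier_cover embed_cls words_cover_Suc mult_cover)

lemma embed_one: "embed n \<one>\<^bsub>cover_group n\<^esub> = \<one>\<^bsub>cover_group (Suc n)\<^esub>"
  by (simp add: one_cover embed_cls)

lemma embed_zz: "embed n (zz n) = zz (Suc n)"
  by (simp add: zz_def cover_elem_cls embed_cls)

lemma embed_zs: "embed n (zs n b) = zs (Suc n) b"
  by (simp add: zs_def embed_zz embed_one)

lemma embed_tt: "1 \<le> i \<Longrightarrow> i < n \<Longrightarrow> embed n (tt n i) = tt (Suc n) i"
  by (simp add: tt_def cover_elem_cls embed_cls)

lemma cperm_embed [simp]: "A \<in> carrier (cover_group n) \<Longrightarrow> cperm (embed n A) = cperm A"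
  by (auto simp: carrier_cover embed_cls words_cover_Suc cperm_cls)

lemma cpar_embed [simp]: "A \<in> carrier (cover_group n) \<Longrightarrow> cpar (embed n A) = cpar A"
  by (auto simp: carrier_cover embed_cls words_cover_Suc cpar_cls)

lemma cperm_in: "A \<in> carrier (cover_group n) \<Longrightarrow> cperm A i \<in> {1..n} \<longleftrightarrow> i \<in> {1..n}"
  using cperm_permutes permutes_in_image by metis

text \<open>Induction over the generators extends \<open>tt_xx\<close> to the whole smaller cover:
  an element acts on the \<open>x_i\<close> through its permutation, and an odd one adds a
  \<open>z\<close>. The conjugation signs of lifted cycles come from here.\<close>

lemma embed_xx:
  assumes "A \<in> carrier (cover_group n)" "1 \<le> i" "i \<le> n"
  shows "embed n A \<cdot>\<^bsub>Suc n\<^esub> xx n i = zs (Suc n) (cpar A) \<cdot>\<^bsub>Suc n\<^esub> (xx n (cperm A i) \<cdot>\<^bsub>Suc n\<^esub> embed n A)"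
  using assms
proof (induction arbitrary: i rule: cover_induct)
  case one
  then show ?case by (simp add: embed_one)
next
  case (zz A)
  then have "1 \<le> cperm A i \<and> cperm A i \<le> n" using cperm_in[of A n i] by simp
  moreover have "embed n (A \<cdot>\<^bsub>n\<^esub> zz n) = zz (Suc n) \<cdot>\<^bsub>Suc n\<^esub> embed n A"
    using zz by (simp add: embed_mult embed_zz zz_central)
  ultimately show ?case using zz zs_left[of "zz (Suc n)" "Suc n" _ "cpar A"]
    by (simp add: cov.m_assoc zz_past)
next
  case (tt A j)
  let ?N = "Suc n"
  let ?k = "transpose j (Suc j) i"
  have k: "1 \<le> ?k" "?k \<le> n" using tt by (auto simp: transpose_def)
  have k': "1 \<le> cperm A ?k" "cperm A ?k \<le> n" using cperm_in[of A n ?k] tt k by auto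
  have "embed n (A \<cdot>\<^bsub>n\<^esub> tt n j) \<cdot>\<^bsub>?N\<^esub> xx n i = embed n A \<cdot>\<^bsub>?N\<^esub> (tt ?N j \<cdot>\<^bsub>?N\<^esub> xx n i)"
    using tt by (simp add: embed_mult embed_tt cov.m_assoc)
  also have "\<dots> = zz ?N \<cdot>\<^bsub>?N\<^esub> ((embed n A \<cdot>\<^bsub>?N\<^esub> xx n ?k) \<cdot>\<^bsub>?N\<^esub> tt ?N j)"
    using tt(1,2,3,5,6) k zz_left[of "embed n A" ?N] by (simp add: tt_xx cov.m_assoc)
  also have "\<dots> = zz ?N \<cdot>\<^bsub>?N\<^esub> (zs ?N (cpar A) \<cdot>\<^bsub>?N\<^esub> (xx n (cperm A ?k) \<cdot>\<^bsub>?N\<^esub> (embed n A \<cdot>\<^bsub>?N\<^esub> tt ?N j)))"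
    unfolding tt.IH[OF k] using tt(1,2,3) k k' by (simp add: cov.m_assoc)
  also have "\<dots> = zs ?N (\<not> cpar A) \<cdot>\<^bsub>?N\<^esub> (xx n (cperm A ?k) \<cdot>\<^bsub>?N\<^esub> (embed n A \<cdot>\<^bsub>?N\<^esub> tt ?N j))"
    using tt k' zs_zs_left[of _ ?N True "cpar A"] by simp
  finally show ?case using tt by (simp add: embed_mult embed_tt)
qed

text \<open>The product lies over the transposition \<open>(i, n)\<close>, which fixes
  \<open>n + 1\<close>. For \<open>i = n - 1\<close> the braid relation collapses it to
  \<open>z t_(n-1)\<close>; smaller \<open>i\<close> are reached by sandwiching with
  \<open>t_i\<close>, which anticommutes with \<open>t_n\<close>. It is the relation that keeps the
  cosets below closed under \<open>t_n\<close>.\<close>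

lemma xx_xx_last_xx:
  assumes "1 \<le> i" "i < n"
  shows "\<exists>h\<in>carrier (cover_group n). xx n i \<cdot>\<^bsub>Suc n\<^esub> (xx n n \<cdot>\<^bsub>Suc n\<^esub> xx n i) = embed n h"
proof -
  let ?N = "Suc n"
  have tt2: "tt ?N k \<cdot>\<^bsub>?N\<^esub> (tt ?N k \<cdot>\<^bsub>?N\<^esub> a) = zz ?N \<cdot>\<^bsub>?N\<^esub> a"
    if "a \<in> carrier (cover_group ?N)" "1 \<le> k" "k < ?N" for a k
    using that by (simp add: tt_tt flip: cov.m_assoc)
  have "i \<le> n - 1" using assms by simp
  then show ?thesis using assms(1)
  proof (induction rule: inc_induct)
    case base
    let ?t = "tt ?N (n-1)" and ?u = "tt ?N n"
    have n: "Suc (n - Suc 0) = n" "1 \<le> n - 1" using assms base by auto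
    have x: "xx n (n-1) = ?t \<cdot>\<^bsub>?N\<^esub> (?u \<cdot>\<^bsub>?N\<^esub> ?t)"
      using xx_step[of "n-1" n] n by (simp add: xx_last)
    have b: "?t \<cdot>\<^bsub>?N\<^esub> (?u \<cdot>\<^bsub>?N\<^esub> ?t) = ?u \<cdot>\<^bsub>?N\<^esub> (?t \<cdot>\<^bsub>?N\<^esub> ?u)"
      using tt_braid[of "n-1" ?N] n by simp
    have "?t \<cdot>\<^bsub>?N\<^esub> (?u \<cdot>\<^bsub>?N\<^esub> (?t \<cdot>\<^bsub>?N\<^esub> (?u \<cdot>\<^bsub>?N\<^esub> (?t \<cdot>\<^bsub>?N\<^esub> (?u \<cdot>\<^bsub>?N\<^esub> ?t))))) = 
      ?t \<cdot>\<^bsub>?N\<^esub> (?u \<cdot>\<^bsub>?N\<^esub> ((?t \<cdot>\<^bsub>?N\<^esub> (?u \<cdot>\<^bsub>?N\<^esub> ?t)) \<cdot>\<^bsub>?N\<^esub> (?u \<cdot>\<^bsub>?N\<^esub> ?t)))"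
      using n by (simp add: cov.m_assoc)
    also have "\<dots> = zz ?N \<cdot>\<^bsub>?N\<^esub> ?t"
      unfolding b using n by (simp add: cov.m_assoc tt2 zz_past zz_zz_left tt_tt zz_past_end)
    finally have "xx n (n-1) \<cdot>\<^bsub>?N\<^esub> (xx n n \<cdot>\<^bsub>?N\<^esub> xx n (n-1)) = embed n (zz n \<cdot>\<^bsub>n\<^esub> tt n (n-1))"
      using n x by (simp add: xx_last cov.m_assoc embed_mult embed_zz embed_tt)
    then show ?case using n by (intro bexI) auto
  next
    case (step i)
    let ?s = "tt ?N i" and ?y = "xx n (Suc i)" and ?u = "tt ?N n"
    obtain h where h: "h \<in> carrier (cover_group n)" "?y \<cdot>\<^bsub>?N\<^esub> (?u \<cdot>\<^bsub>?N\<^esub> ?y) = embed n h"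
      using step by (auto simp: xx_last)
    have su: "?s \<cdot>\<^bsub>?N\<^esub> ?u = zz ?N \<cdot>\<^bsub>?N\<^esub> (?u \<cdot>\<^bsub>?N\<^esub> ?s)"
      using tt_far[of n ?N i] step by simp
    then have su': "?s \<cdot>\<^bsub>?N\<^esub> (?u \<cdot>\<^bsub>?N\<^esub> a) = zz ?N \<cdot>\<^bsub>?N\<^esub> (?u \<cdot>\<^bsub>?N\<^esub> (?s \<cdot>\<^bsub>?N\<^esub> a))"
      if "a \<in> carrier (cover_group ?N)" for a
      using that step by (simp flip: cov.m_assoc)
    have "xx n i \<cdot>\<^bsub>?N\<^esub> (xx n n \<cdot>\<^bsub>?N\<^esub> xx n i) = ?s \<cdot>\<^bsub>?N\<^esub> ((?y \<cdot>\<^bsub>?N\<^esub> (?u \<cdot>\<^bsub>?N\<^esub> ?y)) \<cdot>\<^bsub>?N\<^esub> ?s)"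
      using step by (simp add: xx_step xx_last cov.m_assoc su' tt2 zz_past zz_zz_left)
    also have "\<dots> = embed n (tt n i \<cdot>\<^bsub>n\<^esub> (h \<cdot>\<^bsub>n\<^esub> tt n i))"
      unfolding h(2) using step h(1) by (simp add: embed_mult embed_tt)
    finally show ?case using step h(1)
      by (intro bexI[of _ "tt n i \<cdot>\<^bsub>n\<^esub> (h \<cdot>\<^bsub>n\<^esub> tt n i)"]) simp_all
  qed
qed

text \<open>The right cosets of the smaller cover with representatives 1 and
  \<open>x_1, ..., x_n\<close> are permuted by right multiplication with each generator. For
  \<open>t_j\<close> with \<open>j < n\<close> this is \<open>tt_xx\<close>;
  \<open>t_n = x_n\<close> exchanges the cosets of 1 and \<open>x_n\<close>, and fixes the others by
  \<open>xx_xx_last_xx\<close>.\<close>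

lemma cover_Suc_cases:
  assumes "g \<in> carrier (cover_group (Suc n))"
  shows "(\<exists>h\<in>carrier (cover_group n). g = embed n h) \<or>
    (\<exists>h\<in>carrier (cover_group n). \<exists>i\<in>{1..n}. g = embed n h \<cdot>\<^bsub>Suc n\<^esub> xx n i)" (is "?P g \<or> ?Q g")
  using assms
proof (induction rule: cover_induct)
  case one
  then show ?case by (metis embed_one cov.one_closed)
next
  case (zz A)
  from zz.IH show ?case
  proof
    assume "?P A"
    then show ?thesis by (metis cov.m_closed embed_mult embed_zz zz_closed)
  next
    assume "?Q A"
    then obtain h i where h: "h \<in> carrier (cover_group n)" "i \<in> {1..n}" "A = embed n h \<cdot>\<^bsub>Suc n\<^esub> xx n i" by blast
    then have "A \<cdot>\<^bsub>Suc n\<^esub> zz (Suc n) = embed n (h \<cdot>\<^bsub>n\<^esub> zz n) \<cdot>\<^bsub>Suc n\<^esub> xx n i"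
      by (simp add: embed_mult embed_zz cov.m_assoc zz_past_end)
    then show ?thesis using h by (meson cov.m_closed zz_closed)
  qed
next
  case (tt A j)
  let ?N = "Suc n"
  consider "j < n" | "j = n" using tt by linarith
  then show ?case
  proof cases
    case 1
    from tt.IH show ?thesis
    proof
      assume "?P A"
      then show ?thesis using 1 tt by (metis cov.m_closed embed_mult embed_tt tt_closed)
    next
      assume "?Q A"
      then obtain h i where h: "h \<in> carrier (cover_group n)" "i \<in> {1..n}" "A = embed n h \<cdot>\<^bsub>Suc n\<^esub> xx n i" by blast
      let ?k = "transpose j (Suc j) i"
      have k: "1 \<le> ?k" "?k \<le> n" using tt 1 h(2) by (auto simp: transpose_def)
      have "zz ?N \<cdot>\<^bsub>?N\<^esub> (tt ?N j \<cdot>\<^bsub>?N\<^esub> xx n ?k) = xx n i \<cdot>\<^bsub>?N\<^esub> tt ?N j"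
        using k 1 tt h(2) by (simp add: tt_xx zz_zz_left)
      then have "A \<cdot>\<^bsub>?N\<^esub> tt ?N j = embed n h \<cdot>\<^bsub>?N\<^esub> (zz ?N \<cdot>\<^bsub>?N\<^esub> (tt ?N j \<cdot>\<^bsub>?N\<^esub> xx n ?k))"
        using h tt by (simp add: cov.m_assoc)
      also have "\<dots> = embed n (h \<cdot>\<^bsub>n\<^esub> (zz n \<cdot>\<^bsub>n\<^esub> tt n j)) \<cdot>\<^bsub>?N\<^esub> xx n ?k"
        using h k tt 1 by (simp add: cov.m_assoc embed_mult embed_tt embed_zz)
      finally show ?thesis using k h(1) tt 1
        by (intro disjI2 bexI[of _ "h \<cdot>\<^bsub>n\<^esub> (zz n \<cdot>\<^bsub>n\<^esub> tt n j)"] bexI[of _ ?k]) auto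
    qed
  next
    case 2
    then have t: "tt ?N j = xx n n" by (simp add: xx_last)
    from tt.IH show ?thesis
    proof
      assume "?P A"
      moreover have "n \<in> {1..n}" using 2 tt(2) by simp
      ultimately show ?thesis unfolding t by blast
    next
      assume "?Q A"
      then obtain h i where h: "h \<in> carrier (cover_group n)" "i \<in> {1..n}" "A = embed n h \<cdot>\<^bsub>Suc n\<^esub> xx n i" by blast
      show ?thesis
      proof (cases "i = n")
        case True
        then have "A \<cdot>\<^bsub>?N\<^esub> tt ?N j = embed n (h \<cdot>\<^bsub>n\<^esub> zz n)"
          using h by (simp add: t cov.m_assoc xx_xx embed_mult embed_zz)
        then show ?thesis using h(1) by (meson cov.m_closed zz_closed)
      next
        case False
        then obtain k where k: "k \<in> carrier (cover_group n)" "xx n i \<cdot>\<^bsub>?N\<^esub> (xx n n \<cdot>\<^bsub>?N\<^esub> xx n i) = embed n k"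
          using xx_xx_last_xx[of i n] h(2) by auto
        have "embed n k \<cdot>\<^bsub>?N\<^esub> (zz ?N \<cdot>\<^bsub>?N\<^esub> xx n i) = xx n i \<cdot>\<^bsub>?N\<^esub> xx n n"
          unfolding k(2)[symmetric] using h(2) by (simp add: cov.m_assoc zz_past xx_xx xx_xx_left zz_zz)
        then have "A \<cdot>\<^bsub>?N\<^esub> tt ?N j = embed n (h \<cdot>\<^bsub>n\<^esub> (k \<cdot>\<^bsub>n\<^esub> zz n)) \<cdot>\<^bsub>?N\<^esub> xx n i"
          using h k(1) by (simp add: t cov.m_assoc embed_mult embed_zz)
        then show ?thesis using h k(1)
          by (intro disjI2 bexI[of _ "h \<cdot>\<^bsub>n\<^esub> (k \<cdot>\<^bsub>n\<^esub> zz n)"] bexI[of _ i]) auto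
      qed
    qed
  qed
qed

text \<open>This amounts to the Coxeter presentation of the symmetric group: an element over the identity
  cannot involve the coset of some \<open>x\<^sub>i\<close>, since that moves \<open>n + 1\<close>.\<close>

lemma cperm_id:
  assumes "g \<in> carrier (cover_group n)" "cperm g = id"
  shows "g = \<one>\<^bsub>cover_group n\<^esub> \<or> g = zz n"
  using assms
proof (induction n arbitrary: g)
  case 0
  from 0(1) show ?case
  proof (induction rule: cover_induct)
    case (zz A)
    then show ?case by (auto simp: zz_zz)
  qed auto
next
  case (Suc n)
  from cover_Suc_cases[OF Suc.prems(1)] show ?case
  proof
    assume "\<exists>h\<in>carrier (cover_group n). g = embed n h"
    then obtain h where h: "h \<in> carrier (cover_group n)" "g = embed n h" by blast
    then have "h = \<one>\<^bsub>cover_group n\<^esub> \<or> h = zz n" using Suc.prems(2) by (intro Suc.IH) simp_all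
    then show ?thesis using h(2) embed_one embed_zz by blast
  next
    assume "\<exists>h\<in>carrier (cover_group n). \<exists>i\<in>{1..n}. g = embed n h \<cdot>\<^bsub>Suc n\<^esub> xx n i"
    then obtain h i where h: "h \<in> carrier (cover_group n)" "i \<in> {1..n}" "g = embed n h \<cdot>\<^bsub>Suc n\<^esub> xx n i" by blast
    then have "cperm h i = Suc n" using Suc.prems(2) by (simp add: fun_eq_iff) (metis transpose_apply_second)
    then show ?thesis using cperm_in[OF h(1), of i] h(2) by simp
  qed
qed

lemma cperm_eq:
  assumes "g \<in> carrier (cover_group n)" "h \<in> carrier (cover_group n)" "cperm g = cperm h"
  shows "g = h \<or> g = zz n \<cdot>\<^bsub>n\<^esub> h"
proof -
  let ?i = "inv\<^bsub>cover_group n\<^esub> h"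
  have "cperm h \<circ> cperm ?i = id"
    using assms cperm_mult[of h n ?i] by (simp add: cov.r_inv)
  then have "cperm (g \<cdot>\<^bsub>n\<^esub> ?i) = id" using assms by simp
  then have "g \<cdot>\<^bsub>n\<^esub> ?i = \<one>\<^bsub>cover_group n\<^esub> \<or> g \<cdot>\<^bsub>n\<^esub> ?i = zz n" using assms by (intro cperm_id) auto
  then show ?thesis using assms
    by (metis cov.inv_closed cov.l_inv cov.l_one cov.m_assoc cov.r_one)
qed

lemma zz_mult_neq: "g \<in> carrier (cover_group n) \<Longrightarrow> zz n \<cdot>\<^bsub>n\<^esub> g \<noteq> g"
  using zz_neq_one by (metis cov.l_one cov.one_closed cov.right_cancel zz_closed)

lemma finite_cover: "finite (carrier (cover_group n))"
proof (rule ccontr)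
  assume inf: "infinite (carrier (cover_group n))"
  have "finite (cperm ` carrier (cover_group n))"
    by (rule finite_subset[of _ "{p. p permutes {1..n}}"])
      (use cperm_permutes in \<open>blast intro: finite_permutations\<close>)+
  then obtain g where g: "g \<in> carrier (cover_group n)"
    "infinite {h \<in> carrier (cover_group n). cperm h = cperm g}"
    using pigeonhole_infinite[OF inf] by auto
  moreover have "{h \<in> carrier (cover_group n). cperm h = cperm g} \<subseteq> {g, zz n \<cdot>\<^bsub>n\<^esub> g}"
    using cperm_eq g(1) by auto
  ultimately show False using finite_subset by blast
qed

text \<open>The embedding preserves permutations, so only \<open>g\<close> and \<open>z g\<close>
  could collide, and \<open>z\<close> stays nontrivial in the larger cover. This makes the inverse
  image in \<open>lifted_cycle\<close> unique.\<close>

lemma inj_embed: "inj_on (embed n) (carrier (cover_group n))"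
proof (rule inj_onI)
  fix g h assume gh: "g \<in> carrier (cover_group n)" "h \<in> carrier (cover_group n)" "embed n g = embed n h"
  then have "cperm g = cperm h" by (metis cperm_embed)
  then have "g = h \<or> g = zz n \<cdot>\<^bsub>n\<^esub> h" using gh by (intro cperm_eq)
  moreover have "g \<noteq> zz n \<cdot>\<^bsub>n\<^esub> h"
    using gh zz_mult_neq[of "embed n h" "Suc n"] by (auto simp: embed_mult embed_zz)
  ultimately show "g = h" by blast
qed


subsection \<open>Lifted cycles\<close>

definition xp :: "nat \<Rightarrow> nat list \<Rightarrow> cover" where
  "xp n js = foldr (\<lambda>i a. xx n i \<cdot>\<^bsub>Suc n\<^esub> a) js \<one>\<^bsub>cover_group (Suc n)\<^esub>"

lemma xp_Nil [simp]: "xp n [] = \<one>\<^bsub>cover_group (Suc n)\<^esub>"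
  and xp_Cons: "xp n (j # js) = xx n j \<cdot>\<^bsub>Suc n\<^esub> xp n js"
  by (simp_all add: xp_def)

lemma xp_closed [simp]: "set js \<subseteq> {1..n} \<Longrightarrow> xp n js \<in> carrier (cover_group (Suc n))"
  by (induction js) (auto simp: xp_Cons)

lemma xp_append: "set js \<subseteq> {1..n} \<Longrightarrow> set ks \<subseteq> {1..n} \<Longrightarrow> xp n (js @ ks) = xp n js \<cdot>\<^bsub>Suc n\<^esub> xp n ks"
  by (induction js) (auto simp: xp_Cons cov.m_assoc)

lemma cover_elem_x_words:
  "set js \<subseteq> {1..n} \<Longrightarrow> cover_elem (Suc n) (concat (map (x_word n) js)) = xp n js \<and>
    set (concat (map (x_word n) js)) \<subseteq> cover_gens (Suc n)"
proof (induction js)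
  case Nil
  then show ?case by (simp add: cover_elem_cls pos_word_def one_cover)
next
  case (Cons j js)
  then have "set (x_word n j) \<subseteq> cover_gens (Suc n)" by (intro set_x_word) auto
  then show ?case using Cons by (simp add: cover_elem_append xp_Cons xx_def)
qed

definition valid_cycle :: "nat \<Rightarrow> nat list \<Rightarrow> bool" where
  "valid_cycle n c \<longleftrightarrow> distinct c \<and> set c \<subseteq> {1..n} \<and> 2 \<le> length c"

definition cycle_word :: "nat list \<Rightarrow> nat list" where
  "cycle_word c = hd c # rev (tl c) @ [hd c]"

lemma set_cycle_word: "c \<noteq> [] \<Longrightarrow> set (cycle_word c) = set c"
  by (cases c) (auto simp: cycle_word_def)

lemma length_cycle_word: "c \<noteq> [] \<Longrightarrow> length (cycle_word c) = Suc (length c)"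
  by (cases c) (auto simp: cycle_word_def)

lemma map_cycle_word: "c \<noteq> [] \<Longrightarrow> map f (cycle_word c) = cycle_word (map f c)"
  by (cases c) (auto simp: cycle_word_def rev_map)

lemma valid_cycle_nonempty: "valid_cycle n c \<Longrightarrow> c \<noteq> []"
  by (auto simp: valid_cycle_def)

lemma valid_cycle_word: "valid_cycle n c \<Longrightarrow> set (cycle_word c) \<subseteq> {1..n}"
  by (simp add: set_cycle_word valid_cycle_nonempty) (simp add: valid_cycle_def)

lemma valid_cycle_map:
  assumes "valid_cycle n c" "p permutes {1..n}" shows "valid_cycle n (map p c)"
proof -
  have "p ` set c \<subseteq> {1..n}" using permutes_in_image[OF assms(2)] assms(1) unfolding valid_cycle_def by blast
  then show ?thesis using assms permutes_inj_on[OF assms(2)] by (simp add: valid_cycle_def distinct_map)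
qed

lemma cpar_xp: "set js \<subseteq> {1..n} \<Longrightarrow> cpar (xp n js) \<longleftrightarrow> odd (length js)"
  by (induction js) (auto simp: xp_Cons)

lemma cycle_conj_transpose:
  assumes "distinct (a # l)" "N \<notin> set (a # l)"
  shows "transpose a N \<circ> (cycle_of_list (N # l) \<circ> transpose a N) = cycle_of_list (a # l)"
proof -
  have "transpose a N \<circ> cycle_of_list (N # l) \<circ> inv_into UNIV (transpose a N) = cycle_of_list (map (transpose a N) (N # l))"
    using assms by (intro conjugation_of_cycle) auto
  moreover have "map (transpose a N) l = l"
    using assms by (intro map_idI) (auto simp: transpose_def)
  ultimately show ?thesis by (simp add: comp_def fun_eq_iff)
qed

lemma cperm_xp_rev:
  assumes "distinct l" "set l \<subseteq> {1..n}"
  shows "cperm (xp n (rev l)) = cycle_of_list (Suc n # l)"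
  using assms
proof (induction l)
  case (Cons a l)
  have N: "Suc n \<notin> set (a # l)" using Cons.prems by auto
  have "cperm (xp n (rev (a # l))) = cperm (xp n (rev l)) \<circ> cperm (xp n [a])"
    using Cons.prems by (simp add: xp_append)
  also have "\<dots> = cycle_of_list (Suc n # l) \<circ> transpose a (Suc n)"
    using Cons by (simp add: xp_Cons)
  also have "\<dots> = transpose a (Suc n) \<circ> cycle_of_list (a # l)"
    unfolding cycle_conj_transpose[OF Cons.prems(1) N, symmetric] by (simp add: fun_eq_iff)
  finally show ?case by (simp add: transpose_commute)
qed simp

lemma cperm_cycle_word:
  assumes "valid_cycle n c" shows "cperm (xp n (cycle_word c)) = cycle_of_list c"
proof -
  obtain a l where c: "c = a # l" using valid_cycle_nonempty[OF assms] by (cases c) auto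
  have v: "distinct (a # l)" "set (a # l) \<subseteq> {1..n}" using assms c by (auto simp: valid_cycle_def)
  have "xp n (cycle_word c) = xx n a \<cdot>\<^bsub>Suc n\<^esub> (xp n (rev l) \<cdot>\<^bsub>Suc n\<^esub> xx n a)"
    using v by (simp add: c cycle_word_def xp_Cons xp_append)
  then have "cperm (xp n (cycle_word c)) = transpose a (Suc n) \<circ> (cycle_of_list (Suc n # l) \<circ> transpose a (Suc n))"
    using v by (simp add: cperm_xp_rev)
  also have "\<dots> = cycle_of_list c" unfolding c using v by (intro cycle_conj_transpose) auto
  finally show ?thesis .
qed

text \<open>The defining product fixes \<open>n + 1\<close>, whereas elements of the cosets of the
  \<open>x_i\<close> move it. So it has a preimage under \<open>embed\<close>, and
  \<open>inv_into\<close> returns it.\<close>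

lemma lifted_cycle:
  assumes "valid_cycle n c"
  shows "lifted_cycle n c \<in> carrier (cover_group n)" "embed n (lifted_cycle n c) = xp n (cycle_word c)"
proof -
  let ?g = "xp n (cycle_word c)"
  have set: "set (cycle_word c) \<subseteq> {1..n}" using valid_cycle_word[OF assms] .
  have "cover_elem (Suc n) (x_word n (hd c) @ concat (map (x_word n) (rev (tl c))) @ x_word n (hd c)) = ?g"
    using cover_elem_x_words[OF set] by (simp add: cycle_word_def)
  then have lc: "lifted_cycle n c = inv_into (carrier (cover_group n)) (embed n) ?g"
    by (simp add: lifted_cycle_def)
  have "?g \<in> embed n ` carrier (cover_group n)"
    using cover_Suc_cases[OF xp_closed[OF set]]
  proof (elim disjE)
    assume "\<exists>h\<in>carrier (cover_group n). \<exists>i\<in>{1..n}. ?g = embed n h \<cdot>\<^bsub>Suc n\<^esub> xx n i"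
    then obtain h i where h: "h \<in> carrier (cover_group n)" "i \<in> {1..n}" "?g = embed n h \<cdot>\<^bsub>Suc n\<^esub> xx n i" by blast
    have "cperm ?g (Suc n) = Suc n"
      using assms by (auto simp: cperm_cycle_word valid_cycle_def intro!: id_outside_supp)
    then have "cperm h i = Suc n" using h by simp
    then show ?thesis using cperm_in[OF h(1), of i] h(2) by simp
  qed blast
  then show "lifted_cycle n c \<in> carrier (cover_group n)" "embed n (lifted_cycle n c) = ?g"
    unfolding lc by (rule inv_into_into, rule f_inv_into_f)
qed

lemma cperm_lifted_cycle [simp]: "valid_cycle n c \<Longrightarrow> cperm (lifted_cycle n c) = cycle_of_list c"
  using lifted_cycle[of n c] cperm_cycle_word[of n c] cperm_embed by metis

lemma cpar_lifted_cycle [simp]: "valid_cycle n c \<Longrightarrow> cpar (lifted_cycle n c) \<longleftrightarrow> even (length c)"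
  using lifted_cycle[of n c] cpar_xp[OF valid_cycle_word, of n c] cpar_embed[of "lifted_cycle n c" n]
  by (simp add: length_cycle_word valid_cycle_nonempty)

lemma embed_xp:
  assumes g: "g \<in> carrier (cover_group n)" and "set js \<subseteq> {1..n}"
  shows "embed n g \<cdot>\<^bsub>Suc n\<^esub> xp n js =
    zs (Suc n) (cpar g \<and> odd (length js)) \<cdot>\<^bsub>Suc n\<^esub> (xp n (map (cperm g) js) \<cdot>\<^bsub>Suc n\<^esub> embed n g)"
  using assms(2)
proof (induction js)
  case Nil
  then show ?case using g by simp
next
  case (Cons j js)
  let ?N = "Suc n"
  have js: "set js \<subseteq> {1..n}" and j: "1 \<le> j" "j \<le> n" using Cons.prems by auto
  have js': "set (map (cperm g) js) \<subseteq> {1..n}" and j': "1 \<le> cperm g j" "cperm g j \<le> n"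
    using cperm_in[OF g] js j by auto
  have "embed n g \<cdot>\<^bsub>?N\<^esub> xp n (j # js) = (embed n g \<cdot>\<^bsub>?N\<^esub> xx n j) \<cdot>\<^bsub>?N\<^esub> xp n js"
    using g js j by (simp add: xp_Cons cov.m_assoc)
  also have "\<dots> = zs ?N (cpar g) \<cdot>\<^bsub>?N\<^esub> (xx n (cperm g j) \<cdot>\<^bsub>?N\<^esub> (embed n g \<cdot>\<^bsub>?N\<^esub> xp n js))"
    unfolding embed_xx[OF g j] using g js j' by (simp add: cov.m_assoc)
  also have "\<dots> = zs ?N (cpar g) \<cdot>\<^bsub>?N\<^esub> (zs ?N (cpar g \<and> odd (length js)) \<cdot>\<^bsub>?N\<^esub>
      (xx n (cperm g j) \<cdot>\<^bsub>?N\<^esub> (xp n (map (cperm g) js) \<cdot>\<^bsub>?N\<^esub> embed n g)))"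
    unfolding Cons.IH[OF js] using g js' j' by (simp add: zs_left[of "xx n (cperm g j)"])
  also have "\<dots> = zs ?N (cpar g \<noteq> (cpar g \<and> odd (length js))) \<cdot>\<^bsub>?N\<^esub> (xp n (map (cperm g) (j # js)) \<cdot>\<^bsub>?N\<^esub> embed n g)"
    using g js' j' by (simp add: zs_zs_left xp_Cons cov.m_assoc)
  also have "(cpar g \<noteq> (cpar g \<and> odd (length js))) = (cpar g \<and> odd (length (j # js)))" by auto
  finally show ?case .
qed

text \<open>The word of a cycle has one factor more than the cycle has entries, and an odd
  \<open>g\<close> picks up \<open>z\<close> at every factor. So a sign survives only for odd
  \<open>g\<close> and a cycle of even length.\<close>

lemma mult_lifted_cycle:
  assumes g: "g \<in> carrier (cover_group n)" and c: "valid_cycle n c"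
  shows "g \<cdot>\<^bsub>n\<^esub> lifted_cycle n c =
    zs n (cpar g \<and> even (length c)) \<cdot>\<^bsub>n\<^esub> (lifted_cycle n (map (cperm g) c) \<cdot>\<^bsub>n\<^esub> g)"
proof -
  have v: "valid_cycle n (map (cperm g) c)" using valid_cycle_map[OF c cperm_permutes[OF g]] .
  show ?thesis
    by (rule inj_onD[OF inj_embed[of n]])
      (use g c v embed_xp[OF g valid_cycle_word[OF c]] in
        \<open>simp_all add: embed_mult lifted_cycle embed_zs map_cycle_word length_cycle_word valid_cycle_nonempty\<close>)
qed

lemma mult_lifted_cycle_disjoint:
  assumes "g \<in> carrier (cover_group n)" "valid_cycle n c" "\<And>x. x \<in> set c \<Longrightarrow> cperm g x = x"
  shows "g \<cdot>\<^bsub>n\<^esub> lifted_cycle n c = zs n (cpar g \<and> even (length c)) \<cdot>\<^bsub>n\<^esub> (lifted_cycle n c \<cdot>\<^bsub>n\<^esub> g)"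
proof -
  have "map (cperm g) c = c" using assms(3) by (intro map_idI) auto
  then show ?thesis using mult_lifted_cycle[OF assms(1,2)] by simp
qed

text \<open>Conjugating a cycle by itself rotates its entries, and an odd length leaves no
  sign.\<close>

lemma lifted_cycle_rotate1:
  assumes "valid_cycle n c" "odd (length c)"
  shows "lifted_cycle n (rotate1 c) = lifted_cycle n c"
proof -
  have "map (cycle_of_list c) c = rotate1 c"
    using cyclic_rotation[of c 1] assms by (simp add: valid_cycle_def)
  moreover have "valid_cycle n (rotate1 c)" using assms by (simp add: valid_cycle_def)
  ultimately show ?thesis
    using mult_lifted_cycle[of "lifted_cycle n c" n c] assms by (simp add: lifted_cycle)
qed

lemma lifted_cycle_rotate:
  assumes "valid_cycle n c" "odd (length c)"
  shows "lifted_cycle n (rotate k c) = lifted_cycle n c"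
proof (induction k)
  case (Suc k)
  have "valid_cycle n (rotate k c)" using assms by (simp add: valid_cycle_def)
  then show ?case using Suc lifted_cycle_rotate1[of n "rotate k c"] assms by simp
qed simp


subsection \<open>Star factorizations of lifted cycles\<close>

definition star_prod :: "nat \<Rightarrow> nat \<Rightarrow> nat list \<Rightarrow> cover" where
  "star_prod n k is = foldr (\<lambda>i a. lifted_cycle n [i, k] \<cdot>\<^bsub>n\<^esub> a) is \<one>\<^bsub>cover_group n\<^esub>"

lemma star_prod_Nil [simp]: "star_prod n k [] = \<one>\<^bsub>cover_group n\<^esub>"
  and star_prod_Cons: "star_prod n k (i # is) = lifted_cycle n [i, k] \<cdot>\<^bsub>n\<^esub> star_prod n k is"
  by (simp_all add: star_prod_def)

lemma star_prod_closed [simp]: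
  "set is \<subseteq> {1..n} - {k} \<Longrightarrow> k \<in> {1..n} \<Longrightarrow> star_prod n k is \<in> carrier (cover_group n)"
  by (induction "is") (auto simp: star_prod_Cons valid_cycle_def intro!: cov.m_closed lifted_cycle)

text \<open>Moving \<open>x_k\<close> past the lifted transposition turns it into \<open>x_i\<close>
  with a \<open>z\<close>; cancelling \<open>x_i\<close> on the left leaves the claim. Swapping the
  two entries of a lifted transposition thus costs \<open>z\<close>.\<close>

lemma transposition_word:
  assumes "i \<in> {1..n}" "k \<in> {1..n}" "i \<noteq> k"
  shows "xp n [i, k, i] = zz (Suc n) \<cdot>\<^bsub>Suc n\<^esub> xp n [k, i, k]"
proof -
  let ?N = "Suc n"
  let ?g = "lifted_cycle n [i, k]"
  have v: "valid_cycle n [i, k]" using assms by (auto simp: valid_cycle_def)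
  have g: "embed n ?g = xp n [i, k, i]" using lifted_cycle(2)[OF v] by (simp add: cycle_word_def)
  have "embed n ?g \<cdot>\<^bsub>?N\<^esub> xx n k = zz ?N \<cdot>\<^bsub>?N\<^esub> (xx n i \<cdot>\<^bsub>?N\<^esub> embed n ?g)"
    using embed_xx[of ?g n k] lifted_cycle(1)[OF v] assms v by simp
  then have "xx n i \<cdot>\<^bsub>?N\<^esub> xp n [k, i, k] = xx n i \<cdot>\<^bsub>?N\<^esub> (zz ?N \<cdot>\<^bsub>?N\<^esub> xp n [i, k, i])"
    unfolding g using assms by (simp add: xp_Cons cov.m_assoc zz_past)
  then have "xp n [k, i, k] = zz ?N \<cdot>\<^bsub>?N\<^esub> xp n [i, k, i]"
    using assms by (subst (asm) cov.Units_l_cancel) (auto simp: xp_Cons cov.Units_eq)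
  then show ?thesis using assms by (simp add: zz_zz_left)
qed

text \<open>Each of the m factors is \<open>z x_k x_i x_k\<close>, and each of the m - 1 adjacent
  pairs \<open>x_k x_k\<close> is another \<open>z\<close>. The total power 2m - 1 is odd.\<close>

lemma star_prod_word:
  assumes "set is \<subseteq> {1..n} - {k}" "k \<in> {1..n}" "is \<noteq> []"
  shows "embed n (star_prod n k is) = zz (Suc n) \<cdot>\<^bsub>Suc n\<^esub> xp n (k # is @ [k])"
  using assms
proof (induction "is")
  case (Cons i "is")
  let ?N = "Suc n"
  have v: "valid_cycle n [i, k]" and i: "i \<in> {1..n}" "i \<noteq> k" using Cons.prems by (auto simp: valid_cycle_def)
  have e: "embed n (lifted_cycle n [i, k]) = zz ?N \<cdot>\<^bsub>?N\<^esub> xp n [k, i, k]"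
    using lifted_cycle(2)[OF v] transposition_word[OF i(1) Cons.prems(2) i(2)] by (simp add: cycle_word_def)
  have eq: "embed n (star_prod n k (i # is)) = embed n (lifted_cycle n [i, k]) \<cdot>\<^bsub>?N\<^esub> embed n (star_prod n k is)"
    using Cons.prems lifted_cycle(1)[OF v] by (simp add: star_prod_Cons embed_mult)
  show ?case
  proof (cases "is = []")
    case True
    then show ?thesis using e eq Cons.prems by (simp add: embed_one xp_Cons)
  next
    case False
    then have "embed n (star_prod n k is) = zz ?N \<cdot>\<^bsub>?N\<^esub> xp n (k # is @ [k])" using Cons by simp
    moreover have "set is \<subseteq> {1..n}" using Cons.prems by auto
    ultimately show ?thesis unfolding eq e using Cons.prems
      by (simp add: xp_Cons xp_append cov.m_assoc zz_past xx_xx_left zz_zz_left)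
  qed
qed simp

text \<open>The key to the leading coefficients of the symmetric functions in the Jucys-Murphy elements.\<close>

lemma star_prod_cycle:
  assumes "set is \<subseteq> {1..n} - {k}" "k \<in> {1..n}" "is \<noteq> []" "distinct is"
  shows "star_prod n k is = zz n \<cdot>\<^bsub>n\<^esub> lifted_cycle n (k # rev is)"
proof -
  have v: "valid_cycle n (k # rev is)"
    using assms by (cases "is") (auto simp: valid_cycle_def)
  show ?thesis
    by (rule inj_onD[OF inj_embed[of n]])
      (use assms v lifted_cycle[OF v] in \<open>simp_all add: star_prod_word embed_mult embed_zz cycle_word_def\<close>)
qed


subsection \<open>Products of disjoint lifted cycles\<close>

definition valid_cycles :: "nat \<Rightarrow> nat list list \<Rightarrow> bool" where
  "valid_cycles n cs \<longleftrightarrow> distinct (concat cs) \<and> (\<forall>c\<in>set cs. valid_cycle n c)"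

definition cprod :: "nat \<Rightarrow> nat list list \<Rightarrow> cover" where
  "cprod n cs = foldr (\<lambda>c g. lifted_cycle n c \<cdot>\<^bsub>n\<^esub> g) cs \<one>\<^bsub>cover_group n\<^esub>"

definition cyc :: "nat list list \<Rightarrow> nat \<Rightarrow> nat" where
  "cyc cs = foldr (\<lambda>c f. cycle_of_list c \<circ> f) cs id"

lemma cprod_Nil [simp]: "cprod n [] = \<one>\<^bsub>cover_group n\<^esub>"
  and cprod_Cons: "cprod n (c # cs) = lifted_cycle n c \<cdot>\<^bsub>n\<^esub> cprod n cs"
  by (simp_all add: cprod_def)

lemma cyc_Nil [simp]: "cyc [] = id"
  and cyc_Cons: "cyc (c # cs) = cycle_of_list c \<circ> cyc cs"
  by (simp_all add: cyc_def)

lemma cprod_closed [simp]: "\<forall>c\<in>set cs. valid_cycle n c \<Longrightarrow> cprod n cs \<in> carrier (cover_group n)"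
  by (induction cs) (auto simp: cprod_Cons lifted_cycle)

lemma cprod_append:
  "\<forall>c\<in>set cs. valid_cycle n c \<Longrightarrow> \<forall>c\<in>set ds. valid_cycle n c \<Longrightarrow> cprod n (cs @ ds) = cprod n cs \<cdot>\<^bsub>n\<^esub> cprod n ds"
  by (induction cs) (auto simp: cprod_Cons lifted_cycle cov.m_assoc)

lemma cperm_cprod: "\<forall>c\<in>set cs. valid_cycle n c \<Longrightarrow> cperm (cprod n cs) = cyc cs"
  by (induction cs) (auto simp: cprod_Cons cyc_Cons lifted_cycle)

lemma cpar_cprod_odd: "\<forall>c\<in>set cs. valid_cycle n c \<and> odd (length c) \<Longrightarrow> \<not> cpar (cprod n cs)"
  by (induction cs) (auto simp: cprod_Cons lifted_cycle)

lemma cyc_outside: "x \<notin> set (concat cs) \<Longrightarrow> cyc cs x = x"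
  by (induction cs) (auto simp: cyc_Cons id_outside_supp)

lemma cyc_inside: "distinct (concat cs) \<Longrightarrow> c \<in> set cs \<Longrightarrow> x \<in> set c \<Longrightarrow> cyc cs x = cycle_of_list c x"
proof (induction cs)
  case (Cons d cs)
  show ?case
  proof (cases "c = d")
    case True
    then have "x \<notin> set (concat cs)" using Cons.prems by auto
    then show ?thesis using True by (simp add: cyc_Cons cyc_outside)
  next
    case False
    then have c: "c \<in> set cs" using Cons.prems by simp
    then have "cycle_of_list c x \<in> set c" using Cons.prems(1,3) cycle_permutes permutes_in_image by metis
    then have "cycle_of_list c x \<notin> set d" using Cons.prems c by auto
    then show ?thesis using Cons c by (simp add: cyc_Cons id_outside_supp)
  qed
qed simp

lemma cyc_set_cong:
  assumes "distinct (concat cs)" "distinct (concat ds)" "set cs = set ds" shows "cyc cs = cyc ds"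
proof
  fix x show "cyc cs x = cyc ds x"
    using assms cyc_inside[OF assms(1)] cyc_inside[OF assms(2)] cyc_outside[of x cs] cyc_outside[of x ds]
    by (cases "x \<in> set (concat cs)") auto
qed

lemma cyc_map_rotate1:
  assumes "distinct (concat cs)" "c \<in> set cs" shows "map (cyc cs) c = rotate1 c"
proof -
  have "distinct c" using assms by (auto simp: distinct_concat_iff)
  then have "map (cycle_of_list c) c = rotate1 c" using cyclic_rotation[of c 1] by simp
  moreover have "map (cyc cs) c = map (cycle_of_list c) c" using assms by (auto intro: cyc_inside)
  ultimately show ?thesis by simp
qed

lemma map_funpow_rotate: "map w c = rotate1 c \<Longrightarrow> map (w ^^ k) c = rotate k c"
proof (induction k)
  case (Suc k)
  have "map (w ^^ Suc k) c = map w (map (w ^^ k) c)" by simp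
  also have "\<dots> = rotate k (map w c)" unfolding Suc.IH[OF Suc.prems] by (simp add: rotate_map)
  also have "\<dots> = rotate (Suc k) c" using Suc.prems by (simp add: rotate1_rotate_swap)
  finally show ?case .
qed simp

lemma orbit_list_nth: "map w c = rotate1 c \<Longrightarrow> c \<noteq> [] \<Longrightarrow> (w ^^ k) (hd c) = c ! (k mod length c)"
  using map_funpow_rotate[of w c k] by (metis hd_rotate_conv_nth list.map_sel(1))

text \<open>A list that \<open>w\<close> rotates is an orbit of \<open>w\<close> read off from its
  head, and its length is the time of first return. Both are determined by \<open>w\<close> and the
  head.\<close>

lemma orbit_list_unique:
  assumes "map w c = rotate1 c" "map w d = rotate1 d" "hd c = hd d" "c \<noteq> []" "d \<noteq> []" "distinct c" "distinct d"
  shows "c = d"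
proof -
  have le: "length d \<le> length c" if "map w c = rotate1 c" "map w d = rotate1 d" "hd c = hd d"
    "c \<noteq> []" "d \<noteq> []" "distinct d" for c d :: "'a list"
  proof (rule ccontr)
    assume less: "\<not> length d \<le> length c"
    have "d ! length c = (w ^^ length c) (hd d)" using orbit_list_nth[OF that(2,5)] less by simp
    also have "\<dots> = c ! 0" using orbit_list_nth[OF that(1,4), of "length c"] that(3) by simp
    also have "\<dots> = d ! 0" using that(3,4,5) by (simp add: hd_conv_nth)
    finally have "length c = 0" using less that(5,6) by (subst (asm) nth_eq_iff_index_eq) auto
    then show False using that(4) by simp
  qed
  have len: "length c = length d" using le[of c d] le[of d c] assms by simp
  show ?thesis
  proof (rule nth_equalityI[OF len])
    fix k assume "k < length c"
    then show "c ! k = d ! k"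
      using orbit_list_nth[OF assms(1,4), of k] orbit_list_nth[OF assms(2,5), of k] len assms(3) by simp
  qed
qed

lemma cyc_moves: "distinct (concat cs) \<Longrightarrow> c \<in> set cs \<Longrightarrow> 2 \<le> length c \<Longrightarrow> x \<in> set c \<Longrightarrow> cyc cs x \<noteq> x"
proof -
  assume cs: "distinct (concat cs)" "c \<in> set cs" "2 \<le> length c" "x \<in> set c"
  obtain k where k: "k < length c" "x = c ! k" using cs(4) by (metis in_set_conv_nth)
  have d: "distinct c" using cs by (auto simp: distinct_concat_iff)
  have "map (cyc cs) c ! k = rotate 1 c ! k" using cyc_map_rotate1[OF cs(1,2)] by simp
  then have "cyc cs x = c ! (Suc k mod length c)" using k by (simp add: nth_rotate del: rotate_Suc)
  moreover have "Suc k mod length c \<noteq> k" using k(1) cs(3) by (cases "Suc k = length c") auto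
  moreover have "Suc k mod length c < length c" using cs(3) by (intro mod_less_divisor) linarith
  ultimately show ?thesis using k d by (simp add: nth_eq_iff_index_eq)
qed

lemma valid_cycles_Cons: "valid_cycles n (c # cs) \<longleftrightarrow>
    valid_cycle n c \<and> valid_cycles n cs \<and> set c \<inter> set (concat cs) = {}"
  by (auto simp: valid_cycles_def valid_cycle_def)

lemma rotate_to_hd:
  assumes "x \<in> set c" shows "\<exists>k. hd (rotate k c) = x"
proof -
  obtain a b where "c = a @ x # b" using split_list[OF assms] by blast
  then have "rotate (length a) c = x # b @ a" by (simp add: rotate_append)
  then show ?thesis by (intro exI[of _ "length a"]) simp
qed

text \<open>Lifts of odd cycles are even elements, so disjoint ones commute and each may be rotated
  without a sign. The induction finds in \<open>ds\<close> the cycle through \<open>hd c\<close>,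
  rotates it into \<open>c\<close>, moves it to the front and cancels it.\<close>

lemma cprod_unique:
  assumes "valid_cycles n cs" "valid_cycles n ds" "\<forall>c\<in>set cs. odd (length c)" "\<forall>c\<in>set ds. odd (length c)"
    and "cyc cs = cyc ds"
  shows "cprod n cs = cprod n ds \<and> mset (map length cs) = mset (map length ds)"
  using assms
proof (induction cs arbitrary: ds)
  case Nil
  have "ds = []"
  proof (rule ccontr)
    assume "ds \<noteq> []"
    then obtain d where d: "d \<in> set ds" by (cases ds) auto
    then have "valid_cycle n d" using Nil by (auto simp: valid_cycles_def)
    then have "2 \<le> length d" "hd d \<in> set d" by (auto simp: valid_cycle_def intro!: hd_in_set)
    then have "cyc ds (hd d) \<noteq> hd d"
      using Nil.prems(2) d by (intro cyc_moves[of ds d]) (simp_all add: valid_cycles_def)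
    then show False using Nil by (metis cyc_Nil id_apply)
  qed
  then show ?case by simp
next
  case (Cons c cs)
  let ?w = "cyc ds"
  have c: "valid_cycle n c" "c \<noteq> []" "distinct c" and cs: "valid_cycles n cs"
    using Cons.prems(1) by (auto simp: valid_cycles_Cons valid_cycle_def)
  have dc: "distinct (concat (c # cs))" and dd: "distinct (concat ds)"
    using Cons.prems by (auto simp: valid_cycles_def)
  have wc: "map ?w c = rotate1 c" using cyc_map_rotate1[OF dc, of c] Cons.prems(5) by simp
  have "?w (hd c) \<noteq> hd c"
    using cyc_moves[OF dc, of c "hd c"] c Cons.prems(5) by (simp add: valid_cycle_def)
  then have "hd c \<in> set (concat ds)" using cyc_outside by blast
  then obtain d where d: "d \<in> set ds" "hd c \<in> set d" by auto
  obtain us vs where ds: "ds = us @ d # vs" using split_list[OF d(1)] by blast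
  obtain k where k: "hd (rotate k d) = hd c" using rotate_to_hd[OF d(2)] by blast
  have vd: "valid_cycle n d" and od: "odd (length d)" using Cons.prems d by (auto simp: valid_cycles_def)
  have vu: "\<forall>c\<in>set us. valid_cycle n c" and vv: "\<forall>c\<in>set vs. valid_cycle n c"
    using Cons.prems(2) ds by (auto simp: valid_cycles_def)
  have "map ?w (rotate k d) = rotate1 (rotate k d)"
    using cyc_map_rotate1[OF dd d(1)] by (simp add: rotate1_rotate_swap flip: rotate_map)
  moreover have "rotate k d \<noteq> []" "distinct (rotate k d)" using vd by (auto simp: valid_cycle_def)
  ultimately have cd: "c = rotate k d"
    using orbit_list_unique[OF wc _ k[symmetric] c(2) _ c(3)] by blast
  have fix_d: "cyc us x = x" if "x \<in> set d" for x
    using that dd ds by (intro cyc_outside) auto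
  have "cprod n us \<cdot>\<^bsub>n\<^esub> lifted_cycle n d = lifted_cycle n d \<cdot>\<^bsub>n\<^esub> cprod n us"
    using mult_lifted_cycle_disjoint[of "cprod n us" n d] fix_d vu vd od
    by (simp add: cperm_cprod lifted_cycle)
  then have prod_ds: "cprod n ds = lifted_cycle n c \<cdot>\<^bsub>n\<^esub> cprod n (us @ vs)"
    using ds vu vv vd lifted_cycle[OF vd] lifted_cycle_rotate[OF vd od, of k] cd
    by (simp add: cprod_append cprod_Cons flip: cov.m_assoc)
  have "cyc (c # cs) = cycle_of_list c \<circ> cyc (us @ vs)"
    using arg_cong[OF prod_ds, of cperm] Cons.prems(2,5) c vu vv lifted_cycle[OF c(1)]
    by (simp add: cperm_cprod valid_cycles_def ball_Un comp_def)
  then have "cycle_of_list c \<circ> cyc cs = cycle_of_list c \<circ> cyc (us @ vs)" by (simp add: cyc_Cons)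
  then have "cyc cs = cyc (us @ vs)"
    using fun.inj_map_strong permutes_inj[OF cycle_permutes, of c] by (metis fun.map_comp inj_iff fun.map_id)
  moreover have "valid_cycles n (us @ vs)" using Cons.prems(2) ds by (auto simp: valid_cycles_def)
  ultimately have "cprod n cs = cprod n (us @ vs) \<and> mset (map length cs) = mset (map length (us @ vs))"
    using Cons.prems ds cs by (intro Cons.IH) auto
  then show ?case using prod_ds ds cd by (simp add: cprod_Cons)
qed

lemma permutes_cyc:
  assumes "p permutes {1..n}"
  shows "\<exists>cs. valid_cycles n cs \<and> cyc cs = p"
proof -
  have "\<exists>cs. valid_cycles n cs \<and> cyc cs = p \<and> set (concat cs) \<subseteq> S" if "cycle_decomp S p" "S \<subseteq> {1..n}" for S p
    using that
  proof (induction rule: cycle_decomp.induct)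
    case empty
    show ?case by (rule exI[of _ "[]"]) (simp add: valid_cycles_def)
  next
    case (comp I p c)
    then obtain cs where cs: "valid_cycles n cs" "cyc cs = p" "set (concat cs) \<subseteq> I" by auto
    show ?case
    proof (cases "2 \<le> length c")
      case True
      then have "valid_cycles n (c # cs)" using comp cs by (auto simp: valid_cycles_Cons valid_cycle_def)
      then show ?thesis using cs by (intro exI[of _ "c # cs"]) (auto simp: cyc_Cons)
    next
      \<comment> \<open>Cycles with fewer than two entries act trivially and are dropped, since
        \<open>valid_cycle\<close> excludes them.\<close>
      case False
      then have "cycle_of_list c = id" by (cases c rule: cycle_of_list.cases) auto
      then show ?thesis using cs by auto
    qed
  qed
  then show ?thesis using cycle_decomposition[OF assms] by blast
qed

lemma cover_decomposition:
  assumes "g \<in> carrier (cover_group n)"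
  shows "\<exists>cs b. valid_cycles n cs \<and> sorted_wrt (\<ge>) (map length cs) \<and> g = zs n b \<cdot>\<^bsub>n\<^esub> cprod n cs"
proof -
  obtain ds where ds: "valid_cycles n ds" "cyc ds = cperm g"
    using permutes_cyc[OF cperm_permutes[OF assms]] by blast
  define cs where "cs = rev (sort_key length ds)"
  have m: "mset cs = mset ds" by (simp add: cs_def)
  then have "mset (concat cs) = mset (concat ds)" by (metis mset_concat mset_map sum_mset_sum_list)
  then have "distinct (concat cs)" using ds(1) mset_eq_imp_distinct_iff unfolding valid_cycles_def by blast
  then have cs: "valid_cycles n cs" using ds(1) m by (auto simp: valid_cycles_def dest: mset_eq_setD)
  have "cyc cs = cyc ds"
    using ds(1) cs mset_eq_setD[OF m] cyc_set_cong unfolding valid_cycles_def by blast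
  moreover have "cperm (cprod n cs) = cyc cs"
    using cs by (intro cperm_cprod) (simp add: valid_cycles_def)
  ultimately have "cperm (cprod n cs) = cperm g" using ds(2) by simp
  then have "g = cprod n cs \<or> g = zz n \<cdot>\<^bsub>n\<^esub> cprod n cs"
    using cs assms by (intro cperm_eq) (simp_all add: valid_cycles_def)
  moreover have "sorted_wrt (\<ge>) (map length cs)"
    unfolding cs_def by (simp add: sorted_wrt_rev flip: rev_map)
  moreover have "zs n False \<cdot>\<^bsub>n\<^esub> cprod n cs = cprod n cs" "zs n True \<cdot>\<^bsub>n\<^esub> cprod n cs = zz n \<cdot>\<^bsub>n\<^esub> cprod n cs"
    using cs by (simp_all add: valid_cycles_def)
  ultimately show ?thesis using cs by metis
qed

lemma cperm_surj: "p permutes {1..n} \<Longrightarrow> \<exists>g\<in>carrier (cover_group n). cperm g = p"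
  using permutes_cyc[of p n] by (metis cperm_cprod cprod_closed valid_cycles_def)

lemma mult_cprod:
  assumes g: "g \<in> carrier (cover_group n)" and cs: "\<forall>c\<in>set cs. valid_cycle n c \<and> odd (length c)"
  shows "g \<cdot>\<^bsub>n\<^esub> cprod n cs = cprod n (map (map (cperm g)) cs) \<cdot>\<^bsub>n\<^esub> g"
  using cs
proof (induction cs)
  case (Cons c cs)
  have v: "valid_cycle n (map (cperm g) c)" and vs: "\<forall>d\<in>set (map (map (cperm g)) cs). valid_cycle n d"
    using Cons.prems valid_cycle_map cperm_permutes[OF g] by auto
  have c: "valid_cycle n c" "odd (length c)" using Cons.prems by auto
  have "g \<cdot>\<^bsub>n\<^esub> cprod n (c # cs) = (g \<cdot>\<^bsub>n\<^esub> lifted_cycle n c) \<cdot>\<^bsub>n\<^esub> cprod n cs"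
    using g c Cons.prems by (simp add: cprod_Cons cov.m_assoc lifted_cycle)
  also have "\<dots> = lifted_cycle n (map (cperm g) c) \<cdot>\<^bsub>n\<^esub> (g \<cdot>\<^bsub>n\<^esub> cprod n cs)"
    using g c Cons.prems v by (simp add: mult_lifted_cycle cov.m_assoc lifted_cycle)
  also have "\<dots> = cprod n (map (map (cperm g)) (c # cs)) \<cdot>\<^bsub>n\<^esub> g"
    using g Cons v vs by (simp add: cprod_Cons cov.m_assoc lifted_cycle)
  finally show ?case .
qed (use g in simp)

text \<open>The lifted cycle passes itself freely and passes the other factors with a sign given by
  their parity. As \<open>g\<close> is even and the cycle is an odd element, the remaining factors
  are odd in total.\<close>

lemma even_cycle_anticommute:
  assumes cs: "valid_cycles n cs" and g: "g = zs n b \<cdot>\<^bsub>n\<^esub> cprod n cs" and even: "\<not> cpar g"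
    and c: "c \<in> set cs" "even (length c)"
  shows "lifted_cycle n c \<cdot>\<^bsub>n\<^esub> g = zz n \<cdot>\<^bsub>n\<^esub> (g \<cdot>\<^bsub>n\<^esub> lifted_cycle n c)"
proof -
  obtain us vs where eq: "cs = us @ c # vs" using split_list[OF c(1)] by blast
  let ?c = "lifted_cycle n c" and ?u = "cprod n us" and ?v = "cprod n vs"
  have vc: "valid_cycle n c" and vu: "\<forall>c\<in>set us. valid_cycle n c" and vv: "\<forall>c\<in>set vs. valid_cycle n c"
    using cs eq by (auto simp: valid_cycles_def)
  have [simp]: "?c \<in> carrier (cover_group n)" "?u \<in> carrier (cover_group n)" "?v \<in> carrier (cover_group n)"
    using vc vu vv by (auto simp: lifted_cycle)
  have dis: "x \<notin> set (concat us)" "x \<notin> set (concat vs)" if "x \<in> set c" for x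
    using cs eq that by (auto simp: valid_cycles_def)
  have "cperm ?u x = x" "cperm ?v x = x" if "x \<in> set c" for x
    using dis[OF that] cyc_outside unfolding cperm_cprod[OF vu] cperm_cprod[OF vv] by blast+
  then have u: "?u \<cdot>\<^bsub>n\<^esub> ?c = zs n (cpar ?u) \<cdot>\<^bsub>n\<^esub> (?c \<cdot>\<^bsub>n\<^esub> ?u)"
    and v: "?v \<cdot>\<^bsub>n\<^esub> ?c = zs n (cpar ?v) \<cdot>\<^bsub>n\<^esub> (?c \<cdot>\<^bsub>n\<^esub> ?v)"
    using mult_lifted_cycle_disjoint[of ?u n c] mult_lifted_cycle_disjoint[of ?v n c] vc c(2) by simp_all
  have u': "?c \<cdot>\<^bsub>n\<^esub> ?u = zs n (cpar ?u) \<cdot>\<^bsub>n\<^esub> (?u \<cdot>\<^bsub>n\<^esub> ?c)" and v': "?c \<cdot>\<^bsub>n\<^esub> ?v = zs n (cpar ?v) \<cdot>\<^bsub>n\<^esub> (?v \<cdot>\<^bsub>n\<^esub> ?c)"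
    unfolding u v by (simp_all add: zs_zs_left)
  have prod: "cprod n cs = ?u \<cdot>\<^bsub>n\<^esub> (?c \<cdot>\<^bsub>n\<^esub> ?v)"
    using eq vc vu vv by (simp add: cprod_append cprod_Cons)
  have par: "cpar ?u \<noteq> cpar ?v" using even vc c by (simp add: g prod)
  have "?c \<cdot>\<^bsub>n\<^esub> cprod n cs = (?c \<cdot>\<^bsub>n\<^esub> ?u) \<cdot>\<^bsub>n\<^esub> (?c \<cdot>\<^bsub>n\<^esub> ?v)"
    by (simp add: prod cov.m_assoc)
  also have "\<dots> = zs n (cpar ?u) \<cdot>\<^bsub>n\<^esub> (zs n (cpar ?v) \<cdot>\<^bsub>n\<^esub> (?u \<cdot>\<^bsub>n\<^esub> (?c \<cdot>\<^bsub>n\<^esub> (?v \<cdot>\<^bsub>n\<^esub> ?c))))"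
    unfolding u' v' by (simp add: cov.m_assoc zs_left[of ?u] zs_left[of ?c])
  also have "\<dots> = zz n \<cdot>\<^bsub>n\<^esub> (cprod n cs \<cdot>\<^bsub>n\<^esub> ?c)"
    using par by (simp add: zs_zs_left prod cov.m_assoc)
  finally show ?thesis unfolding g
    using vc vu vv by (simp add: prod zs_left[of ?c] zs_left[of "zz n"] cov.m_assoc)
qed


subsection \<open>Minimal factorizations into transpositions\<close>

definition tprod :: "(nat \<times> nat) list \<Rightarrow> nat \<Rightarrow> nat" where
  "tprod ts = foldr (\<lambda>(i, k) f. transpose i k \<circ> f) ts id"

lemma tprod_Nil [simp]: "tprod [] = id"
  and tprod_Cons: "tprod ((i, k) # ts) = transpose i k \<circ> tprod ts"
  by (simp_all add: tprod_def)

lemma tprod_append: "tprod (ts @ us) = tprod ts \<circ> tprod us"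
  by (induction ts) (auto simp: tprod_Cons o_assoc)

text \<open>Labels stand for connected components of the graph with edges \<open>ts\<close>. One
  more edge merges at most two components, so it lowers the number of labels by at most one.\<close>

lemma label_exists:
  assumes "finite A"
  shows "\<exists>f :: 'a \<Rightarrow> 'a. (\<forall>(i, k)\<in>set ts. f i = f k) \<and> card A \<le> card (f ` A) + length ts"
proof (induction ts)
  case Nil
  show ?case by (rule exI[of _ id]) simp
next
  case (Cons t ts)
  obtain a b where t: "t = (a, b)" by fastforce
  obtain f :: "'a \<Rightarrow> 'a" where f: "\<forall>(i, k)\<in>set ts. f i = f k" "card A \<le> card (f ` A) + length ts"
    using Cons.IH by blast
  \<comment> \<open>The component of \<open>b\<close> is relabelled as that of \<open>a\<close>, so
    a single label can disappear.\<close>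
  define g where "g = (\<lambda>x. if f x = f b then f a else f x)"
  have "f ` A \<subseteq> insert (f b) (g ` A)" by (auto simp: g_def)
  then have "card (f ` A) \<le> card (insert (f b) (g ` A))" using assms by (intro card_mono) auto
  also have "\<dots> \<le> Suc (card (g ` A))" by (simp add: card_insert_if assms)
  finally have "card A \<le> card (g ` A) + length (t # ts)" using f(2) by simp
  moreover have "\<forall>(i, k)\<in>set (t # ts). g i = g k" using f(1) t by (auto simp: g_def)
  ultimately show ?case by blast
qed

lemma label_tprod: "\<forall>(i, k)\<in>set ts. f i = f k \<Longrightarrow> f (tprod ts x) = f x"
proof (induction ts)
  case (Cons t ts)
  obtain i k where t: "t = (i, k)" by fastforce
  have "f (transpose i k y) = f y" for y using Cons.prems t by (simp add: transpose_def)
  then show ?case using Cons t by (simp add: tprod_Cons)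
qed simp

lemma tprod_moves:
  assumes "tprod ts x \<noteq> x" obtains i k where "(i, k) \<in> set ts" "x = i \<or> x = k"
proof -
  have "tprod ts x = x" if "\<forall>(i, k)\<in>set ts. x \<noteq> i \<and> x \<noteq> k"
    using that by (induction ts) (auto simp: tprod_Cons)
  then show ?thesis using assms that by blast
qed

lemma distinct_concat_same:
  "distinct (concat cs) \<Longrightarrow> c \<in> set cs \<Longrightarrow> d \<in> set cs \<Longrightarrow> x \<in> set c \<Longrightarrow> x \<in> set d \<Longrightarrow> c = d"
  by (auto simp: distinct_concat_iff)

lemma distinct_concat_distinct: "distinct (concat cs) \<Longrightarrow> [] \<notin> set cs \<Longrightarrow> distinct cs"
  by (simp add: distinct_concat_iff)

lemma valid_cyclesD:
  assumes "valid_cycles n cs"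
  shows "distinct (concat cs)" "distinct cs" "set (concat cs) \<subseteq> {1..n}"
    "\<And>c. c \<in> set cs \<Longrightarrow> valid_cycle n c" "\<And>c. c \<in> set cs \<Longrightarrow> c \<noteq> []" "\<And>c. c \<in> set cs \<Longrightarrow> distinct c"
    "\<And>c. c \<in> set cs \<Longrightarrow> 2 \<le> length c"
proof -
  show d: "distinct (concat cs)" and v: "\<And>c. c \<in> set cs \<Longrightarrow> valid_cycle n c"
    using assms by (auto simp: valid_cycles_def)
  show ne: "\<And>c. c \<in> set cs \<Longrightarrow> c \<noteq> []" "\<And>c. c \<in> set cs \<Longrightarrow> distinct c" "\<And>c. c \<in> set cs \<Longrightarrow> 2 \<le> length c"
    using v unfolding valid_cycle_def by force+
  have "[] \<notin> set cs" using ne(1) by blast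
  then show "distinct cs" using distinct_concat_distinct[OF d] by blast
  show "set (concat cs) \<subseteq> {1..n}" using v by (fastforce simp: valid_cycle_def)
qed

text \<open>Labels constant along the transpositions are constant on the cycles of the product; counting
  labels bounds the number of transpositions from below.\<close>

lemma cycles_of_tprod:
  assumes cs: "valid_cycles n cs" and w: "cyc cs = tprod ts"
    and ts: "\<forall>(i, k)\<in>set ts. i \<in> {1..n} \<and> k \<in> {1..n} \<and> i \<noteq> k"
  shows "sum_list (map (\<lambda>c. length c - 1) cs) \<le> length ts"
    and "sum_list (map (\<lambda>c. length c - 1) cs) = length ts \<Longrightarrow> (i, k) \<in> set ts \<Longrightarrow>
      \<exists>c\<in>set cs. i \<in> set c \<and> k \<in> set c"
proof -
  note v = valid_cyclesD[OF cs]
  obtain f :: "nat \<Rightarrow> nat" where f: "\<forall>(i, k)\<in>set ts. f i = f k" "card {1..n} \<le> card (f ` {1..n}) + length ts"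
    using label_exists[OF finite_atLeastAtMost[of 1 n], of ts] by blast
  have fw: "f (cyc cs x) = f x" for x unfolding w by (rule label_tprod[OF f(1)])
  then have fwk: "f ((cyc cs ^^ j) x) = f x" for j x by (induction j) auto
  have fc: "f x = f (hd c)" if "c \<in> set cs" "x \<in> set c" for c x
  proof -
    obtain j where "j < length c" "x = c ! j" using \<open>x \<in> set c\<close> by (metis in_set_conv_nth)
    then have "x = (cyc cs ^^ j) (hd c)"
      using orbit_list_nth[OF cyc_map_rotate1[OF v(1) that(1)] v(5)[OF that(1)], of j] by simp
    then show ?thesis by (simp add: fwk)
  qed
  let ?U = "set (concat cs)"
  \<comment> \<open>One representative per orbit: the fixed points and the heads of the cycles.
    Labels are constant on orbits, so there are at most \<open>card ?R\<close> of them.\<close>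
  let ?R = "({1..n} - ?U) \<union> hd ` set cs"
  have rep: "\<exists>r\<in>?R. f x = f r \<and> (x \<notin> ?U \<and> r = x \<or> (\<exists>c\<in>set cs. x \<in> set c \<and> r = hd c))"
    if "x \<in> {1..n}" for x
  proof (cases "x \<in> ?U")
    case True
    then obtain c where "c \<in> set cs" "x \<in> set c" by auto
    then show ?thesis using fc by (intro bexI[of _ "hd c"]) auto
  next
    case False
    then show ?thesis using that by auto
  qed
  then have sub: "f ` {1..n} \<subseteq> f ` ?R" by blast
  have fin: "finite ?R" by auto
  have len: "length (concat cs) = sum_list (map (\<lambda>c. length c - 1) cs) + length cs"
    using v(5) by (induction cs) (auto simp: Suc_le_eq)
  have "card ?R \<le> card ({1..n} - ?U) + card (hd ` set cs)" by (rule card_Un_le)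
  also have "card ({1..n} - ?U) = n - length (concat cs)"
    using v(3) distinct_card[OF v(1)] by (subst card_Diff_subset) simp_all
  also have "card (hd ` set cs) \<le> length cs"
    using card_image_le[of "set cs" hd] card_length[of cs] by simp
  finally have cR: "card ?R \<le> n - length (concat cs) + length cs" by simp
  have cn: "length (concat cs) \<le> n"
    using card_mono[OF _ v(3)] distinct_card[OF v(1)] by simp
  have c1: "n \<le> card (f ` {1..n}) + length ts" using f(2) by simp
  have c2: "card (f ` {1..n}) \<le> card (f ` ?R)" using sub by (intro card_mono) auto
  have c3: "card (f ` ?R) \<le> card ?R" using fin by (rule card_image_le)
  show "sum_list (map (\<lambda>c. length c - 1) cs) \<le> length ts" using c1 c2 c3 cR cn len by linarith
  assume eq: "sum_list (map (\<lambda>c. length c - 1) cs) = length ts" and ik: "(i, k) \<in> set ts"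
  \<comment> \<open>Equality in the count makes labels injective on orbits. The end points of a
    transposition share a label, hence also an orbit.\<close>
  have "card (f ` ?R) = card ?R" using c1 c2 c3 cR cn len eq by linarith
  then have inj: "inj_on f ?R" using fin by (rule eq_card_imp_inj_on[rotated])
  have ik': "i \<in> {1..n}" "k \<in> {1..n}" using bspec[OF ts ik] by auto
  obtain r where r: "r \<in> ?R" "f i = f r" "i \<notin> ?U \<and> r = i \<or> (\<exists>c\<in>set cs. i \<in> set c \<and> r = hd c)"
    using rep[OF ik'(1)] by blast
  obtain s where s: "s \<in> ?R" "f k = f s" "k \<notin> ?U \<and> s = k \<or> (\<exists>c\<in>set cs. k \<in> set c \<and> s = hd c)"
    using rep[OF ik'(2)] by blast
  have "f i = f k" using f(1) ik by auto
  then have rs: "r = s" using inj r s by (auto dest: inj_onD)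
  have hd: "hd c \<in> set c" if "c \<in> set cs" for c using v(5)[OF that] by simp
  from r(3) show "\<exists>c\<in>set cs. i \<in> set c \<and> k \<in> set c"
  proof
    assume i: "i \<notin> ?U \<and> r = i"
    moreover have "i \<noteq> k" using ts ik by auto
    ultimately obtain c where "c \<in> set cs" "i = hd c" using s(3) rs by auto
    then have "i \<in> ?U" using hd[of c] by auto
    then show ?thesis using i by blast
  next
    assume "\<exists>c\<in>set cs. i \<in> set c \<and> r = hd c"
    then obtain c where c: "c \<in> set cs" "i \<in> set c" "r = hd c" by blast
    from s(3) show ?thesis
    proof
      assume "k \<notin> ?U \<and> s = k"
      then have "hd c \<notin> ?U" using rs c(3) by simp
      moreover have "hd c \<in> ?U" using hd[OF c(1)] c(1) by auto
      ultimately show ?thesis by blast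
    next
      assume "\<exists>c\<in>set cs. k \<in> set c \<and> s = hd c"
      then obtain d where d: "d \<in> set cs" "k \<in> set d" "s = hd d" by blast
      then have "hd d = hd c" using c(3) rs by simp
      then have "hd c \<in> set d" using hd[OF d(1)] by simp
      then have "c = d" using distinct_concat_same[OF v(1) c(1) d(1) hd[OF c(1)]] by simp
      then show ?thesis using c d by auto
    qed
  qed
qed


subsection \<open>Block functions\<close>

text \<open>A block function \<open>b\<close> encodes one term of the expansion of a monomial in the Jucys-Murphy elements:
  the entries of \<open>b k\<close> are the indices \<open>i\<close> of the transpositions \<open>[i, k]\<close> chosen from the factors \<open>M\<^sub>k\<close>.\<close>

definition blocks :: "nat \<Rightarrow> (nat \<Rightarrow> nat list) \<Rightarrow> bool" where
  "blocks n b \<longleftrightarrow> (\<forall>k. set (b k) \<subseteq> {1..<k}) \<and> (\<forall>k. k \<notin> {1..n} \<longrightarrow> b k = [])"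

definition block_pairs :: "(nat \<Rightarrow> nat list) \<Rightarrow> nat list \<Rightarrow> (nat \<times> nat) list" where
  "block_pairs b ks = concat (map (\<lambda>k. map (\<lambda>i. (i, k)) (b k)) ks)"

text \<open>The cycles, up to sign, to which the nonempty blocks multiply by
  \<open>star_prod_cycle\<close> when their entries are distinct.\<close>

definition block_cycles :: "(nat \<Rightarrow> nat list) \<Rightarrow> nat list \<Rightarrow> nat list list" where
  "block_cycles b ks = map (\<lambda>k. k # rev (b k)) (filter (\<lambda>k. b k \<noteq> []) ks)"

definition block_prod :: "nat \<Rightarrow> (nat \<Rightarrow> nat list) \<Rightarrow> nat list \<Rightarrow> cover" where
  "block_prod n b ks = foldr (\<lambda>k g. star_prod n k (b k) \<cdot>\<^bsub>n\<^esub> g) ks \<one>\<^bsub>cover_group n\<^esub>"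

lemma block_prod_Nil [simp]: "block_prod n b [] = \<one>\<^bsub>cover_group n\<^esub>"
  and block_prod_Cons: "block_prod n b (k # ks) = star_prod n k (b k) \<cdot>\<^bsub>n\<^esub> block_prod n b ks"
  by (simp_all add: block_prod_def)

lemma blocks_star: "blocks n b \<Longrightarrow> k \<in> {1..n} \<Longrightarrow> set (b k) \<subseteq> {1..n} - {k}"
  by (fastforce simp: blocks_def)

lemma block_prod_closed [simp]:
  "blocks n b \<Longrightarrow> set ks \<subseteq> {1..n} \<Longrightarrow> block_prod n b ks \<in> carrier (cover_group n)"
  by (induction ks) (auto simp: block_prod_Cons intro!: cov.m_closed star_prod_closed[OF blocks_star])

lemma valid_cycle_pair: "i \<in> {1..n} \<Longrightarrow> k \<in> {1..n} \<Longrightarrow> i \<noteq> k \<Longrightarrow> valid_cycle n [i, k]"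
  by (auto simp: valid_cycle_def)

lemma cperm_star_prod:
  "set is \<subseteq> {1..n} - {k} \<Longrightarrow> k \<in> {1..n} \<Longrightarrow> cperm (star_prod n k is) = tprod (map (\<lambda>i. (i, k)) is)"
proof (induction "is")
  case (Cons i "is")
  then have "valid_cycle n [i, k]" by (intro valid_cycle_pair) auto
  then show ?case using Cons by (simp add: star_prod_Cons tprod_Cons lifted_cycle)
qed simp

lemma cperm_block_prod:
  "blocks n b \<Longrightarrow> set ks \<subseteq> {1..n} \<Longrightarrow> cperm (block_prod n b ks) = tprod (block_pairs b ks)"
proof (induction ks)
  case (Cons k ks)
  then show ?case
    using cperm_star_prod[of "b k" n k] blocks_star[of n b k]
    by (simp add: block_prod_Cons block_pairs_def tprod_append)
qed (simp add: block_pairs_def)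

lemma block_cycles_Cons:
  "block_cycles b (k # ks) = (if b k = [] then block_cycles b ks else (k # rev (b k)) # block_cycles b ks)"
  by (simp add: block_cycles_def)

text \<open>Every nonempty block contributes one \<open>z\<close> through
  \<open>star_prod_cycle\<close>. This is the origin of the leading signs.\<close>

lemma block_prod_cycles:
  assumes "blocks n b" "set ks \<subseteq> {1..n}" "valid_cycles n (block_cycles b ks)"
  shows "block_prod n b ks = zs n (odd (length (block_cycles b ks))) \<cdot>\<^bsub>n\<^esub> cprod n (block_cycles b ks)"
  using assms
proof (induction ks)
  case Nil
  then show ?case by (simp add: block_cycles_def)
next
  case (Cons k ks)
  show ?case
  proof (cases "b k = []")
    case True
    then show ?thesis using Cons by (simp add: block_prod_Cons block_cycles_Cons valid_cycles_def)
  next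
    case False
    then have v: "valid_cycle n (k # rev (b k))" "valid_cycles n (block_cycles b ks)"
      using Cons.prems by (auto simp: block_cycles_Cons valid_cycles_Cons)
    have k: "k \<in> {1..n}" using Cons.prems by simp
    have "star_prod n k (b k) = zz n \<cdot>\<^bsub>n\<^esub> lifted_cycle n (k # rev (b k))"
      using v k blocks_star[OF Cons.prems(1) k] False
      by (intro star_prod_cycle) (auto simp: valid_cycle_def)
    then show ?thesis using Cons False v lifted_cycle(1)[OF v(1)] zs_zs_left[of _ n True]
      by (simp add: block_prod_Cons block_cycles_Cons cprod_Cons cov.m_assoc
          zs_left[of "lifted_cycle n (k # rev (b k))"] valid_cycles_def)
  qed
qed

lemma length_block_pairs: "length (block_pairs b ks) = (\<Sum>k\<leftarrow>ks. length (b k))"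
  by (simp add: block_pairs_def length_concat comp_def)

lemma distinct_concat_map:
  assumes "distinct xs" "\<And>x. x \<in> set xs \<Longrightarrow> distinct (f x)"
    "\<And>x y. x \<in> set xs \<Longrightarrow> y \<in> set xs \<Longrightarrow> x \<noteq> y \<Longrightarrow> set (f x) \<inter> set (f y) = {}"
  shows "distinct (concat (map f xs))"
  using assms
proof (induction xs)
  case (Cons x xs)
  have "set (f x) \<inter> set (f y) = {}" if "y \<in> set xs" for y
    using Cons.prems(1) that by (intro Cons.prems(3)) auto
  moreover have "distinct (concat (map f xs))" using Cons.prems by (intro Cons.IH) auto
  ultimately show ?case using Cons.prems(2)[of x] by auto
qed simp

definition upto1 :: "nat \<Rightarrow> nat list" where
  "upto1 n = [1..<Suc n]"

lemma set_upto1 [simp]: "set (upto1 n) = {1..n}"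
  and distinct_upto1 [simp]: "distinct (upto1 n)"
  and upto1_0 [simp]: "upto1 0 = []"
  and upto1_Suc: "upto1 (Suc n) = upto1 n @ [Suc n]"
  by (auto simp: upto1_def)

lemma sum_list_upto1: "(\<Sum>k\<leftarrow>upto1 n. f k) = (\<Sum>k\<in>{1..n}. f k)"
  using sum_list_distinct_conv_sum_set[OF distinct_upto1, of f n] by simp

definition centres :: "nat \<Rightarrow> (nat \<Rightarrow> nat list) \<Rightarrow> nat set" where
  "centres n b = {k \<in> {1..n}. b k \<noteq> []}"

text \<open>In a minimal factorization no transposition joins two orbits, so each block stays inside
  one cycle, and every cycle is reached by some block. If there are as many cycles as nonempty
  blocks, the blocks match the cycles one to one and their lengths leave no room for repeated
  entries.\<close>

lemma block_factorization:
  assumes b: "blocks n b" and cs: "valid_cycles n cs" and w: "cyc cs = tprod (block_pairs b (upto1 n))"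
  shows "sum_list (map (\<lambda>c. length c - 1) cs) \<le> (\<Sum>k\<in>{1..n}. length (b k))"
    and "sum_list (map (\<lambda>c. length c - 1) cs) = (\<Sum>k\<in>{1..n}. length (b k)) \<Longrightarrow> length cs \<le> card (centres n b)"
    and "sum_list (map (\<lambda>c. length c - 1) cs) = (\<Sum>k\<in>{1..n}. length (b k)) \<Longrightarrow> length cs = card (centres n b) \<Longrightarrow>
      valid_cycles n (block_cycles b (upto1 n))"
proof -
  note v = valid_cyclesD[OF cs]
  let ?ts = "block_pairs b (upto1 n)" and ?K = "centres n b"
  have ts_iff: "(i, k) \<in> set ?ts \<longleftrightarrow> k \<in> ?K \<and> i \<in> set (b k)" for i k
    by (auto simp: block_pairs_def centres_def)
  have ts: "\<forall>(i, k)\<in>set ?ts. i \<in> {1..n} \<and> k \<in> {1..n} \<and> i \<noteq> k"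
  proof (intro ballI, clarify)
    fix i k assume "(i, k) \<in> set ?ts"
    then have k: "k \<in> {1..n}" and "i \<in> set (b k)" by (auto simp: ts_iff centres_def)
    then have "i \<in> {1..n} - {k}" using blocks_star[OF b k] by blast
    then show "i \<in> {1..n} \<and> k \<in> {1..n} \<and> i \<noteq> k" using k by auto
  qed
  have len: "length ?ts = (\<Sum>k\<in>{1..n}. length (b k))"
    by (simp add: length_block_pairs sum_list_upto1)
  show "sum_list (map (\<lambda>c. length c - 1) cs) \<le> (\<Sum>k\<in>{1..n}. length (b k))"
    using cycles_of_tprod(1)[OF cs w ts] len by simp
  assume "sum_list (map (\<lambda>c. length c - 1) cs) = (\<Sum>k\<in>{1..n}. length (b k))"
  then have eq: "sum_list (map (\<lambda>c. length c - 1) cs) = length ?ts" using len by simp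
  have edge: "\<exists>c\<in>set cs. i \<in> set c \<and> k \<in> set c" if "k \<in> ?K" "i \<in> set (b k)" for i k
    using cycles_of_tprod(2)[OF cs w ts eq, of i k] ts_iff that by simp
  have "\<exists>c\<in>set cs. k \<in> set c" if "k \<in> ?K" for k
    using edge[OF that, of "hd (b k)"] that by (auto simp: centres_def)
  \<comment> \<open>\<open>C k\<close> is the cycle that contains the centre \<open>k\<close>, and
    with it the whole block at \<open>k\<close>.\<close>
  then obtain C where C: "\<And>k. k \<in> ?K \<Longrightarrow> C k \<in> set cs \<and> k \<in> set (C k)" by metis
  have Cuniq: "C k = c" if "k \<in> ?K" "c \<in> set cs" "k \<in> set c" for k c
    using distinct_concat_same[OF v(1)] C[OF that(1)] that by blast
  have bC: "set (b k) \<subseteq> set (C k)" if "k \<in> ?K" for k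
  proof
    fix i assume "i \<in> set (b k)"
    from edge[OF \<open>k \<in> ?K\<close> this] obtain c where "c \<in> set cs" "i \<in> set c" "k \<in> set c" by blast
    then show "i \<in> set (C k)" using Cuniq[OF \<open>k \<in> ?K\<close>] by simp
  qed
  \<comment> \<open>Every entry of a cycle is moved, so it occurs in some transposition. This makes
    \<open>C\<close> surjective and, once \<open>C\<close> is injective, confines \<open>C k\<close>
    to the centre \<open>k\<close> and its block.\<close>
  have touch: "\<exists>k\<in>?K. C k = c \<and> (x = k \<or> x \<in> set (b k))" if "c \<in> set cs" "x \<in> set c" for c x
  proof -
    have "tprod ?ts x \<noteq> x" using cyc_moves[OF v(1) that(1) v(7)[OF that(1)] that(2)] w by simp
    then obtain i k where ik: "(i, k) \<in> set ?ts" "x = i \<or> x = k" by (rule tprod_moves)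
    then have k: "k \<in> ?K" "i \<in> set (b k)" by (auto simp: ts_iff)
    then have "x \<in> set (C k)" using ik(2) C[OF k(1)] bC[OF k(1)] by auto
    then have "C k = c" using distinct_concat_same[OF v(1)] C[OF k(1)] that by blast
    then show ?thesis using k ik(2) by auto
  qed
  have img: "C ` ?K = set cs"
  proof
    show "set cs \<subseteq> C ` ?K"
    proof
      fix c assume c: "c \<in> set cs"
      then have "hd c \<in> set c" using v(5) by simp
      then show "c \<in> C ` ?K" using touch[OF c] by blast
    qed
  qed (use C in auto)
  have fin: "finite ?K" by (simp add: centres_def)
  have lc: "length cs = card (C ` ?K)" unfolding img by (simp add: distinct_card[OF v(2)])
  then show "length cs \<le> card ?K" using card_image_le[OF fin, of C] by simp
  assume "length cs = card ?K"
  then have inj: "inj_on C ?K" using lc eq_card_imp_inj_on[OF fin, of C] by simp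
  have sub: "set (C k) \<subseteq> insert k (set (b k))" if k: "k \<in> ?K" for k
  proof
    fix x assume "x \<in> set (C k)"
    then obtain k' where "k' \<in> ?K" "C k' = C k" "x = k' \<or> x \<in> set (b k')" using touch C[OF k] by blast
    then show "x \<in> insert k (set (b k))" using inj k by (auto dest: inj_onD)
  qed
  have le: "length (C k) - 1 \<le> card (set (b k))" if k: "k \<in> ?K" for k
  proof -
    have "length (C k) = card (set (C k))" using v(6) C[OF k] by (simp add: distinct_card)
    also have "\<dots> \<le> card (insert k (set (b k)))" using sub[OF k] by (intro card_mono) auto
    also have "\<dots> \<le> Suc (card (set (b k)))" by (simp add: card_insert_if)
    finally show ?thesis by simp
  qed
  have "(\<Sum>k\<in>?K. length (C k) - 1) = sum_list (map (\<lambda>c. length c - 1) cs)"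
    using sum.reindex[OF inj, of "\<lambda>c. length c - 1"] img v(2) by (simp add: sum_list_distinct_conv_sum_set)
  also have "\<dots> = (\<Sum>k\<in>?K. length (b k))"
    unfolding eq len by (rule sum.mono_neutral_right) (auto simp: centres_def)
  finally have sums: "(\<Sum>k\<in>?K. length (C k) - 1) = (\<Sum>k\<in>?K. length (b k))" .
  \<comment> \<open>By \<open>le\<close> each left summand is at most the number of distinct entries
    of the block, hence at most its length. Equal sums force equality in every term, so no block
    repeats an entry.\<close>
  have "length (C k) - 1 = length (b k)" if "k \<in> ?K" for k
    by (rule sum_mono_inv[OF sums _ that fin]) (meson le card_length order_trans)
  then have db: "distinct (b k)" if "k \<in> ?K" for k
    using le[OF that] that card_length[of "b k"] by (intro card_distinct) (metis le_antisym)
  have kC: "set (k # rev (b k)) \<subseteq> set (C k)" if "k \<in> ?K" for k using bC C that by auto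
  have fK: "set (filter (\<lambda>k. b k \<noteq> []) (upto1 n)) = ?K" by (auto simp: centres_def)
  have "distinct (concat (block_cycles b (upto1 n)))"
    unfolding block_cycles_def
  proof (rule distinct_concat_map, unfold fK)
    fix k assume k: "k \<in> ?K"
    then have "k \<notin> set (b k)" using blocks_star[OF b, of k] by (auto simp: centres_def)
    then show "distinct (k # rev (b k))" using db[OF k] by simp
    fix l assume l: "l \<in> ?K" "k \<noteq> l"
    then have "C k \<noteq> C l" using inj k by (auto dest: inj_onD)
    then have "set (C k) \<inter> set (C l) = {}" using distinct_concat_same[OF v(1)] C[OF k] C[OF l(1)] by blast
    then show "set (k # rev (b k)) \<inter> set (l # rev (b l)) = {}" using kC[OF k] kC[OF l(1)] by blast
  qed simp
  moreover have "valid_cycle n c" if "c \<in> set (block_cycles b (upto1 n))" for c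
  proof -
    have "c \<in> (\<lambda>k. k # rev (b k)) ` ?K" using that unfolding block_cycles_def set_map fK .
    then obtain k where k: "c = k # rev (b k)" "k \<in> ?K" by (rule imageE)
    then have "set (b k) \<subseteq> {1..n} - {k}" "k \<in> {1..n}" "b k \<noteq> []"
      using blocks_star[OF b, of k] by (auto simp: centres_def)
    then show ?thesis using k db[OF k(2)] by (auto simp: valid_cycle_def Suc_le_eq)
  qed
  ultimately show "valid_cycles n (block_cycles b (upto1 n))" by (auto simp: valid_cycles_def)
qed

text \<open>Two cycles of one permutation through a common point list the same orbit; rotated to
  start at that point they coincide by \<open>orbit_list_unique\<close>.\<close>

lemma cycles_meet:
  assumes "valid_cycles n cs" "valid_cycles n ds" "cyc cs = cyc ds"
    "c \<in> set cs" "d \<in> set ds" "x \<in> set c" "x \<in> set d"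
  shows "set c = set d" "hd c = hd d \<Longrightarrow> c = d"
proof -
  note v = valid_cyclesD[OF assms(1)] and v' = valid_cyclesD[OF assms(2)]
  let ?w = "cyc ds"
  have wc: "map ?w c = rotate1 c" using cyc_map_rotate1[OF v(1) assms(4)] assms(3) by simp
  have wd: "map ?w d = rotate1 d" using cyc_map_rotate1[OF v'(1) assms(5)] .
  show "hd c = hd d \<Longrightarrow> c = d"
    using orbit_list_unique[OF wc wd] v(5,6) v'(5,6) assms(4,5) by blast
  obtain j k where j: "hd (rotate j c) = x" and k: "hd (rotate k d) = x"
    using rotate_to_hd assms(6,7) by metis
  have "map ?w (rotate j c) = rotate1 (rotate j c)" "map ?w (rotate k d) = rotate1 (rotate k d)"
    using wc wd by (simp_all add: rotate1_rotate_swap flip: rotate_map)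
  then have "rotate j c = rotate k d"
    using orbit_list_unique[of ?w "rotate j c" "rotate k d"] j k v(5,6) v'(5,6) assms(4,5) by simp
  then show "set c = set d" by (metis set_rotate)
qed

text \<open>A centre exceeds all entries of its block, so it is the largest entry of its cycle. The
  permutation therefore determines the centres, and reading each cycle from its centre gives back
  the block.\<close>

lemma blocks_unique:
  assumes "blocks n b" "blocks n b'" "valid_cycles n (block_cycles b (upto1 n))"
    "valid_cycles n (block_cycles b' (upto1 n))"
    "cyc (block_cycles b (upto1 n)) = cyc (block_cycles b' (upto1 n))"
  shows "b = b'"
proof -
  have *: "b' k = b k" if asm: "blocks n b" "blocks n b'" "valid_cycles n (block_cycles b (upto1 n))"
    "valid_cycles n (block_cycles b' (upto1 n))"
    "cyc (block_cycles b (upto1 n)) = cyc (block_cycles b' (upto1 n))" "b k \<noteq> []" for b b' k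
  proof -
    have K: "k \<in> {1..n}" using asm by (auto simp: blocks_def)
    let ?c = "k # rev (b k)"
    have c: "?c \<in> set (block_cycles b (upto1 n))" using K asm(6) by (auto simp: block_cycles_def)
    have "cyc (block_cycles b' (upto1 n)) k \<noteq> k"
      using cyc_moves[OF valid_cyclesD(1)[OF asm(3)] c valid_cyclesD(7)[OF asm(3) c], of k] asm(5) by simp
    then obtain d where d: "d \<in> set (block_cycles b' (upto1 n))" "k \<in> set d" using cyc_outside by fastforce
    then obtain l where l: "d = l # rev (b' l)" by (auto simp: block_cycles_def)
    have "set ?c = set d" by (rule cycles_meet(1)[OF asm(3,4,5) c d(1) _ d(2)]) simp
    moreover have "x \<le> k" if "x \<in> set ?c" for x using asm(1) that by (fastforce simp: blocks_def)
    moreover have "x \<le> l" if "x \<in> set d" for x using asm(2) that l by (fastforce simp: blocks_def)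
    ultimately have "k = l" using l by (metis le_antisym list.set_intros(1))
    then have "?c = d" using cycles_meet(2)[OF asm(3,4,5) c d(1) _ d(2)] l by simp
    then show ?thesis using l \<open>k = l\<close> by simp
  qed
  show ?thesis
  proof
    fix k
    have "b k \<noteq> [] \<Longrightarrow> b' k = b k" by (rule *[OF assms])
    moreover have "b' k \<noteq> [] \<Longrightarrow> b k = b' k" by (rule *[OF assms(2,1,4,3) assms(5)[symmetric]])
    ultimately show "b k = b' k" by metis
  qed
qed

text \<open>Each cycle is rotated to start with its largest entry, which becomes the centre; the
  other entries then lie below it, as \<open>blocks\<close> demands.\<close>

lemma blocks_exist:
  assumes "valid_cycles n ds"
  shows "\<exists>b. blocks n b \<and> valid_cycles n (block_cycles b (upto1 n)) \<and> cyc (block_cycles b (upto1 n)) = cyc ds"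
proof -
  \<comment> \<open>The inclusion of supports strengthens the induction: it shows that the block at
    a new centre is still empty.\<close>
  have "\<exists>b. blocks n b \<and> valid_cycles n (block_cycles b (upto1 n)) \<and> cyc (block_cycles b (upto1 n)) = cyc ds \<and>
      set (concat (block_cycles b (upto1 n))) \<subseteq> set (concat ds)"
    using assms
  proof (induction ds)
    case Nil
    have "block_cycles (\<lambda>_. []) (upto1 n) = []" by (simp add: block_cycles_def)
    then show ?case by (intro exI[of _ "\<lambda>_. []"]) (simp add: blocks_def valid_cycles_def)
  next
    case (Cons c ds)
    have c: "valid_cycle n c" and dis: "set c \<inter> set (concat ds) = {}" and ds: "valid_cycles n ds"
      using Cons.prems by (auto simp: valid_cycles_Cons)
    obtain b where b: "blocks n b" "valid_cycles n (block_cycles b (upto1 n))"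
      "cyc (block_cycles b (upto1 n)) = cyc ds" "set (concat (block_cycles b (upto1 n))) \<subseteq> set (concat ds)"
      using Cons.IH[OF ds] by blast
    define m where "m = Max (set c)"
    have ne: "set c \<noteq> {}" using c by (auto simp: valid_cycle_def)
    have m: "m \<in> set c" unfolding m_def using ne by (intro Max_in) auto
    have m': "m \<in> {1..n}" using m c by (auto simp: valid_cycle_def)
    obtain j where j: "hd (rotate j c) = m" using rotate_to_hd[OF m] by blast
    define d where "d = rotate j c"
    have d: "valid_cycle n d" "d = m # tl d" "set d = set c" "distinct d"
      using c j by (auto simp: d_def valid_cycle_def) (metis hd_Cons_tl list.size(3) not_numeral_le_zero length_rotate)
    have bm: "b m = []"
    proof (rule ccontr)
      assume "b m \<noteq> []"
      then have "m \<in> set (concat (block_cycles b (upto1 n)))" using m' by (auto simp: block_cycles_def)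
      then show False using b(4) m dis by blast
    qed
    define b' where "b' = b(m := rev (tl d))"
    have tl: "tl d \<noteq> []" using d(1) by (cases d) (auto simp: valid_cycle_def)
    have set_tl: "set (tl d) \<subseteq> {1..<m}"
    proof
      fix x assume x: "x \<in> set (tl d)"
      then have "x \<in> set d" "x \<noteq> m" using d(2,4) by (metis list.set_intros(2), metis distinct.simps(2))
      moreover have "x \<le> m" unfolding m_def using \<open>x \<in> set d\<close> d(3) by simp
      moreover have "x \<ge> 1" using \<open>x \<in> set d\<close> d(1) by (auto simp: valid_cycle_def)
      ultimately show "x \<in> {1..<m}" by simp
    qed
    have blocks: "blocks n b'" using b(1) set_tl m' by (auto simp: b'_def blocks_def)
    \<comment> \<open>Only sets of cycles are compared, because \<open>block_cycles\<close> lists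
      them by centre and the new cycle need not come first.\<close>
    have set': "set (block_cycles b' (upto1 n)) = set (d # block_cycles b (upto1 n))"
    proof -
      have "set (block_cycles b' (upto1 n)) = (\<lambda>k. k # rev (b' k)) ` {k \<in> {1..n}. b' k \<noteq> []}"
        by (auto simp: block_cycles_def)
      also have "{k \<in> {1..n}. b' k \<noteq> []} = insert m {k \<in> {1..n}. b k \<noteq> []}"
        using m' tl by (auto simp: b'_def)
      also have "(\<lambda>k. k # rev (b' k)) ` insert m {k \<in> {1..n}. b k \<noteq> []} =
          insert d ((\<lambda>k. k # rev (b k)) ` {k \<in> {1..n}. b k \<noteq> []})"
        using d(2) bm by (auto simp: b'_def image_iff)
      also have "\<dots> = set (d # block_cycles b (upto1 n))"
        by (auto simp: block_cycles_def)
      finally show ?thesis .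
    qed
    have v1: "valid_cycles n (d # block_cycles b (upto1 n))"
      using d b dis by (simp add: valid_cycles_Cons) blast
    have "distinct (concat (block_cycles b' (upto1 n)))"
      unfolding distinct_concat_iff
    proof (intro conjI allI impI)
      show "distinct (removeAll [] (block_cycles b' (upto1 n)))"
        by (intro distinct_removeAll) (auto simp: block_cycles_def distinct_map inj_on_def)
      show "distinct ys" if "ys \<in> set (block_cycles b' (upto1 n))" for ys
        using that valid_cyclesD(6)[OF v1] unfolding set' by blast
      show "set ys \<inter> set zs = {}"
        if "ys \<in> set (block_cycles b' (upto1 n)) \<and> zs \<in> set (block_cycles b' (upto1 n)) \<and> ys \<noteq> zs" for ys zs
        using that distinct_concat_same[OF valid_cyclesD(1)[OF v1]] unfolding set' by blast
    qed
    then have v2: "valid_cycles n (block_cycles b' (upto1 n))"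
      using v1 unfolding valid_cycles_def set' by blast
    have "cyc (block_cycles b' (upto1 n)) = cyc (d # block_cycles b (upto1 n))"
      using cyc_set_cong[OF valid_cyclesD(1)[OF v2] valid_cyclesD(1)[OF v1] set'] .
    also have "\<dots> = cyc (c # ds)"
      using cycle_of_list_rotate_independent[of c j] c b(3) by (simp add: cyc_Cons d_def valid_cycle_def)
    finally have "cyc (block_cycles b' (upto1 n)) = cyc (c # ds)" .
    moreover have "set (concat (block_cycles b' (upto1 n))) \<subseteq> set (concat (c # ds))"
      using b(4) d(3) by (simp add: set') blast
    ultimately show ?case using blocks v2 by blast
  qed
  then show ?thesis by blast
qed


subsection \<open>The group algebra acting on functions\<close>

text \<open>Left translation, set to zero off the carrier because functions live on the whole type.
  Translation by the unit is therefore the projection to functions supported on the group.\<close>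

definition shift :: "nat \<Rightarrow> cover \<Rightarrow> (cover, 'r::comm_ring) endo" where
  "shift n g = Endo (\<lambda>v x. if x \<in> carrier (cover_group n) then v (inv\<^bsub>cover_group n\<^esub> g \<cdot>\<^bsub>n\<^esub> x) else 0)"

lemma app_shift [simp]:
  "app (shift n g) v x = (if x \<in> carrier (cover_group n) then v (inv\<^bsub>cover_group n\<^esub> g \<cdot>\<^bsub>n\<^esub> x) else 0)"
  unfolding shift_def by (subst Endo_inverse) (auto simp: fun_eq_iff)

lemma shift_mult:
  assumes "g \<in> carrier (cover_group n)" "k \<in> carrier (cover_group n)"
  shows "shift n g * shift n k = shift n (g \<cdot>\<^bsub>n\<^esub> k)"
  by (rule endo_eqI) (use assms in \<open>simp add: cov.inv_mult_group cov.m_assoc\<close>)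

lemma sc_shift: "sc r * shift n g = shift n g * sc r"
  by (rule endo_eqI) simp

text \<open>The family \<open>F\<close> is left open: with \<open>shift\<close> it represents the
  group algebra, and with \<open>S\<close> it represents the spin group algebra.\<close>

definition lincomb :: "nat \<Rightarrow> (cover \<Rightarrow> (cover, 'r::comm_ring) endo) \<Rightarrow> (cover \<Rightarrow> 'r) \<Rightarrow> (cover, 'r) endo" where
  "lincomb n F f = (\<Sum>g\<in>carrier (cover_group n). sc (f g) * F g)"

lemma carrier_group_algebra:
  "f \<in> carrier (group_algebra (cover_group n)) \<longleftrightarrow> (\<forall>g. g \<notin> carrier (cover_group n) \<longrightarrow> f g = 0)"
proof -
  have "{g. f g \<noteq> 0} \<subseteq> carrier (cover_group n) \<Longrightarrow> finite {g. f g \<noteq> 0}"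
    using finite_cover finite_subset by blast
  then show ?thesis by (auto simp: group_algebra_def)
qed

lemma group_algebra_sel:
  "\<zero>\<^bsub>group_algebra G\<^esub> = (\<lambda>_. 0)" "\<one>\<^bsub>group_algebra G\<^esub> = delta \<one>\<^bsub>G\<^esub> 1"
  "f \<oplus>\<^bsub>group_algebra G\<^esub> k = (\<lambda>g. f g + k g)"
  "f \<otimes>\<^bsub>group_algebra G\<^esub> k = (\<lambda>g. \<Sum>(a, b)\<in>{(a, b). f a \<noteq> 0 \<and> k b \<noteq> 0 \<and> a \<otimes>\<^bsub>G\<^esub> b = g}. f a * k b)"
  by (simp_all add: group_algebra_def)

lemma group_algebra_mult_closed:
  assumes "f \<in> carrier (group_algebra (cover_group n))" "k \<in> carrier (group_algebra (cover_group n))"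
  shows "f \<otimes>\<^bsub>group_algebra (cover_group n)\<^esub> k \<in> carrier (group_algebra (cover_group n))"
  unfolding carrier_group_algebra
proof (intro allI impI)
  fix g assume g: "g \<notin> carrier (cover_group n)"
  have *: "{(a, b). f a \<noteq> 0 \<and> k b \<noteq> 0 \<and> a \<cdot>\<^bsub>n\<^esub> b = g} = {}"
    using assms g unfolding carrier_group_algebra by (auto intro: cov.m_closed)
  then show "(f \<otimes>\<^bsub>group_algebra (cover_group n)\<^esub> k) g = 0"
    by (simp only: group_algebra_sel * sum.empty)
qed

lemma lincomb_mult:
  fixes f k :: "cover \<Rightarrow> 'r::{comm_ring, comm_monoid_mult}"
  assumes f: "f \<in> carrier (group_algebra (cover_group n))" and k: "k \<in> carrier (group_algebra (cover_group n))"
    and F: "\<And>a b. a \<in> carrier (cover_group n) \<Longrightarrow> b \<in> carrier (cover_group n) \<Longrightarrow> F a * F b = F (a \<cdot>\<^bsub>n\<^esub> b)"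
    and scF: "\<And>r a. sc r * F a = F a * sc r"
  shows "lincomb n F (f \<otimes>\<^bsub>group_algebra (cover_group n)\<^esub> k) = lincomb n F f * lincomb n F k"
proof -
  let ?G = "carrier (cover_group n)"
  let ?D = "{(a, b). f a \<noteq> 0 \<and> k b \<noteq> 0}"
  have D: "?D \<subseteq> ?G \<times> ?G" using f k unfolding carrier_group_algebra by auto
  then have fin: "finite ?D" by (rule finite_subset) (simp add: finite_cover)
  have "lincomb n F f * lincomb n F k = (\<Sum>a\<in>?G. \<Sum>b\<in>?G. (sc (f a) * F a) * (sc (k b) * F b))"
    unfolding lincomb_def by (rule sum_product)
  also have "\<dots> = (\<Sum>(a, b)\<in>?G \<times> ?G. (sc (f a) * F a) * (sc (k b) * F b))"
    by (simp add: sum.cartesian_product)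
  also have "\<dots> = (\<Sum>(a, b)\<in>?G \<times> ?G. sc (f a * k b) * F (a \<cdot>\<^bsub>n\<^esub> b))"
  proof (intro sum.cong HOL.refl, clarify)
    fix a b assume ab: "a \<in> ?G" "b \<in> ?G"
    have "(sc (f a) * F a) * (sc (k b) * F b) = sc (f a) * (F a * sc (k b)) * F b" by (simp add: mult.assoc)
    also have "\<dots> = sc (f a) * sc (k b) * (F a * F b)" unfolding scF[symmetric] by (simp add: mult.assoc)
    finally show "(sc (f a) * F a) * (sc (k b) * F b) = sc (f a * k b) * F (a \<cdot>\<^bsub>n\<^esub> b)"
      using F[OF ab] by (simp add: sc_mult)
  qed
  \<comment> \<open>Restricting to pairs with nonzero coefficients matches the index set in the
    definition of the convolution; the next step groups the pairs by their product.\<close>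
  also have "\<dots> = (\<Sum>(a, b)\<in>?D. sc (f a * k b) * F (a \<cdot>\<^bsub>n\<^esub> b))"
    by (rule sum.mono_neutral_right) (use D in \<open>auto simp: finite_cover sc_0\<close>)
  also have "\<dots> = (\<Sum>g\<in>?G. \<Sum>p\<in>{p\<in>?D. fst p \<cdot>\<^bsub>n\<^esub> snd p = g}. sc (f (fst p) * k (snd p)) * F (fst p \<cdot>\<^bsub>n\<^esub> snd p))"
  proof -
    have "(\<lambda>p. fst p \<cdot>\<^bsub>n\<^esub> snd p) ` ?D \<subseteq> ?G" using D by auto
    from sum.group[OF fin finite_cover this] show ?thesis
      unfolding case_prod_unfold by (rule HOL.sym)
  qed
  also have "\<dots> = (\<Sum>g\<in>?G. sc ((f \<otimes>\<^bsub>group_algebra (cover_group n)\<^esub> k) g) * F g)"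
  proof (rule sum.cong[OF HOL.refl])
    fix g
    have "(\<Sum>p\<in>{p\<in>?D. fst p \<cdot>\<^bsub>n\<^esub> snd p = g}. sc (f (fst p) * k (snd p)) * F (fst p \<cdot>\<^bsub>n\<^esub> snd p)) =
        (\<Sum>p\<in>{p\<in>?D. fst p \<cdot>\<^bsub>n\<^esub> snd p = g}. sc (f (fst p) * k (snd p))) * F g"
      unfolding sum_distrib_right by (rule sum.cong) auto
    also have "(\<Sum>p\<in>{p\<in>?D. fst p \<cdot>\<^bsub>n\<^esub> snd p = g}. sc (f (fst p) * k (snd p))) =
        sc ((f \<otimes>\<^bsub>group_algebra (cover_group n)\<^esub> k) g)"
      unfolding group_algebra_sel sc_sum by (rule sum.cong) auto
    finally show "(\<Sum>p\<in>{p\<in>?D. fst p \<cdot>\<^bsub>n\<^esub> snd p = g}. sc (f (fst p) * k (snd p)) * F (fst p \<cdot>\<^bsub>n\<^esub> snd p)) =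
        sc ((f \<otimes>\<^bsub>group_algebra (cover_group n)\<^esub> k) g) * F g" .
  qed
  finally show ?thesis by (simp add: lincomb_def)
qed

lemma lincomb_add: "lincomb n F (\<lambda>g. f g + k g) = lincomb n F f + lincomb n F k"
  by (simp add: lincomb_def sc_add distrib_right sum.distrib)

lemma lincomb_minus: "lincomb n F (\<lambda>g. - f g) = - lincomb n F f"
  by (simp add: lincomb_def sc_minus sum_negf)

lemma lincomb_zero: "lincomb n F (\<lambda>g. 0) = 0"
  by (simp add: lincomb_def sc_0)

lemma lincomb_cong: "(\<And>g. g \<in> carrier (cover_group n) \<Longrightarrow> f g = k g) \<Longrightarrow> lincomb n F f = lincomb n F k"
  unfolding lincomb_def by (rule sum.cong) auto

lemma lincomb_delta:
  fixes r :: "'r::{comm_ring, comm_monoid_mult}"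
  shows "k \<in> carrier (cover_group n) \<Longrightarrow> lincomb n F (delta k r) = sc r * F k"
proof -
  assume k: "k \<in> carrier (cover_group n)"
  have "lincomb n F (delta k r) = (\<Sum>g\<in>carrier (cover_group n). if g = k then sc r * F k else 0)"
    unfolding lincomb_def by (rule sum.cong) (auto simp: delta_def sc_0)
  then show ?thesis using k by (simp add: finite_cover)
qed

text \<open>The delta at the unit is a separating vector, since the operator of \<open>f\<close>
  sends it to \<open>f\<close>. Evaluating there also underlies \<open>coef\<close> and hence
  faithfulness for the spin algebra.\<close>

lemma lincomb_shift_inj:
  fixes f :: "cover \<Rightarrow> 'r::{comm_ring, comm_monoid_mult}"
  assumes "f \<in> carrier (group_algebra (cover_group n))"
  shows "app (lincomb n (shift n) f) (delta \<one>\<^bsub>cover_group n\<^esub> 1) = f"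
proof
  fix x
  let ?G = "carrier (cover_group n)"
  have "app (lincomb n (shift n) f) (delta \<one>\<^bsub>cover_group n\<^esub> 1) x =
      (\<Sum>g\<in>?G. f g * (if x \<in> ?G then delta \<one>\<^bsub>cover_group n\<^esub> 1 (inv\<^bsub>cover_group n\<^esub> g \<cdot>\<^bsub>n\<^esub> x) else 0))"
    by (simp add: lincomb_def app_sum)
  also have "\<dots> = (\<Sum>g\<in>?G. if g = x then f x else 0)"
  proof (rule sum.cong[OF HOL.refl])
    fix g assume g: "g \<in> ?G"
    then have "x \<in> ?G \<Longrightarrow> inv\<^bsub>cover_group n\<^esub> g \<cdot>\<^bsub>n\<^esub> x = \<one>\<^bsub>cover_group n\<^esub> \<longleftrightarrow> g = x"
      by (metis cov.inv_closed cov.inv_equality cov.inv_inv cov.l_inv)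
    then show "f g * (if x \<in> ?G then delta \<one>\<^bsub>cover_group n\<^esub> 1 (inv\<^bsub>cover_group n\<^esub> g \<cdot>\<^bsub>n\<^esub> x) else 0) = (if g = x then f x else 0)"
      using g by (auto simp: delta_def)
  qed
  also have "\<dots> = f x" using assms by (auto simp: finite_cover carrier_group_algebra)
  finally show "app (lincomb n (shift n) f) (delta \<one>\<^bsub>cover_group n\<^esub> 1) x = f x" .
qed

lemma lincomb_shift_eqD:
  fixes f k :: "cover \<Rightarrow> 'r::{comm_ring, comm_monoid_mult}"
  assumes "f \<in> carrier (group_algebra (cover_group n))" "k \<in> carrier (group_algebra (cover_group n))"
    and "lincomb n (shift n) f = lincomb n (shift n) k"
  shows "f = k"
  using lincomb_shift_inj[OF assms(2)]
  unfolding assms(3)[symmetric] lincomb_shift_inj[OF assms(1)] .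

lemma delta_closed: "g \<in> carrier (cover_group n) \<Longrightarrow> delta g r \<in> carrier (group_algebra (cover_group n))"
  by (auto simp: carrier_group_algebra delta_def)

lemma shift_one_lincomb:
  fixes f :: "cover \<Rightarrow> 'r::{comm_ring, comm_monoid_mult}"
  shows "shift n \<one>\<^bsub>cover_group n\<^esub> * lincomb n (shift n) f = lincomb n (shift n) f"
    and "lincomb n (shift n) f * shift n \<one>\<^bsub>cover_group n\<^esub> = lincomb n (shift n) f"
proof -
  show "lincomb n (shift n) f * shift n \<one>\<^bsub>cover_group n\<^esub> = lincomb n (shift n) f"
    unfolding lincomb_def sum_distrib_right by (rule sum.cong) (auto simp: mult.assoc shift_mult)
  show "shift n \<one>\<^bsub>cover_group n\<^esub> * lincomb n (shift n) f = lincomb n (shift n) f"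
    unfolding lincomb_def sum_distrib_left
  proof (rule sum.cong[OF HOL.refl])
    fix g assume g: "g \<in> carrier (cover_group n)"
    have "shift n \<one>\<^bsub>cover_group n\<^esub> * (sc (f g) * shift n g) = sc (f g) * (shift n \<one>\<^bsub>cover_group n\<^esub> * shift n g)"
      unfolding mult.assoc[symmetric] sc_shift[of "f g" n "\<one>\<^bsub>cover_group n\<^esub>"] ..
    then show "shift n \<one>\<^bsub>cover_group n\<^esub> * (sc (f g) * shift n g) = sc (f g) * shift n g"
      using g by (simp add: shift_mult)
  qed
qed

text \<open>Associativity and distributivity of the convolution are inherited from the composition of operators.\<close>

lemma ring_group_algebra:
  "ring (group_algebra (cover_group n) :: (cover \<Rightarrow> 'r::{comm_ring, comm_monoid_mult}) ring)"
proof -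
  let ?A = "group_algebra (cover_group n) :: (cover \<Rightarrow> 'r) ring"
  let ?W = "lincomb n (shift n) :: (cover \<Rightarrow> 'r) \<Rightarrow> _"
  have m: "?W (f \<otimes>\<^bsub>?A\<^esub> k) = ?W f * ?W k" if "f \<in> carrier ?A" "k \<in> carrier ?A" for f k
    using that by (intro lincomb_mult shift_mult sc_shift)
  have a: "?W (f \<oplus>\<^bsub>?A\<^esub> k) = ?W f + ?W k" for f k
    by (simp add: group_algebra_sel lincomb_add)
  have ac: "f \<oplus>\<^bsub>?A\<^esub> k \<in> carrier ?A" if "f \<in> carrier ?A" "k \<in> carrier ?A" for f k
    using that by (simp add: group_algebra_sel carrier_group_algebra)
  note mc = group_algebra_mult_closed
  have one: "\<one>\<^bsub>?A\<^esub> \<in> carrier ?A" "?W \<one>\<^bsub>?A\<^esub> = shift n \<one>\<^bsub>cover_group n\<^esub>"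
    by (simp_all add: group_algebra_sel delta_closed lincomb_delta sc_1)
  have ab: "abelian_group ?A"
  proof (rule abelian_groupI)
    fix x assume "x \<in> carrier ?A"
    then have "(\<lambda>g. - x g) \<in> carrier ?A" "(\<lambda>g. - x g) \<oplus>\<^bsub>?A\<^esub> x = \<zero>\<^bsub>?A\<^esub>"
      by (auto simp: group_algebra_sel carrier_group_algebra)
    then show "\<exists>y\<in>carrier ?A. y \<oplus>\<^bsub>?A\<^esub> x = \<zero>\<^bsub>?A\<^esub>" by blast
  qed (auto simp: group_algebra_sel carrier_group_algebra ac_simps)
  have mon: "monoid ?A"
  proof (rule monoidI)
    fix x y z assume "x \<in> carrier ?A" "y \<in> carrier ?A" "z \<in> carrier ?A"
    then show "x \<otimes>\<^bsub>?A\<^esub> y \<otimes>\<^bsub>?A\<^esub> z = x \<otimes>\<^bsub>?A\<^esub> (y \<otimes>\<^bsub>?A\<^esub> z)"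
      by (intro lincomb_shift_eqD[of _ n]) (simp_all add: mc m mult.assoc)
  next
    fix x assume x: "x \<in> carrier ?A"
    show "\<one>\<^bsub>?A\<^esub> \<otimes>\<^bsub>?A\<^esub> x = x" "x \<otimes>\<^bsub>?A\<^esub> \<one>\<^bsub>?A\<^esub> = x"
      by (rule lincomb_shift_eqD[of _ n]; use x one in \<open>simp add: mc m shift_one_lincomb\<close>)+
  qed (use mc one in auto)
  show ?thesis
    by (rule ringI[OF ab mon]; rule lincomb_shift_eqD[of _ n])
      (simp_all add: mc m a ac distrib_left distrib_right)
qed


subsection \<open>The faithful representation of the spin group algebra\<close>

lemma mult_commute_shuffle:
  fixes c d e :: "'a::semigroup_mult"
  assumes "d * c = c * d" shows "(c * d) * (c * e) = c * (c * (d * e))"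
  using assms by (metis mult.assoc)

locale spin =
  fixes n :: nat and h :: "'r::{comm_ring, comm_monoid_mult}"
  assumes half: "(1 + 1) * h = 1"
begin

abbreviation "G \<equiv> carrier (cover_group n)"
abbreviation "A \<equiv> (group_algebra (cover_group n) :: (cover \<Rightarrow> 'r) ring)"
abbreviation "B \<equiv> (spin_algebra n :: 'r spin ring)"

sublocale A: ring A
  by (rule ring_group_algebra)

lemma half_add: "h * x + h * x = (x :: 'r)"
proof -
  have "h * x + h * x = ((1 + 1) * h) * x" by (simp add: distrib_right)
  then show ?thesis by (simp add: half)
qed

text \<open>Translation by \<open>g\<close> times the central idempotent \<open>h (1 - z)\<close>,
  on whose image \<open>z\<close> acts as -1.\<close>

definition S :: "cover \<Rightarrow> (cover, 'r) endo" where
  "S g = sc h * (shift n g - shift n (zz n \<cdot>\<^bsub>n\<^esub> g))"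

lemma S_mult:
  assumes "g \<in> G" "k \<in> G" shows "S g * S k = S (g \<cdot>\<^bsub>n\<^esub> k)"
proof -
  let ?s = "shift n :: _ \<Rightarrow> (cover, 'r) endo"
  have "(?s g - ?s (zz n \<cdot>\<^bsub>n\<^esub> g)) * (?s k - ?s (zz n \<cdot>\<^bsub>n\<^esub> k)) =
      ?s (g \<cdot>\<^bsub>n\<^esub> k) - ?s (zz n \<cdot>\<^bsub>n\<^esub> (g \<cdot>\<^bsub>n\<^esub> k)) + (?s (g \<cdot>\<^bsub>n\<^esub> k) - ?s (zz n \<cdot>\<^bsub>n\<^esub> (g \<cdot>\<^bsub>n\<^esub> k)))"
    using assms
    by (simp add: left_diff_distrib right_diff_distrib shift_mult cov.m_assoc zz_left[of g] zz_zz_left)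
  moreover have "S g * S k = sc h * (sc h * ((?s g - ?s (zz n \<cdot>\<^bsub>n\<^esub> g)) * (?s k - ?s (zz n \<cdot>\<^bsub>n\<^esub> k))))"
  proof -
    have "(?s g - ?s (zz n \<cdot>\<^bsub>n\<^esub> g)) * sc h = sc h * (?s g - ?s (zz n \<cdot>\<^bsub>n\<^esub> g))"
      by (simp add: sc_shift left_diff_distrib right_diff_distrib)
    then show ?thesis unfolding S_def by (rule mult_commute_shuffle)
  qed
  ultimately have "S g * S k = sc h * (sc h * (?s (g \<cdot>\<^bsub>n\<^esub> k) - ?s (zz n \<cdot>\<^bsub>n\<^esub> (g \<cdot>\<^bsub>n\<^esub> k))) +
      sc h * (?s (g \<cdot>\<^bsub>n\<^esub> k) - ?s (zz n \<cdot>\<^bsub>n\<^esub> (g \<cdot>\<^bsub>n\<^esub> k))))"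
    by (simp add: distrib_left)
  also have "\<dots> = S (g \<cdot>\<^bsub>n\<^esub> k)"
    unfolding S_def by (rule endo_eqI) (simp add: half_add)
  finally show ?thesis .
qed

lemma sc_S: "sc r * S g = S g * sc r"
  unfolding S_def by (rule endo_eqI) (simp add: algebra_simps)

lemma S_zz: "g \<in> G \<Longrightarrow> S (zz n \<cdot>\<^bsub>n\<^esub> g) = - S g"
  by (simp add: S_def zz_zz_left right_diff_distrib)

text \<open>At the delta of the unit, \<open>S g\<close> has the value \<open>h\<close> at
  \<open>g\<close> and \<open>- h\<close> at \<open>z g\<close>. Doubling normalises these to 1 and
  -1.\<close>

definition coef :: "(cover, 'r) endo \<Rightarrow> cover \<Rightarrow> 'r" where
  "coef X g = app X (delta \<one>\<^bsub>cover_group n\<^esub> 1) g + app X (delta \<one>\<^bsub>cover_group n\<^esub> 1) g"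

lemma coef_add: "coef (X + Y) g = coef X g + coef Y g"
  and coef_diff: "coef (X - Y) g = coef X g - coef Y g"
  and coef_minus: "coef (- X) g = - coef X g"
  and coef_zero: "coef 0 g = 0"
  and coef_sc: "coef (sc r * X) g = r * coef X g"
  by (simp_all add: coef_def algebra_simps)

lemma coef_sum: "coef (sum X I) g = (\<Sum>i\<in>I. coef (X i) g)"
  by (induction I rule: infinite_finite_induct) (auto simp: coef_add coef_zero)

lemma coef_S:
  assumes "g \<in> G" "k \<in> G"
  shows "coef (S k) g = (if g = k then 1 else if g = zz n \<cdot>\<^bsub>n\<^esub> k then - 1 else 0)"
proof -
  have *: "inv\<^bsub>cover_group n\<^esub> a \<cdot>\<^bsub>n\<^esub> g = \<one>\<^bsub>cover_group n\<^esub> \<longleftrightarrow> g = a" if "a \<in> G" for a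
    using that assms(1) by (metis cov.inv_closed cov.inv_equality cov.inv_inv cov.l_inv)
  have "coef (S k) g = delta \<one>\<^bsub>cover_group n\<^esub> 1 (inv\<^bsub>cover_group n\<^esub> k \<cdot>\<^bsub>n\<^esub> g) -
     delta \<one>\<^bsub>cover_group n\<^esub> 1 (inv\<^bsub>cover_group n\<^esub> (zz n \<cdot>\<^bsub>n\<^esub> k) \<cdot>\<^bsub>n\<^esub> g)"
    unfolding coef_def S_def using assms by (simp add: half_add)
  also have "\<dots> = (if g = k then 1 else 0) - (if g = zz n \<cdot>\<^bsub>n\<^esub> k then 1 else 0)"
    using *[of k] *[of "zz n \<cdot>\<^bsub>n\<^esub> k"] assms by (simp add: delta_def)
  finally show ?thesis using zz_mult_neq[OF assms(2)] by auto
qed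

abbreviation lin :: "(cover \<Rightarrow> 'r) \<Rightarrow> (cover, 'r) endo" where
  "lin \<equiv> lincomb n S"

lemma coef_lin:
  assumes "g \<in> G" shows "coef (lin f) g = f g - f (zz n \<cdot>\<^bsub>n\<^esub> g)"
proof -
  have "coef (lin f) g = (\<Sum>k\<in>G. f k * (if g = k then 1 else if g = zz n \<cdot>\<^bsub>n\<^esub> k then - 1 else 0))"
    unfolding lincomb_def coef_sum by (rule sum.cong) (simp_all add: coef_sc coef_S assms)
  also have "\<dots> = (\<Sum>k\<in>G. (if k = g then f g else 0) + (if k = zz n \<cdot>\<^bsub>n\<^esub> g then - f (zz n \<cdot>\<^bsub>n\<^esub> g) else 0))"
  proof (rule sum.cong[OF HOL.refl])
    fix k assume "k \<in> G"
    then have "g = zz n \<cdot>\<^bsub>n\<^esub> k \<longleftrightarrow> k = zz n \<cdot>\<^bsub>n\<^esub> g" using assms zz_zz_left by metis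
    then show "f k * (if g = k then 1 else if g = zz n \<cdot>\<^bsub>n\<^esub> k then - 1 else 0) =
        (if k = g then f g else 0) + (if k = zz n \<cdot>\<^bsub>n\<^esub> g then - f (zz n \<cdot>\<^bsub>n\<^esub> g) else 0)"
      using zz_mult_neq[OF assms] by auto
  qed
  also have "\<dots> = f g - f (zz n \<cdot>\<^bsub>n\<^esub> g)"
    using assms by (simp add: sum.distrib finite_cover)
  finally show ?thesis .
qed

lemma lin_shift_zz: "lin (\<lambda>g. f (zz n \<cdot>\<^bsub>n\<^esub> g)) = - lin f"
proof -
  have bij: "bij_betw (\<lambda>g. zz n \<cdot>\<^bsub>n\<^esub> g) G G"
    by (rule bij_betw_byWitness[where f' = "\<lambda>g. zz n \<cdot>\<^bsub>n\<^esub> g"]) (auto simp: zz_zz_left)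
  have "- lin f = (\<Sum>g\<in>G. sc (f g) * S (zz n \<cdot>\<^bsub>n\<^esub> g))"
    unfolding lincomb_def sum_negf[symmetric] by (rule sum.cong) (simp_all add: S_zz)
  also have "\<dots> = (\<Sum>g\<in>G. sc (f (zz n \<cdot>\<^bsub>n\<^esub> g)) * S (zz n \<cdot>\<^bsub>n\<^esub> (zz n \<cdot>\<^bsub>n\<^esub> g)))"
    by (rule sum.reindex_bij_betw[OF bij, symmetric])
  also have "\<dots> = lin (\<lambda>g. f (zz n \<cdot>\<^bsub>n\<^esub> g))"
    unfolding lincomb_def by (rule sum.cong) (simp_all add: zz_zz_left)
  finally show ?thesis by simp
qed

text \<open>The sum runs over both \<open>g\<close> and \<open>z g\<close>, which contribute
  equally, so the coefficients have to be halved. It follows that coefficients determine operators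
  in the image.\<close>

lemma lin_coef: "lin (\<lambda>g. h * coef (lin f) g) = lin f"
proof -
  have "lin (\<lambda>g. h * coef (lin f) g) = lin (\<lambda>g. h * f g + - (h * f (zz n \<cdot>\<^bsub>n\<^esub> g)))"
    by (rule lincomb_cong) (simp add: coef_lin algebra_simps)
  also have "\<dots> = lin (\<lambda>g. h * f g) + lin (\<lambda>g. h * f g)"
    unfolding lincomb_add lincomb_minus using lin_shift_zz[of "\<lambda>g. h * f g"] by simp
  also have "\<dots> = lin f" unfolding lincomb_add[symmetric] by (simp add: half_add)
  finally show ?thesis .
qed

lemma lin_eqI:
  assumes "\<And>g. g \<in> G \<Longrightarrow> coef (lin f) g = coef (lin k) g" shows "lin f = lin k"
proof -
  have "lin (\<lambda>g. h * coef (lin f) g) = lin (\<lambda>g. h * coef (lin k) g)"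
    using assms by (intro lincomb_cong) simp
  then show ?thesis by (simp add: lin_coef)
qed

lemma lin_mult: "f \<in> carrier A \<Longrightarrow> k \<in> carrier A \<Longrightarrow> lin (f \<otimes>\<^bsub>A\<^esub> k) = lin f * lin k"
  by (intro lincomb_mult S_mult sc_S)

lemma A_minus: "f \<in> carrier A \<Longrightarrow> \<ominus>\<^bsub>A\<^esub> f = (\<lambda>g. - f g)"
  by (rule A.minus_equality) (auto simp: group_algebra_sel carrier_group_algebra)

lemma ideal_kernel: "ideal {f \<in> carrier A. lin f = 0} A"
proof (rule idealI[OF A.ring_axioms])
  show "subgroup {f \<in> carrier A. lin f = 0} (add_monoid A)"
  proof (rule A.add.subgroupI)
    fix f assume f: "f \<in> {f \<in> carrier A. lin f = 0}"
    then have "\<ominus>\<^bsub>A\<^esub> f = (\<lambda>g. - f g)" using A_minus by blast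
    then show "\<ominus>\<^bsub>A\<^esub> f \<in> {f \<in> carrier A. lin f = 0}"
      using f by (auto simp: lincomb_minus carrier_group_algebra)
  next
    have "\<zero>\<^bsub>A\<^esub> \<in> {f \<in> carrier A. lin f = 0}" by (simp add: group_algebra_sel(1) lincomb_zero carrier_group_algebra)
    then show "{f \<in> carrier A. lin f = 0} \<noteq> {}" by blast
  qed (auto simp: group_algebra_sel lincomb_add carrier_group_algebra)
next
  fix f k assume "f \<in> {f \<in> carrier A. lin f = 0}" "k \<in> carrier A"
  then show "k \<otimes>\<^bsub>A\<^esub> f \<in> {f \<in> carrier A. lin f = 0}" "f \<otimes>\<^bsub>A\<^esub> k \<in> {f \<in> carrier A. lin f = 0}"
    by (simp_all add: lin_mult)
qed

lemma relator_closed: "delta (zz n) 1 \<oplus>\<^bsub>A\<^esub> \<one>\<^bsub>A\<^esub> \<in> carrier A"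
  by (intro A.a_closed delta_closed A.one_closed) simp

lemma spin_ideal_eq_Idl: "spin_ideal n = Idl\<^bsub>A\<^esub> {delta (zz n) 1 \<oplus>\<^bsub>A\<^esub> \<one>\<^bsub>A\<^esub>}"
  by (simp add: spin_ideal_def zz_def Let_def)

lemma ideal_spin: "ideal (spin_ideal n) A"
  unfolding spin_ideal_eq_Idl using relator_closed by (intro A.genideal_ideal) simp

text \<open>If \<open>lin f = 0\<close>, then \<open>f\<close> agrees at \<open>g\<close> and
  \<open>z g\<close>, so \<open>f\<close> is the product of \<open>h f\<close> with
  \<open>z + 1\<close> and lies in the ideal. Conversely \<open>S\<close> sends \<open>z + 1\<close>
  to 0.\<close>

lemma spin_ideal_eq: "spin_ideal n = {f \<in> carrier A. lin f = 0}"
proof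
  have "lin (delta (zz n) 1 \<oplus>\<^bsub>A\<^esub> \<one>\<^bsub>A\<^esub>) = S (zz n) + S \<one>\<^bsub>cover_group n\<^esub>"
    unfolding group_algebra_sel lincomb_add by (simp add: lincomb_delta sc_1)
  also have "\<dots> = 0" using S_zz[of "\<one>\<^bsub>cover_group n\<^esub>"] by simp
  finally show "spin_ideal n \<subseteq> {f \<in> carrier A. lin f = 0}"
    unfolding spin_ideal_eq_Idl using ideal_kernel relator_closed by (intro A.genideal_minimal) auto
next
  show "{f \<in> carrier A. lin f = 0} \<subseteq> spin_ideal n"
  proof
    fix f assume f: "f \<in> {f \<in> carrier A. lin f = 0}"
    let ?hf = "\<lambda>g. h * f g" and ?r = "delta (zz n) 1 \<oplus>\<^bsub>A\<^esub> \<one>\<^bsub>A\<^esub>" and ?W = "lincomb n (shift n) :: _ \<Rightarrow> (cover, 'r) endo"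
    have fA: "f \<in> carrier A" and hf: "?hf \<in> carrier A" using f by (auto simp: carrier_group_algebra)
    have fz: "f (zz n \<cdot>\<^bsub>n\<^esub> g) = f g" if "g \<in> G" for g
      using coef_lin[OF that, of f] f by (simp add: coef_zero)
    have bij: "bij_betw (\<lambda>g. zz n \<cdot>\<^bsub>n\<^esub> g) G G"
      by (rule bij_betw_byWitness[where f' = "\<lambda>g. zz n \<cdot>\<^bsub>n\<^esub> g"]) (auto simp: zz_zz_left)
    have "?W ?hf * shift n (zz n) = (\<Sum>g\<in>G. sc (?hf g) * shift n (zz n \<cdot>\<^bsub>n\<^esub> g))"
      unfolding lincomb_def sum_distrib_right
      by (rule sum.cong) (simp_all add: mult.assoc shift_mult zz_central)
    also have "\<dots> = (\<Sum>g\<in>G. sc (?hf (zz n \<cdot>\<^bsub>n\<^esub> g)) * shift n (zz n \<cdot>\<^bsub>n\<^esub> g))"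
      by (rule sum.cong) (simp_all add: fz)
    also have "\<dots> = ?W ?hf" unfolding lincomb_def by (rule sum.reindex_bij_betw[OF bij])
    finally have z: "?W ?hf * shift n (zz n) = ?W ?hf" .
    have "?W (?hf \<otimes>\<^bsub>A\<^esub> ?r) = ?W ?hf * ?W ?r"
      using hf relator_closed by (intro lincomb_mult shift_mult sc_shift)
    also have "?W ?r = shift n (zz n) + shift n \<one>\<^bsub>cover_group n\<^esub>"
      unfolding group_algebra_sel lincomb_add by (simp add: lincomb_delta sc_1)
    also have "?W ?hf * (shift n (zz n) + shift n \<one>\<^bsub>cover_group n\<^esub>) = ?W ?hf + ?W ?hf"
      by (simp add: distrib_left z shift_one_lincomb)
    also have "\<dots> = ?W f" unfolding lincomb_add[symmetric] by (simp add: half_add)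
    finally have "?hf \<otimes>\<^bsub>A\<^esub> ?r = f"
      using hf relator_closed fA by (intro lincomb_shift_eqD[of _ n]) (auto intro: group_algebra_mult_closed)
    moreover have "?r \<in> spin_ideal n"
      unfolding spin_ideal_eq_Idl by (rule A.genideal_self'[OF relator_closed])
    ultimately show "f \<in> spin_ideal n" using ideal.I_l_closed[OF ideal_spin _ hf] by metis
  qed
qed

sublocale B: ring B
  unfolding spin_algebra_def by (rule ideal.quotient_is_ring[OF ideal_spin])

lemma proj_hom: "spin_proj n \<in> ring_hom A B"
  using ideal.rcos_ring_hom[OF ideal_spin] unfolding spin_proj_def spin_algebra_def by simp

lemma proj_closed [simp]: "f \<in> carrier A \<Longrightarrow> spin_proj n f \<in> carrier B"
  using proj_hom by (rule ring_hom_closed)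

lemma carrier_B: "x \<in> carrier B \<longleftrightarrow> (\<exists>f\<in>carrier A. x = spin_proj n f)"
  unfolding spin_algebra_def spin_proj_def by (auto simp: FactRing_def A_RCOSETS_defs a_r_coset_def)

lemma proj_eq_iff:
  assumes "f \<in> carrier A" "k \<in> carrier A"
  shows "spin_proj n f = spin_proj n k \<longleftrightarrow> lin f = lin k"
proof -
  have "spin_proj n f = spin_proj n k \<longleftrightarrow> f \<ominus>\<^bsub>A\<^esub> k \<in> spin_ideal n"
    unfolding spin_proj_def using A.quotient_eq_iff_same_a_r_cos[OF ideal_spin assms] by simp
  also have "f \<ominus>\<^bsub>A\<^esub> k = (\<lambda>g. f g + - k g)"
    unfolding a_minus_def A_minus[OF assms(2)] by (simp add: group_algebra_sel)
  also have "\<dots> \<in> spin_ideal n \<longleftrightarrow> lin f = lin k"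
    unfolding spin_ideal_eq mem_Collect_eq lincomb_add lincomb_minus
    using assms by (auto simp: carrier_group_algebra)
  finally show ?thesis .
qed

text \<open>The faithful representation of the quotient. By \<open>proj_eq_iff\<close> the chosen
  representative does not affect the value.\<close>

definition Th :: "'r spin \<Rightarrow> (cover, 'r) endo" where
  "Th x = lin (SOME f. f \<in> carrier A \<and> x = spin_proj n f)"

lemma Th_proj: "f \<in> carrier A \<Longrightarrow> Th (spin_proj n f) = lin f"
  unfolding Th_def by (rule someI2[of _ f]) (auto simp: proj_eq_iff)

lemma Th_inj: "x \<in> carrier B \<Longrightarrow> y \<in> carrier B \<Longrightarrow> Th x = Th y \<Longrightarrow> x = y"
  unfolding carrier_B using Th_proj proj_eq_iff by metis

lemma Th_add: "x \<in> carrier B \<Longrightarrow> y \<in> carrier B \<Longrightarrow> Th (x \<oplus>\<^bsub>B\<^esub> y) = Th x + Th y"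
proof -
  assume "x \<in> carrier B" "y \<in> carrier B"
  then obtain f k where fk: "f \<in> carrier A" "k \<in> carrier A" "x = spin_proj n f" "y = spin_proj n k"
    by (auto simp: carrier_B)
  then have "x \<oplus>\<^bsub>B\<^esub> y = spin_proj n (f \<oplus>\<^bsub>A\<^esub> k)" by (simp add: ring_hom_add[OF proj_hom])
  also have "Th \<dots> = lin (f \<oplus>\<^bsub>A\<^esub> k)" using fk by (intro Th_proj A.a_closed)
  finally show ?thesis using fk by (simp add: Th_proj group_algebra_sel lincomb_add)
qed

lemma Th_mult: "x \<in> carrier B \<Longrightarrow> y \<in> carrier B \<Longrightarrow> Th (x \<otimes>\<^bsub>B\<^esub> y) = Th x * Th y"
proof -
  assume "x \<in> carrier B" "y \<in> carrier B"
  then obtain f k where fk: "f \<in> carrier A" "k \<in> carrier A" "x = spin_proj n f" "y = spin_proj n k"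
    by (auto simp: carrier_B)
  then have "x \<otimes>\<^bsub>B\<^esub> y = spin_proj n (f \<otimes>\<^bsub>A\<^esub> k)" by (simp add: ring_hom_mult[OF proj_hom])
  also have "Th \<dots> = lin (f \<otimes>\<^bsub>A\<^esub> k)" using fk by (intro Th_proj A.m_closed)
  finally show ?thesis using fk by (simp add: Th_proj lin_mult)
qed

lemma Th_one: "Th \<one>\<^bsub>B\<^esub> = S \<one>\<^bsub>cover_group n\<^esub>"
  using Th_proj[OF A.one_closed] ring_hom_one[OF proj_hom]
  by (simp add: group_algebra_sel lincomb_delta sc_1)

lemma Th_zero: "Th \<zero>\<^bsub>B\<^esub> = 0"
  using Th_add[OF B.zero_closed B.zero_closed] by simp

lemma Th_minus: "x \<in> carrier B \<Longrightarrow> Th (\<ominus>\<^bsub>B\<^esub> x) = - Th x"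
  using Th_add[of "\<ominus>\<^bsub>B\<^esub> x" x] by (simp add: B.l_neg Th_zero eq_neg_iff_add_eq_0)

lemma Th_finsum:
  assumes "finite I" "\<And>i. i \<in> I \<Longrightarrow> f i \<in> carrier B"
  shows "Th (\<Oplus>\<^bsub>B\<^esub>i\<in>I. f i) = (\<Sum>i\<in>I. Th (f i))"
  using assms
proof (induction I rule: finite_induct)
  case empty
  then show ?case by (simp add: Th_zero)
next
  case (insert i I)
  then have "f \<in> I \<rightarrow> carrier B" "f i \<in> carrier B" by auto
  then show ?case using insert by (simp add: B.finsum_insert Th_add B.finsum_closed)
qed

lemma spin_of_closed [simp]: "g \<in> G \<Longrightarrow> spin_of n g \<in> carrier B"
  by (simp add: spin_of_def delta_closed)

lemma Th_spin_of: "g \<in> G \<Longrightarrow> Th (spin_of n g) = S g"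
  by (simp add: spin_of_def Th_proj delta_closed lincomb_delta sc_1)

lemma scalar_closed [simp]: "scalar n r \<in> carrier B"
  by (simp add: scalar_def delta_closed)

lemma Th_scalar: "Th (scalar n r) = sc r * S \<one>\<^bsub>cover_group n\<^esub>"
  by (simp add: scalar_def Th_proj delta_closed lincomb_delta)

end


section \<open>Products of disjoint odd cycles as conjugacy classes of the double cover\<close>

lemma partition_list_exists:
  "sum_list ms \<le> length xs \<Longrightarrow> distinct xs \<Longrightarrow>
    \<exists>cs. map length cs = ms \<and> distinct (concat cs) \<and> set (concat cs) \<subseteq> set xs"
proof (induction ms arbitrary: xs)
  case (Cons m ms)
  then have "sum_list ms \<le> length (drop m xs)" "distinct (drop m xs)" by auto
  then obtain cs where cs: "map length cs = ms" "distinct (concat cs)" "set (concat cs) \<subseteq> set (drop m xs)"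
    using Cons.IH by blast
  have "set (take m xs) \<inter> set (drop m xs) = {}" using Cons.prems by (intro set_take_disj_set_drop_if_distinct) auto
  then have "map length (take m xs # cs) = m # ms \<and> distinct (concat (take m xs # cs)) \<and>
      set (concat (take m xs # cs)) \<subseteq> set xs"
    using cs Cons.prems set_take_subset[of m xs] set_drop_subset[of m xs] by auto
  then show ?case by (rule exI)
qed (auto intro: exI[of _ "[]"])

lemma permutes_extend:
  assumes "distinct xs" "distinct ys" "length xs = length ys" "set xs \<subseteq> {1..n::nat}" "set ys \<subseteq> {1..n}"
  shows "\<exists>p. p permutes {1..n} \<and> map p xs = ys"
proof -
  have "\<exists>f. bij_betw f (set xs) (set ys) \<and> map f xs = ys"
  proof (intro exI conjI)
    let ?f = "\<lambda>x. the (map_of (zip xs ys) x)"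
    show m: "map ?f xs = ys" using assms(1,3) by (intro nth_equalityI) (simp_all add: map_of_zip_nth)
    have "?f ` set xs = set ys" using m by (metis set_map)
    moreover have "card (set xs) = card (set ys)" using assms by (simp add: distinct_card)
    ultimately show "bij_betw ?f (set xs) (set ys)"
      unfolding bij_betw_def using eq_card_imp_inj_on[of "set xs" ?f] by simp
  qed
  then obtain f where f: "bij_betw f (set xs) (set ys)" "map f xs = ys" by blast
  have "card ({1..n} - set xs) = card ({1..n} - set ys)"
    using assms by (simp add: card_Diff_subset distinct_card)
  then obtain k where k: "bij_betw k ({1..n} - set xs) ({1..n} - set ys)"
    using finite_same_card_bij[of "{1..n} - set xs" "{1..n} - set ys"] by auto
  define p where "p = (\<lambda>x. if x \<in> set xs then f x else if x \<in> {1..n} then k x else x)"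
  have "bij_betw p (set xs) (set ys)" using f(1) by (subst bij_betw_cong[of _ _ f]) (auto simp: p_def)
  moreover have "bij_betw p ({1..n} - set xs) ({1..n} - set ys)"
    using k by (subst bij_betw_cong[of _ _ k]) (auto simp: p_def)
  ultimately have "bij_betw p (set xs \<union> ({1..n} - set xs)) (set ys \<union> ({1..n} - set ys))"
    by (rule bij_betw_combine) auto
  then have "bij_betw p {1..n} {1..n}" using assms by (simp add: Un_absorb1)
  then have "p permutes {1..n}" using assms(4) by (intro bij_imp_permutes) (auto simp: p_def)
  moreover have "map p xs = ys" unfolding f(2)[symmetric] by (auto simp: p_def)
  ultimately show ?thesis by blast
qed

lemma sorted_ge_mset_unique:
  fixes l l' :: "nat list"
  assumes "sorted_wrt (\<ge>) l" "sorted_wrt (\<ge>) l'" "mset l = mset l'" shows "l = l'"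
proof -
  have "sorted (rev l)" "sorted (rev l')" using assms by (simp_all add: sorted_wrt_rev)
  then have "rev l = rev l'" using assms(3) by (metis mset_rev properties_for_sort)
  then show ?thesis by simp
qed

lemma finite_even_partitions: "finite (even_partitions n)"
proof (rule finite_subset)
  show "even_partitions n \<subseteq> {l. set l \<subseteq> {..n} \<and> length l \<le> n}"
    by (auto simp: even_partitions_def dest!: member_le_sum_list)
qed (simp add: finite_lists_length_le)

definition has_type :: "nat \<Rightarrow> nat list \<Rightarrow> nat list list \<Rightarrow> bool" where
  "has_type n l cs \<longleftrightarrow> valid_cycles n cs \<and> map length cs = map Suc l"

lemma cycle_products_iff:
  assumes "l \<in> even_partitions n"
  shows "g \<in> cycle_products l n \<longleftrightarrow> (\<exists>cs. has_type n l cs \<and> g = cprod n cs)"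
proof -
  have "distinct (concat cs) \<and> set (concat cs) \<subseteq> {1..n} \<longleftrightarrow> valid_cycles n cs"
    if "map length cs = map Suc l" for cs
  proof
    assume *: "distinct (concat cs) \<and> set (concat cs) \<subseteq> {1..n}"
    have "valid_cycle n c" if "c \<in> set cs" for c
    proof -
      have "length c \<in> set (map Suc l)" unfolding \<open>map length cs = map Suc l\<close>[symmetric] using that by simp
      then have "2 \<le> length c" using assms by (auto simp: even_partitions_def Suc_le_eq)
      then show ?thesis using * that by (auto simp: valid_cycle_def distinct_concat_iff)
    qed
    then show "valid_cycles n cs" using * by (simp add: valid_cycles_def)
  next
    assume "valid_cycles n cs"
    then show "distinct (concat cs) \<and> set (concat cs) \<subseteq> {1..n}" using valid_cyclesD by blast
  qed
  then show ?thesis unfolding cycle_products_def has_type_def cprod_def by blast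
qed

lemma has_type_odd:
  assumes "l \<in> even_partitions n" "has_type n l cs" "c \<in> set cs" shows "odd (length c)"
proof -
  have "length c \<in> set (map Suc l)" using assms(2,3) unfolding has_type_def by (metis image_eqI set_map)
  then show ?thesis using assms(1) by (auto simp: even_partitions_def)
qed

lemma has_type_valid: "has_type n l cs \<Longrightarrow> valid_cycles n cs" "has_type n l cs \<Longrightarrow> c \<in> set cs \<Longrightarrow> valid_cycle n c"
  by (auto simp: has_type_def valid_cycles_def)

lemma has_type_sum: "has_type n l cs \<Longrightarrow> sum_list (map (\<lambda>c. length c - 1) cs) = sum_list l"
proof -
  assume "has_type n l cs"
  then have "map (\<lambda>c. length c - 1) cs = map (\<lambda>m. m - 1) (map Suc l)"
    unfolding has_type_def by (metis (no_types, lifting) map_eq_conv map_map o_apply)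
  then show ?thesis by (simp add: comp_def)
qed

lemma cycle_products_closed:
  "l \<in> even_partitions n \<Longrightarrow> g \<in> cycle_products l n \<Longrightarrow> g \<in> carrier (cover_group n)"
  by (auto simp: cycle_products_iff has_type_valid)

lemma finite_cycle_products: "l \<in> even_partitions n \<Longrightarrow> finite (cycle_products l n)"
  by (rule finite_subset[OF _ finite_cover[of n]]) (auto simp: cycle_products_closed)

lemma cycle_products_even:
  assumes "l \<in> even_partitions n" "g \<in> cycle_products l n" shows "\<not> cpar g"
proof -
  obtain cs where "has_type n l cs" "g = cprod n cs" using assms by (auto simp: cycle_products_iff)
  then show ?thesis using cpar_cprod_odd[of cs n] has_type_odd[OF assms(1)] has_type_valid by blast
qed

text \<open>The order and rotation of odd cycles are immaterial, so \<open>cprod_unique\<close>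
  applies. In particular \<open>g\<close> and \<open>z g\<close> never both occur, so the terms of
  \<open>d_l\<close> cannot cancel.\<close>

lemma cycle_products_unique:
  assumes "l \<in> even_partitions n" "l' \<in> even_partitions n" "g \<in> cycle_products l n" "g' \<in> cycle_products l' n"
    and "cperm g = cperm g'"
  shows "g = g'" "l = l'"
proof -
  obtain cs ds where cs: "has_type n l cs" "g = cprod n cs" and ds: "has_type n l' ds" "g' = cprod n ds"
    using assms by (auto simp: cycle_products_iff)
  have "cyc cs = cyc ds"
    using assms(5) cs ds has_type_valid(2)[OF cs(1)] has_type_valid(2)[OF ds(1)] by (simp add: cperm_cprod)
  then have *: "cprod n cs = cprod n ds \<and> mset (map length cs) = mset (map length ds)"
    using cs ds has_type_odd assms(1,2) by (intro cprod_unique) (auto simp: has_type_valid)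
  show "g = g'" using * cs ds by simp
  have "image_mset Suc (mset l) = image_mset Suc (mset l')"
    using * cs(1) ds(1) by (simp add: has_type_def flip: mset_map)
  then have "mset l = mset l'" using multiset.inj_map[of Suc] by (simp add: inj_def)
  then show "l = l'" using assms(1,2) by (intro sorted_ge_mset_unique) (auto simp: even_partitions_def)
qed

lemma cycle_products_nonempty:
  assumes "l \<in> even_partitions n" shows "\<exists>g. g \<in> cycle_products l n"
proof -
  have "sum_list (map Suc l) = sum_list l + length l" by (induction l) auto
  then have "sum_list (map Suc l) \<le> length (upto1 n)" using assms by (simp add: even_partitions_def upto1_def del: upt_Suc)
  then obtain cs where "map length cs = map Suc l" "distinct (concat cs)" "set (concat cs) \<subseteq> set (upto1 n)"
    using partition_list_exists[OF _ distinct_upto1] by blast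
  then show ?thesis unfolding cycle_products_def set_upto1 by blast
qed

lemma cycle_products_conj:
  assumes l: "l \<in> even_partitions n" and g: "g \<in> cycle_products l n" and k: "k \<in> carrier (cover_group n)"
  shows "\<exists>g'\<in>cycle_products l n. k \<cdot>\<^bsub>n\<^esub> g = g' \<cdot>\<^bsub>n\<^esub> k"
proof -
  obtain cs where cs: "has_type n l cs" "g = cprod n cs" using l g by (auto simp: cycle_products_iff)
  let ?ds = "map (map (cperm k)) cs"
  have p: "cperm k permutes {1..n}" by (rule cperm_permutes[OF k])
  have "distinct (concat ?ds)"
    using valid_cyclesD(1)[OF has_type_valid(1)[OF cs(1)]] permutes_inj_on[OF p]
    by (simp add: distinct_map flip: map_concat)
  moreover have "valid_cycle n d" if "d \<in> set ?ds" for d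
    using that valid_cycle_map[OF _ p] has_type_valid(2)[OF cs(1)] by auto
  ultimately have "has_type n l ?ds" using cs(1) by (simp add: has_type_def valid_cycles_def comp_def)
  then have "cprod n ?ds \<in> cycle_products l n" using l by (auto simp: cycle_products_iff)
  moreover have "k \<cdot>\<^bsub>n\<^esub> g = cprod n ?ds \<cdot>\<^bsub>n\<^esub> k"
    unfolding cs(2) using has_type_valid(2)[OF cs(1)] has_type_odd[OF l cs(1)] by (intro mult_cprod[OF k]) blast
  ultimately show ?thesis by blast
qed

text \<open>A permutation matching the entries of two cycle lists lifts to the cover, and odd cycles
  are conjugated without a sign. With \<open>cycle_products_conj\<close> this makes
  \<open>cycle_products\<close> a single conjugacy class.\<close>

lemma cycle_products_transitive:
  assumes l: "l \<in> even_partitions n" and g: "g \<in> cycle_products l n" "g' \<in> cycle_products l n"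
  shows "\<exists>k\<in>carrier (cover_group n). k \<cdot>\<^bsub>n\<^esub> g = g' \<cdot>\<^bsub>n\<^esub> k"
proof -
  obtain cs ds where cs: "has_type n l cs" "g = cprod n cs" and ds: "has_type n l ds" "g' = cprod n ds"
    using assms by (auto simp: cycle_products_iff)
  have len: "map length cs = map length ds" using cs ds by (simp add: has_type_def)
  note v = valid_cyclesD[OF has_type_valid(1)[OF cs(1)]] and v' = valid_cyclesD[OF has_type_valid(1)[OF ds(1)]]
  have "length (concat cs) = length (concat ds)" using len by (simp add: length_concat)
  then obtain p where p: "p permutes {1..n}" "map p (concat cs) = concat ds"
    using permutes_extend[OF v(1) v'(1) _ v(3) v'(3)] by blast
  obtain k where k: "k \<in> carrier (cover_group n)" "cperm k = p" using cperm_surj[OF p(1)] by blast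
  have "concat (map (map p) cs) = concat ds" using p(2) by (simp add: map_concat)
  moreover have "length (map (map p) cs) = length ds" using len by (metis length_map)
  moreover have "\<forall>(x, y)\<in>set (zip (map (map p) cs) ds). length x = length y"
  proof (clarify)
    fix x y assume "(x, y) \<in> set (zip (map (map p) cs) ds)"
    then obtain i where i: "i < length cs" "i < length ds" "x = map p (cs ! i)" "y = ds ! i"
      by (auto simp: in_set_zip)
    then show "length x = length y" using len by (metis length_map nth_map)
  qed
  ultimately have "map (map p) cs = ds" by (intro concat_injective) auto
  moreover have "k \<cdot>\<^bsub>n\<^esub> g = cprod n (map (map (cperm k)) cs) \<cdot>\<^bsub>n\<^esub> k"
    unfolding cs(2) using has_type_valid(2)[OF cs(1)] has_type_odd[OF l cs(1)] by (intro mult_cprod[OF k(1)]) blast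
  ultimately show ?thesis using k ds by auto
qed

text \<open>The distinction is whether all cycles have odd length. In the second case
  \<open>g\<close> is conjugate to \<open>z g\<close>, which will force its coefficient in a central
  element to vanish.\<close>

lemma cycle_type_cases:
  assumes g: "g \<in> carrier (cover_group n)" and even: "\<not> cpar g"
  obtains l where "l \<in> even_partitions n" "g \<in> cycle_products l n \<or> zz n \<cdot>\<^bsub>n\<^esub> g \<in> cycle_products l n"
  | k where "k \<in> carrier (cover_group n)" "k \<cdot>\<^bsub>n\<^esub> g = zz n \<cdot>\<^bsub>n\<^esub> (g \<cdot>\<^bsub>n\<^esub> k)"
proof -
  obtain cs b where cs: "valid_cycles n cs" "sorted_wrt (\<ge>) (map length cs)" "g = zs n b \<cdot>\<^bsub>n\<^esub> cprod n cs"
    using cover_decomposition[OF g] by blast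
  note v = valid_cyclesD[OF cs(1)]
  show thesis
  proof (cases "\<forall>c\<in>set cs. odd (length c)")
    case True
    define l where "l = map (\<lambda>c. length c - 1) cs"
    have 1: "map Suc l = map length cs" using v(7) by (fastforce simp: l_def)
    have len: "sum_list l + length l = length (concat cs)"
      using v(5) unfolding l_def by (induction cs) (auto simp: Suc_le_eq)
    have "length (concat cs) \<le> n" using card_mono[OF _ v(3)] distinct_card[OF v(1)] by simp
    moreover have "sorted_wrt (\<ge>) l"
      using cs(2) unfolding l_def sorted_wrt_map by (rule sorted_wrt_mono_rel[rotated]) auto
    moreover have "\<forall>p\<in>set l. 0 < p \<and> even p" using v(7) True by (fastforce simp: l_def)
    ultimately have l: "l \<in> even_partitions n" using len by (simp add: even_partitions_def)
    then have "cprod n cs \<in> cycle_products l n"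
      using 1 cs(1) by (auto simp: cycle_products_iff has_type_def intro!: exI[of _ cs])
    moreover have "cprod n cs = g \<or> cprod n cs = zz n \<cdot>\<^bsub>n\<^esub> g"
      using cs(3) v(4) by (cases b) (simp_all add: zz_zz_left)
    ultimately show ?thesis using that(1)[OF l] by metis
  next
    case False
    then obtain c where c: "c \<in> set cs" "even (length c)" by blast
    show ?thesis
      using that(2)[OF lifted_cycle(1)[OF v(4)[OF c(1)]] even_cycle_anticommute[OF cs(1,3) even c]] .
  qed
qed


subsection \<open>The even center and its basis\<close>

context spin
begin

definition Im :: "(cover, 'r) endo set" where
  "Im = range lin"

lemma Im_eqI: "X \<in> Im \<Longrightarrow> Y \<in> Im \<Longrightarrow> (\<And>g. g \<in> G \<Longrightarrow> coef X g = coef Y g) \<Longrightarrow> X = Y"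
  unfolding Im_def using lin_eqI by blast

lemma sc_mult_lin: "sc r * lin f = lin (\<lambda>g. r * f g)"
  by (simp add: lincomb_def sum_distrib_left sc_mult mult.assoc)

lemma lin_delta: "g \<in> G \<Longrightarrow> lin (delta g 1) = S g"
  by (simp add: lincomb_delta sc_1)

lemma coef_zz: "X \<in> Im \<Longrightarrow> g \<in> G \<Longrightarrow> coef X (zz n \<cdot>\<^bsub>n\<^esub> g) = - coef X g"
  by (auto simp: Im_def coef_lin zz_zz_left)

definition graded :: "bool \<Rightarrow> (cover, 'r) endo set" where
  "graded p = {lin f |f. \<forall>g\<in>G. cpar g \<noteq> p \<longrightarrow> f g = 0}"

lemma graded_Im: "X \<in> graded p \<Longrightarrow> X \<in> Im"
  by (auto simp: graded_def Im_def)

lemma graded_S: "g \<in> G \<Longrightarrow> S g \<in> graded (cpar g)"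
proof -
  assume "g \<in> G"
  then have "S g = lin (delta g 1)" by (simp add: lin_delta)
  moreover have "\<forall>k\<in>G. cpar k \<noteq> cpar g \<longrightarrow> delta g 1 k = (0::'r)" by (auto simp: delta_def)
  ultimately show ?thesis unfolding graded_def by blast
qed

lemma graded_zero: "0 \<in> graded p"
  unfolding graded_def by (auto simp: lincomb_zero intro!: exI[of _ "\<lambda>_. 0"])

lemma graded_add:
  assumes "X \<in> graded p" "Y \<in> graded p" shows "X + Y \<in> graded p"
proof -
  obtain f k where "X = lin f" "Y = lin k" "\<forall>g\<in>G. cpar g \<noteq> p \<longrightarrow> f g = 0" "\<forall>g\<in>G. cpar g \<noteq> p \<longrightarrow> k g = 0"
    using assms by (auto simp: graded_def)
  then show ?thesis unfolding graded_def by (auto simp flip: lincomb_add intro!: exI[of _ "\<lambda>g. f g + k g"])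
qed

lemma graded_minus:
  assumes "X \<in> graded p" shows "- X \<in> graded p"
proof -
  obtain f where "X = lin f" "\<forall>g\<in>G. cpar g \<noteq> p \<longrightarrow> f g = 0" using assms by (auto simp: graded_def)
  then show ?thesis unfolding graded_def by (auto simp flip: lincomb_minus intro!: exI[of _ "\<lambda>g. - f g"])
qed

lemma graded_sc:
  assumes "X \<in> graded p" shows "sc r * X \<in> graded p"
proof -
  obtain f where "X = lin f" "\<forall>g\<in>G. cpar g \<noteq> p \<longrightarrow> f g = 0" using assms by (auto simp: graded_def)
  then show ?thesis unfolding graded_def by (auto simp: sc_mult_lin intro!: exI[of _ "\<lambda>g. r * f g"])
qed

lemma graded_sum: "(\<And>i. i \<in> I \<Longrightarrow> X i \<in> graded p) \<Longrightarrow> (\<Sum>i\<in>I. X i) \<in> graded p"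
  by (induction I rule: infinite_finite_induct) (auto intro: graded_zero graded_add)

lemma graded_mult:
  assumes "X \<in> graded p" "Y \<in> graded q" shows "X * Y \<in> graded (p \<noteq> q)"
proof -
  obtain f k where f: "X = lin f" "Y = lin k" "\<forall>g\<in>G. cpar g \<noteq> p \<longrightarrow> f g = 0" "\<forall>g\<in>G. cpar g \<noteq> q \<longrightarrow> k g = 0"
    using assms by (auto simp: graded_def)
  have "sc (f a) * S a * (sc (k b) * S b) \<in> graded (p \<noteq> q)" if ab: "a \<in> G" "b \<in> G" for a b
  proof -
    have eq: "sc (f a) * S a * (sc (k b) * S b) = sc (f a * k b) * S (a \<cdot>\<^bsub>n\<^esub> b)"
    proof -
      have "sc (f a) * S a * (sc (k b) * S b) = sc (f a) * (S a * sc (k b)) * S b" by (simp add: mult.assoc)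
      also have "\<dots> = sc (f a) * sc (k b) * (S a * S b)" unfolding sc_S[symmetric] by (simp add: mult.assoc)
      finally show ?thesis using ab by (simp add: S_mult sc_mult)
    qed
    show ?thesis
    proof (cases "cpar a = p \<and> cpar b = q")
      case True
      then show ?thesis unfolding eq using graded_S[of "a \<cdot>\<^bsub>n\<^esub> b"] ab by (auto intro: graded_sc)
    next
      case False
      then have "f a * k b = 0" using f ab by auto
      then show ?thesis unfolding eq by (simp add: sc_0 graded_zero)
    qed
  qed
  then show ?thesis unfolding f lincomb_def sum_product by (intro graded_sum)
qed

text \<open>The image of the even center under \<open>Th\<close>. Commuting with all
  \<open>S k\<close> is enough, since these span the represented algebra.\<close>

definition Z :: "(cover, 'r) endo set" where
  "Z = {X \<in> graded False. \<forall>k\<in>G. S k * X = X * S k}"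

lemma Z_Im: "X \<in> Z \<Longrightarrow> X \<in> Im"
  by (auto simp: Z_def graded_Im)

lemma Z_add: "X \<in> Z \<Longrightarrow> Y \<in> Z \<Longrightarrow> X + Y \<in> Z"
  by (auto simp: Z_def graded_add distrib_left distrib_right)

lemma Z_minus: "X \<in> Z \<Longrightarrow> - X \<in> Z"
  by (auto simp: Z_def graded_minus)

lemma Z_diff: "X \<in> Z \<Longrightarrow> Y \<in> Z \<Longrightarrow> X - Y \<in> Z"
  using Z_add[of X "- Y"] Z_minus[of Y] by simp

lemma Z_zero: "0 \<in> Z"
  by (simp add: Z_def graded_zero)

lemma Z_sum: "(\<And>i. i \<in> I \<Longrightarrow> X i \<in> Z) \<Longrightarrow> (\<Sum>i\<in>I. X i) \<in> Z"
  by (induction I rule: infinite_finite_induct) (auto intro: Z_zero Z_add)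

lemma Z_sc: "X \<in> Z \<Longrightarrow> sc r * X \<in> Z"
proof -
  assume X: "X \<in> Z"
  have "S k * (sc r * X) = sc r * X * S k" if "k \<in> G" for k
  proof -
    have "S k * (sc r * X) = sc r * (S k * X)" unfolding mult.assoc[symmetric] sc_S[of r k] ..
    also have "S k * X = X * S k" using X that by (simp add: Z_def)
    finally show ?thesis by (simp add: mult.assoc)
  qed
  then show ?thesis using X by (simp add: Z_def graded_sc)
qed

lemma Z_mult: "X \<in> Z \<Longrightarrow> Y \<in> Z \<Longrightarrow> X * Y \<in> Z"
proof -
  assume X: "X \<in> Z" "Y \<in> Z"
  have "S k * (X * Y) = X * Y * S k" if "k \<in> G" for k
  proof -
    have "S k * (X * Y) = (S k * X) * Y" by (simp add: mult.assoc)
    also have "S k * X = X * S k" using X that by (simp add: Z_def)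
    also have "X * S k * Y = X * (S k * Y)" by (simp add: mult.assoc)
    also have "S k * Y = Y * S k" using X that by (simp add: Z_def)
    finally show ?thesis by (simp add: mult.assoc)
  qed
  then show ?thesis using X graded_mult[of X False Y False] by (simp add: Z_def)
qed

lemma Z_one: "S \<one>\<^bsub>cover_group n\<^esub> \<in> Z"
  using graded_S[of "\<one>\<^bsub>cover_group n\<^esub>"] by (auto simp: Z_def S_mult)

text \<open>Compare coefficients at the product of \<open>k\<close> and \<open>g\<close>: in
  \<open>S k * X\<close> it is the coefficient of \<open>X\<close> at \<open>g\<close>, in
  \<open>X * S k\<close> the one at \<open>g'\<close>.\<close>

lemma coef_conj:
  assumes "X \<in> Z" "g \<in> G" "k \<in> G" "g' \<in> G" "k \<cdot>\<^bsub>n\<^esub> g = g' \<cdot>\<^bsub>n\<^esub> k"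
  shows "coef X g = coef X g'"
proof -
  obtain f where X: "X = lin f" using assms(1) by (auto simp: Z_def graded_def)
  let ?i = "inv\<^bsub>cover_group n\<^esub> k"
  have bl: "bij_betw (\<lambda>g. k \<cdot>\<^bsub>n\<^esub> g) G G"
    by (rule bij_betw_byWitness[where f' = "\<lambda>g. ?i \<cdot>\<^bsub>n\<^esub> g"]) (use assms(3) in \<open>auto simp flip: cov.m_assoc\<close>)
  have br: "bij_betw (\<lambda>g. g \<cdot>\<^bsub>n\<^esub> k) G G"
    by (rule bij_betw_byWitness[where f' = "\<lambda>g. g \<cdot>\<^bsub>n\<^esub> ?i"]) (use assms(3) in \<open>auto simp: cov.m_assoc\<close>)
  have "S k * X = (\<Sum>g\<in>G. sc (f g) * S (k \<cdot>\<^bsub>n\<^esub> g))"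
    unfolding X lincomb_def sum_distrib_left
  proof (rule sum.cong[OF HOL.refl])
    fix x assume x: "x \<in> G"
    have "S k * (sc (f x) * S x) = sc (f x) * (S k * S x)" unfolding mult.assoc[symmetric] sc_S[of "f x" k] ..
    then show "S k * (sc (f x) * S x) = sc (f x) * S (k \<cdot>\<^bsub>n\<^esub> x)" using x assms(3) by (simp add: S_mult)
  qed
  also have "\<dots> = (\<Sum>g\<in>G. sc (f (?i \<cdot>\<^bsub>n\<^esub> (k \<cdot>\<^bsub>n\<^esub> g))) * S (k \<cdot>\<^bsub>n\<^esub> g))"
    using assms(3) by (intro sum.cong) (simp_all flip: cov.m_assoc)
  also have "\<dots> = lin (\<lambda>g. f (?i \<cdot>\<^bsub>n\<^esub> g))"
    unfolding lincomb_def by (rule sum.reindex_bij_betw[OF bl])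
  finally have l: "S k * X = lin (\<lambda>g. f (?i \<cdot>\<^bsub>n\<^esub> g))" .
  have "X * S k = (\<Sum>g\<in>G. sc (f g) * S (g \<cdot>\<^bsub>n\<^esub> k))"
    unfolding X lincomb_def sum_distrib_right using assms(3)
    by (intro sum.cong) (simp_all add: mult.assoc S_mult)
  also have "\<dots> = (\<Sum>g\<in>G. sc (f ((g \<cdot>\<^bsub>n\<^esub> k) \<cdot>\<^bsub>n\<^esub> ?i)) * S (g \<cdot>\<^bsub>n\<^esub> k))"
    using assms(3) by (intro sum.cong) (simp_all add: cov.m_assoc)
  also have "\<dots> = lin (\<lambda>g. f (g \<cdot>\<^bsub>n\<^esub> ?i))"
    unfolding lincomb_def by (rule sum.reindex_bij_betw[OF br])
  finally have r: "X * S k = lin (\<lambda>g. f (g \<cdot>\<^bsub>n\<^esub> ?i))" .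
  have "S k * X = X * S k" using assms(1,3) by (simp add: Z_def)
  then have "coef (lin (\<lambda>g. f (?i \<cdot>\<^bsub>n\<^esub> g))) (k \<cdot>\<^bsub>n\<^esub> g) = coef (lin (\<lambda>g. f (g \<cdot>\<^bsub>n\<^esub> ?i))) (k \<cdot>\<^bsub>n\<^esub> g)"
    unfolding l r by simp
  moreover have "coef (lin (\<lambda>g. f (?i \<cdot>\<^bsub>n\<^esub> g))) (k \<cdot>\<^bsub>n\<^esub> g) = coef X g"
  proof -
    have "?i \<cdot>\<^bsub>n\<^esub> (k \<cdot>\<^bsub>n\<^esub> g) = g" using assms(2,3) by (simp flip: cov.m_assoc)
    moreover from this have "?i \<cdot>\<^bsub>n\<^esub> (zz n \<cdot>\<^bsub>n\<^esub> (k \<cdot>\<^bsub>n\<^esub> g)) = zz n \<cdot>\<^bsub>n\<^esub> g"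
      using assms(2,3) zz_left[of ?i n "k \<cdot>\<^bsub>n\<^esub> g"] by simp
    ultimately show ?thesis using assms(2,3) by (simp add: X coef_lin)
  qed
  moreover have "coef (lin (\<lambda>g. f (g \<cdot>\<^bsub>n\<^esub> ?i))) (k \<cdot>\<^bsub>n\<^esub> g) = coef X g'"
    unfolding assms(5) using assms(3,4) by (simp add: X coef_lin cov.m_assoc)
  ultimately show ?thesis by simp
qed

definition dd :: "nat list \<Rightarrow> (cover, 'r) endo" where
  "dd l = (\<Sum>g\<in>cycle_products l n. S g)"

abbreviation "EP \<equiv> even_partitions n"

lemma dd_Z: assumes l: "l \<in> EP" shows "dd l \<in> Z"
proof -
  have "S g \<in> graded False" if "g \<in> cycle_products l n" for g
    using graded_S[OF cycle_products_closed[OF l that]] cycle_products_even[OF l that] by simp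
  then have gr: "dd l \<in> graded False" unfolding dd_def by (intro graded_sum)
  have "S k * dd l = dd l * S k" if k: "k \<in> G" for k
  proof -
    let ?i = "inv\<^bsub>cover_group n\<^esub> k"
    let ?c = "\<lambda>g. k \<cdot>\<^bsub>n\<^esub> g \<cdot>\<^bsub>n\<^esub> ?i"
    have c: "k \<cdot>\<^bsub>n\<^esub> g \<cdot>\<^bsub>n\<^esub> inv\<^bsub>cover_group n\<^esub> k \<in> cycle_products l n" if "g \<in> cycle_products l n" "k \<in> G" for g k
    proof -
      from cycle_products_conj[OF l that]
      obtain g' where g': "g' \<in> cycle_products l n" "k \<cdot>\<^bsub>n\<^esub> g = g' \<cdot>\<^bsub>n\<^esub> k" by blast
      show "k \<cdot>\<^bsub>n\<^esub> g \<cdot>\<^bsub>n\<^esub> inv\<^bsub>cover_group n\<^esub> k \<in> cycle_products l n"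
        unfolding g'(2) using g'(1) cycle_products_closed[OF l g'(1)] that(2) by (simp add: cov.m_assoc)
    qed
    have bij: "bij_betw ?c (cycle_products l n) (cycle_products l n)"
    proof (rule bij_betw_byWitness[where f' = "\<lambda>g. ?i \<cdot>\<^bsub>n\<^esub> g \<cdot>\<^bsub>n\<^esub> k"])
      show "?c ` cycle_products l n \<subseteq> cycle_products l n" using c k by auto
      show "(\<lambda>g. ?i \<cdot>\<^bsub>n\<^esub> g \<cdot>\<^bsub>n\<^esub> k) ` cycle_products l n \<subseteq> cycle_products l n" using c[of _ ?i] k by auto
      have "?i \<cdot>\<^bsub>n\<^esub> (k \<cdot>\<^bsub>n\<^esub> (g \<cdot>\<^bsub>n\<^esub> a)) = g \<cdot>\<^bsub>n\<^esub> a" "k \<cdot>\<^bsub>n\<^esub> (?i \<cdot>\<^bsub>n\<^esub> (g \<cdot>\<^bsub>n\<^esub> a)) = g \<cdot>\<^bsub>n\<^esub> a"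
        "?i \<cdot>\<^bsub>n\<^esub> (k \<cdot>\<^bsub>n\<^esub> g) = g" "k \<cdot>\<^bsub>n\<^esub> (?i \<cdot>\<^bsub>n\<^esub> g) = g"
        if "g \<in> G" "a \<in> G" for g a
        using that k by (simp_all flip: cov.m_assoc)
      then show "\<forall>a\<in>cycle_products l n. ?i \<cdot>\<^bsub>n\<^esub> ?c a \<cdot>\<^bsub>n\<^esub> k = a"
        "\<forall>a'\<in>cycle_products l n. ?c (?i \<cdot>\<^bsub>n\<^esub> a' \<cdot>\<^bsub>n\<^esub> k) = a'"
        using k cycle_products_closed[OF l] by (simp_all add: cov.m_assoc)
    qed
    have "dd l * S k = (\<Sum>g\<in>cycle_products l n. S (?c g) * S k)"
      unfolding dd_def sum_distrib_right by (rule sum.reindex_bij_betw[OF bij, symmetric])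
    also have "\<dots> = (\<Sum>g\<in>cycle_products l n. S k * S g)"
      using k cycle_products_closed[OF l] by (intro sum.cong) (simp_all add: S_mult cov.m_assoc)
    finally show ?thesis by (simp add: dd_def sum_distrib_left)
  qed
  then show ?thesis using gr by (simp add: Z_def)
qed

lemma coef_dd:
  assumes l: "l \<in> EP" "l' \<in> EP" and g: "g \<in> cycle_products l' n"
  shows "coef (dd l) g = (if l = l' then 1 else 0)"
proof -
  have gG: "g \<in> G" using cycle_products_closed[OF l(2) g] .
  have "coef (S k) g = (if k = g then 1 else 0)" if "k \<in> cycle_products l n" for k
  proof -
    have kG: "k \<in> G" using cycle_products_closed[OF l(1) that] .
    have "g \<noteq> zz n \<cdot>\<^bsub>n\<^esub> k"
      using cycle_products_unique(1)[OF l that g] kG zz_mult_neq[OF kG] by auto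
    then show ?thesis using coef_S[OF gG kG] by auto
  qed
  then have "coef (dd l) g = (\<Sum>k\<in>cycle_products l n. if k = g then 1 else 0)"
    unfolding dd_def coef_sum by (intro sum.cong) auto
  also have "\<dots> = (if g \<in> cycle_products l n then 1 else 0)"
    by (simp add: finite_cycle_products[OF l(1)])
  also have "g \<in> cycle_products l n \<longleftrightarrow> l = l'"
    using cycle_products_unique(2)[OF l _ g] g by auto
  finally show ?thesis .
qed

text \<open>On \<open>Z\<close> the choice is immaterial, because coefficients are constant on the
  class (\<open>dcoef_eq\<close>).\<close>

definition dcoef :: "(cover, 'r) endo \<Rightarrow> nat list \<Rightarrow> 'r" where
  "dcoef X l = coef X (SOME g. g \<in> cycle_products l n)"

lemma dcoef_eq:
  assumes "X \<in> Z" "l \<in> EP" "g \<in> cycle_products l n" shows "coef X g = dcoef X l"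
proof -
  let ?g = "SOME g. g \<in> cycle_products l n"
  have g': "?g \<in> cycle_products l n" using assms(3) by (rule someI)
  obtain k where "k \<in> G" "k \<cdot>\<^bsub>n\<^esub> g = ?g \<cdot>\<^bsub>n\<^esub> k" using cycle_products_transitive[OF assms(2,3) g'] by blast
  then show ?thesis unfolding dcoef_def
    using coef_conj[OF assms(1)] cycle_products_closed[OF assms(2)] assms(3) g' by blast
qed

lemma dcoef_sum:
  assumes "l \<in> EP" "L \<subseteq> EP"
  shows "dcoef (\<Sum>l\<in>L. sc (c l) * dd l) l = (if l \<in> L then c l else 0)"
proof -
  let ?g = "SOME g. g \<in> cycle_products l n"
  have g': "?g \<in> cycle_products l n" using cycle_products_nonempty[OF assms(1)] by (rule someI_ex)
  have "dcoef (\<Sum>l\<in>L. sc (c l) * dd l) l = (\<Sum>l'\<in>L. if l' = l then c l else 0)"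
    unfolding dcoef_def coef_sum coef_sc
    using coef_dd[OF _ assms(1) g'] assms(2) by (intro sum.cong) auto
  also have "\<dots> = (if l \<in> L then c l else 0)"
    using finite_subset[OF assms(2) finite_even_partitions] by simp
  finally show ?thesis .
qed

text \<open>Coefficients change sign under \<open>z\<close> and vanish at odd elements, so both
  sides are compared at even elements. Those over a product of odd cycles are settled by
  \<open>dcoef_sum\<close>; every other one is conjugate to its own \<open>z\<close>
  multiple.\<close>

theorem even_center_basis:
  assumes X: "X \<in> Z" shows "X = (\<Sum>l\<in>EP. sc (dcoef X l) * dd l)" (is "_ = ?Y")
proof -
  have Y: "?Y \<in> Z" by (intro Z_sum Z_sc dd_Z)
  have CP: "coef X g = coef ?Y g" if "l \<in> EP" "g \<in> cycle_products l n" for l g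
    using dcoef_eq[OF X that] dcoef_eq[OF Y that] dcoef_sum[OF that(1), of EP] that(1) by simp
  show ?thesis
  proof (rule Im_eqI[OF Z_Im[OF X] Z_Im[OF Y]])
    fix g assume g: "g \<in> G"
    show "coef X g = coef ?Y g"
    proof (cases "cpar g")
      case True
      have "coef W g = 0" if "W \<in> Z" for W
      proof -
        from that obtain f where "W = lin f" "\<forall>g\<in>G. cpar g \<longrightarrow> f g = 0" by (auto simp: Z_def graded_def)
        then show ?thesis using g True by (simp add: coef_lin)
      qed
      then show ?thesis using X Y by simp
    next
      case False
      from g False show ?thesis
      proof (cases rule: cycle_type_cases)
        case (1 l)
        from 1(2) show ?thesis
        proof (elim disjE)
          assume "zz n \<cdot>\<^bsub>n\<^esub> g \<in> cycle_products l n"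
          then have "- coef X g = - coef ?Y g"
            using CP[OF 1(1)] coef_zz[OF Z_Im[OF X] g] coef_zz[OF Z_Im[OF Y] g] by simp
          then show ?thesis by simp
        qed (use CP[OF 1(1)] in simp)
      next
        case (2 k)
        \<comment> \<open>Conjugation makes the coefficient equal to its negative; multiplying the
          doubled value by \<open>h\<close> gives 0.\<close>
        have "coef W g = 0" if "W \<in> Z" for W
        proof -
          have "coef W g = coef W (zz n \<cdot>\<^bsub>n\<^esub> g)"
            using 2 g by (intro coef_conj[OF that _ 2(1)]) (simp_all add: cov.m_assoc)
          then have "coef W g = - coef W g" using coef_zz[OF Z_Im[OF that] g] by simp
          then have "coef W g + coef W g = 0" by (simp add: eq_neg_iff_add_eq_0)
          then have "h * (coef W g + coef W g) = 0" by simp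
          then show ?thesis by (simp add: distrib_left half_add)
        qed
        then show ?thesis using X Y by simp
      qed
    qed
  qed
qed

lemma Th_even_center: "x \<in> even_center n \<longleftrightarrow> x \<in> carrier B \<and> Th x \<in> Z"
proof
  assume x: "x \<in> even_center n"
  then obtain f where f: "f \<in> carrier A" "{g. f g \<noteq> 0} \<subseteq> even_elems n" "x = spin_proj n f"
    by (auto simp: even_center_def even_part_def)
  then have xB: "x \<in> carrier B" by simp
  have "Th x = lin f" using f by (simp add: Th_proj)
  then have "Th x \<in> graded False" using f(2) by (auto simp: graded_def even_elems_eq)
  moreover have "S k * Th x = Th x * S k" if "k \<in> G" for k
  proof -
    have "x \<otimes>\<^bsub>B\<^esub> spin_of n k = spin_of n k \<otimes>\<^bsub>B\<^esub> x" using x that by (auto simp: even_center_def)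
    then have "Th (x \<otimes>\<^bsub>B\<^esub> spin_of n k) = Th (spin_of n k \<otimes>\<^bsub>B\<^esub> x)" by simp
    then show ?thesis using that xB by (simp add: Th_mult Th_spin_of)
  qed
  ultimately show "x \<in> carrier B \<and> Th x \<in> Z" using xB by (simp add: Z_def)
next
  assume x: "x \<in> carrier B \<and> Th x \<in> Z"
  then obtain f where f: "Th x = lin f" "\<forall>g\<in>G. cpar g \<longrightarrow> f g = 0" by (auto simp: Z_def graded_def)
  \<comment> \<open>\<open>even_part\<close> asks for a representative that vanishes off the even
    elements everywhere, while \<open>f\<close> is controlled only on \<open>G\<close>.\<close>
  let ?f = "\<lambda>g. if g \<in> even_elems n then f g else 0"
  have fA: "?f \<in> carrier A" by (auto simp: carrier_group_algebra even_elems_eq)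
  have "lin ?f = lin f" using f(2) by (intro lincomb_cong) (auto simp: even_elems_eq)
  then have "x = spin_proj n ?f" using x f(1) fA by (intro Th_inj) (auto simp: Th_proj)
  then have "x \<in> even_part n" using fA unfolding even_part_def by (auto split: if_splits)
  moreover have "x \<otimes>\<^bsub>B\<^esub> y = y \<otimes>\<^bsub>B\<^esub> x" if y: "y \<in> carrier B" for y
  proof -
    obtain k where k: "k \<in> carrier A" "y = spin_proj n k" using y by (auto simp: carrier_B)
    have "Th x * (sc (k g) * S g) = (sc (k g) * S g) * Th x" if "g \<in> G" for g
    proof -
      have "S g * Th x = Th x * S g" using x that by (simp add: Z_def)
      moreover have "Th x * sc r = sc r * Th x" for r
        unfolding f(1) lincomb_def sum_distrib_left sum_distrib_right
        by (intro sum.cong) (simp_all add: mult.assoc flip: sc_S, simp add: mult.commute flip: mult.assoc sc_mult)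
      ultimately show ?thesis by (simp add: mult.assoc) (simp flip: mult.assoc)
    qed
    then have "Th x * Th y = Th y * Th x"
      using k by (simp add: Th_proj) (simp add: lincomb_def sum_distrib_left sum_distrib_right)
    then show ?thesis using x y by (intro Th_inj) (auto simp: Th_mult)
  qed
  ultimately show "x \<in> even_center n" by (auto simp: even_center_def)
qed

end


section \<open>Words in lifted transpositions and identities for anticommuting elements\<close>

lemma lifted_pair_sq:
  assumes "i \<in> {1..n}" "k \<in> {1..n}" "i \<noteq> k"
  shows "lifted_cycle n [i, k] \<cdot>\<^bsub>n\<^esub> lifted_cycle n [i, k] = zz n"
proof -
  have v: "valid_cycle n [i, k]" using assms by (intro valid_cycle_pair)
  note lc = lifted_cycle[OF v]
  have ik: "1 \<le> i" "i \<le> n" "1 \<le> k" "k \<le> n" using assms by auto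
  let ?N = "Suc n" and ?x = "xx n i" and ?y = "xx n k"
  have [simp]: "?x \<in> carrier (cover_group ?N)" "?y \<in> carrier (cover_group ?N)" using ik by simp_all
  have "xp n [i, k, i] \<cdot>\<^bsub>?N\<^esub> xp n [i, k, i] = ?x \<cdot>\<^bsub>?N\<^esub> (?y \<cdot>\<^bsub>?N\<^esub> (?x \<cdot>\<^bsub>?N\<^esub> (?x \<cdot>\<^bsub>?N\<^esub> (?y \<cdot>\<^bsub>?N\<^esub> ?x))))"
    by (simp add: xp_Cons cov.m_assoc)
  also have "\<dots> = ?x \<cdot>\<^bsub>?N\<^esub> (?y \<cdot>\<^bsub>?N\<^esub> (zz ?N \<cdot>\<^bsub>?N\<^esub> (?y \<cdot>\<^bsub>?N\<^esub> ?x)))"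
    using ik xx_xx_left[of i n] by simp
  also have "\<dots> = zz ?N \<cdot>\<^bsub>?N\<^esub> (?x \<cdot>\<^bsub>?N\<^esub> (?y \<cdot>\<^bsub>?N\<^esub> (?y \<cdot>\<^bsub>?N\<^esub> ?x)))"
    by (simp add: zz_left[of ?x] zz_left[of ?y])
  also have "\<dots> = zz ?N \<cdot>\<^bsub>?N\<^esub> (zz ?N \<cdot>\<^bsub>?N\<^esub> (?x \<cdot>\<^bsub>?N\<^esub> ?x))"
    using ik xx_xx_left[of k n] by (simp add: zz_left[of ?x])
  also have "\<dots> = zz ?N"
    unfolding xx_xx[OF ik(1,2)] by (rule zz_zz_left) simp
  finally have "xp n [i, k, i] \<cdot>\<^bsub>Suc n\<^esub> xp n [i, k, i] = zz (Suc n)" .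
  then have "embed n (lifted_cycle n [i, k] \<cdot>\<^bsub>n\<^esub> lifted_cycle n [i, k]) = embed n (zz n)"
    unfolding embed_mult[OF lc(1) lc(1)] lc(2) by (simp add: cycle_word_def embed_zz)
  from inj_onD[OF inj_embed this] show ?thesis using lc(1) by simp
qed

lemma lifted_pair_closed [simp]:
  "i \<in> {1..n} \<Longrightarrow> k \<in> {1..n} \<Longrightarrow> i \<noteq> k \<Longrightarrow> lifted_cycle n [i, k] \<in> carrier (cover_group n)"
  by (intro lifted_cycle(1) valid_cycle_pair)

lemma mult_lifted_pair:
  assumes "g \<in> carrier (cover_group n)" "i \<in> {1..n}" "k \<in> {1..n}" "i \<noteq> k"
  shows "g \<cdot>\<^bsub>n\<^esub> lifted_cycle n [i, k] = zs n (cpar g) \<cdot>\<^bsub>n\<^esub> (lifted_cycle n [cperm g i, cperm g k] \<cdot>\<^bsub>n\<^esub> g)"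
  using mult_lifted_cycle[OF assms(1) valid_cycle_pair[OF assms(2-4)]] by simp

lemma cperm_lifted_pair: "i \<in> {1..n} \<Longrightarrow> k \<in> {1..n} \<Longrightarrow> i \<noteq> k \<Longrightarrow> cperm (lifted_cycle n [i, k]) = transpose i k"
  using valid_cycle_pair by simp

lemma cpar_lifted_pair: "i \<in> {1..n} \<Longrightarrow> k \<in> {1..n} \<Longrightarrow> i \<noteq> k \<Longrightarrow> cpar (lifted_cycle n [i, k])"
  using valid_cycle_pair by simp

lemma anticommute_sq:
  fixes a b :: "'a::ring"
  assumes "a * b = - (b * a)" shows "a * (b * b) = b * b * a"
proof -
  have "a * (b * b) = (a * b) * b" by (simp add: mult.assoc)
  also have "\<dots> = - (b * (a * b))" by (subst assms) (simp add: mult.assoc)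
  also have "\<dots> = b * b * a" by (subst assms) (simp add: mult.assoc)
  finally show ?thesis .
qed

lemma commute_mult:
  fixes a e x :: "'a::semigroup_mult"
  assumes "a * e = e * a" "e * x = x * e" shows "e * (a * x) = a * x * e"
  using assms by (metis mult.assoc)

lemma commute_exchange:
  fixes a p q r :: "'a::semigroup_mult"
  assumes "q * p = p * q" shows "(a * q) * (p * r) = (a * p) * (q * r)"
  using assms by (metis mult.assoc)

text \<open>Moving \<open>T\<close> past a square gives \<open>M^2 T = T N^2 + N - M\<close> and the
  same with \<open>M\<close> and \<open>N\<close> exchanged. The corrections cancel in the sum at
  once, and in the product because \<open>N\<close> commutes with \<open>M^2\<close>.\<close>

lemma two_symmetric_commute:
  fixes M N T e :: "'a::ring"
  assumes NT: "N * T = - (T * M) - e" and MT: "M * T = - (T * N) - e"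
    and e: "e * M = M" "M * e = M" "e * N = N" "N * e = N"
    and MN: "N * (M * M) = (M * M) * N" "(N * N) * (M * M) = (M * M) * (N * N)"
  shows "(M * M + N * N) * T = T * (M * M + N * N)" "(M * M * (N * N)) * T = T * (M * M * (N * N))"
proof -
  have "M * M * T = M * (- (T * N) - e)" by (simp add: mult.assoc MT)
  also have "\<dots> = - (M * T) * N - M" by (simp add: right_diff_distrib e mult.assoc)
  also have "\<dots> = T * (N * N) + N - M" unfolding MT by (simp add: distrib_right left_diff_distrib e mult.assoc)
  finally have M2: "M * M * T = T * (N * N) + N - M" .
  have "N * N * T = N * (- (T * M) - e)" by (simp add: mult.assoc NT)
  also have "\<dots> = - (N * T) * M - N" by (simp add: right_diff_distrib e mult.assoc)
  also have "\<dots> = T * (M * M) + M - N" unfolding NT by (simp add: distrib_right left_diff_distrib e mult.assoc)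
  finally have N2: "N * N * T = T * (M * M) + M - N" .
  show "(M * M + N * N) * T = T * (M * M + N * N)"
    unfolding distrib_right distrib_left M2 N2 by (simp add: algebra_simps)
  have "(M * M * (N * N)) * T = (M * M) * (N * N * T)" by (simp add: mult.assoc)
  also have "\<dots> = (M * M * T) * (M * M) + (M * M) * M - (M * M) * N"
    unfolding N2 by (simp add: right_diff_distrib distrib_left mult.assoc)
  also have "\<dots> = T * (N * N) * (M * M) + (N * (M * M) - (M * M) * N)"
    unfolding M2 by (simp add: left_diff_distrib distrib_right mult.assoc)
  also have "\<dots> = T * ((N * N) * (M * M))" using MN(1) by (simp add: mult.assoc)
  finally show "(M * M * (N * N)) * T = T * (M * M * (N * N))" unfolding MN(2) .
qed

definition valid_pairs :: "nat \<Rightarrow> (nat \<times> nat) list \<Rightarrow> bool" where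
  "valid_pairs n ws \<longleftrightarrow> (\<forall>(i, k)\<in>set ws. i \<in> {1..n} \<and> k \<in> {1..n} \<and> i \<noteq> k)"

definition pair_prod :: "nat \<Rightarrow> (nat \<times> nat) list \<Rightarrow> cover" where
  "pair_prod n ws = foldr (\<lambda>(i, k) g. lifted_cycle n [i, k] \<cdot>\<^bsub>n\<^esub> g) ws \<one>\<^bsub>cover_group n\<^esub>"

lemma pair_prod_Nil [simp]: "pair_prod n [] = \<one>\<^bsub>cover_group n\<^esub>"
  and pair_prod_Cons: "pair_prod n ((i, k) # ws) = lifted_cycle n [i, k] \<cdot>\<^bsub>n\<^esub> pair_prod n ws"
  by (simp_all add: pair_prod_def)

lemma valid_pairs_Nil [simp]: "valid_pairs n []"
  and valid_pairs_Cons: "valid_pairs n ((i, k) # ws) \<longleftrightarrow> i \<in> {1..n} \<and> k \<in> {1..n} \<and> i \<noteq> k \<and> valid_pairs n ws"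
  and valid_pairs_append: "valid_pairs n (us @ ws) \<longleftrightarrow> valid_pairs n us \<and> valid_pairs n ws"
  by (auto simp: valid_pairs_def)

lemma pair_prod_closed [simp]: "valid_pairs n ws \<Longrightarrow> pair_prod n ws \<in> carrier (cover_group n)"
proof (induction ws)
  case (Cons w ws)
  then show ?case by (cases w) (simp add: valid_pairs_Cons pair_prod_Cons)
qed simp

lemma pair_prod_append:
  "valid_pairs n us \<Longrightarrow> valid_pairs n ws \<Longrightarrow> pair_prod n (us @ ws) = pair_prod n us \<cdot>\<^bsub>n\<^esub> pair_prod n ws"
proof (induction us)
  case (Cons u us)
  then show ?case by (cases u) (simp add: valid_pairs_Cons pair_prod_Cons cov.m_assoc)
qed simp

lemma cperm_pair_prod: "valid_pairs n ws \<Longrightarrow> cperm (pair_prod n ws) = tprod ws"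
proof (induction ws)
  case (Cons w ws)
  then show ?case
    by (cases w) (simp add: valid_pairs_Cons pair_prod_Cons tprod_Cons cperm_lifted_pair)
qed simp

lemma star_prod_pairs: "star_prod n k is = pair_prod n (map (\<lambda>i. (i, k)) is)"
  by (induction "is") (simp_all add: star_prod_Cons pair_prod_Cons)

lemma lifted_cycle_pairs:
  assumes "valid_cycle n c"
  shows "\<exists>ws. valid_pairs n ws \<and> length ws = length c - 1 \<and> lifted_cycle n c = zz n \<cdot>\<^bsub>n\<^esub> pair_prod n ws"
proof -
  obtain k l where c: "c = k # l" using valid_cycle_nonempty[OF assms] by (cases c) auto
  have l: "set l \<subseteq> {1..n} - {k}" "k \<in> {1..n}" "l \<noteq> []" "distinct l"
    using assms c by (auto simp: valid_cycle_def)
  have "zz n \<cdot>\<^bsub>n\<^esub> star_prod n k (rev l) = lifted_cycle n c"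
    using star_prod_cycle[of "rev l" n k] l lifted_cycle(1)[OF assms] c by (simp add: zz_zz_left)
  moreover have "valid_pairs n (map (\<lambda>i. (i, k)) (rev l))" using l by (auto simp: valid_pairs_def)
  ultimately show ?thesis using c by (intro exI[of _ "map (\<lambda>i. (i, k)) (rev l)"]) (simp add: star_prod_pairs)
qed

lemma cprod_pairs:
  assumes "\<forall>c\<in>set cs. valid_cycle n c"
  shows "\<exists>ws b. valid_pairs n ws \<and> length ws = sum_list (map (\<lambda>c. length c - 1) cs) \<and>
    cprod n cs = zs n b \<cdot>\<^bsub>n\<^esub> pair_prod n ws"
  using assms
proof (induction cs)
  case Nil
  show ?case by (rule exI[of _ "[]"], rule exI[of _ False]) simp
next
  case (Cons c cs)
  then obtain ws b where ws: "valid_pairs n ws" "length ws = sum_list (map (\<lambda>c. length c - 1) cs)"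
    "cprod n cs = zs n b \<cdot>\<^bsub>n\<^esub> pair_prod n ws" by auto
  obtain us where us: "valid_pairs n us" "length us = length c - 1" "lifted_cycle n c = zz n \<cdot>\<^bsub>n\<^esub> pair_prod n us"
    using lifted_cycle_pairs[of n c] Cons.prems by auto
  have "cprod n (c # cs) = zs n True \<cdot>\<^bsub>n\<^esub> (pair_prod n us \<cdot>\<^bsub>n\<^esub> (zs n b \<cdot>\<^bsub>n\<^esub> pair_prod n ws))"
    using us ws by (simp add: cprod_Cons cov.m_assoc)
  also have "\<dots> = zs n (True \<noteq> b) \<cdot>\<^bsub>n\<^esub> pair_prod n (us @ ws)"
    using us ws by (simp only: zs_left[of "pair_prod n us"] zs_zs_left cov.m_closed pair_prod_closed pair_prod_append)
  finally show ?case using us ws by (intro exI[of _ "us @ ws"] exI[of _ "True \<noteq> b"]) (simp add: valid_pairs_append)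
qed


subsection \<open>The filtration by the number of transpositions\<close>

context spin
begin

text \<open>The span of the images of products of at most \<open>j\<close> lifted transpositions,
  built one summand at a time so that inductions have a single step.\<close>

inductive_set filt :: "nat \<Rightarrow> (cover, 'r) endo set" for j where
  zero: "0 \<in> filt j"
| add: "X \<in> filt j \<Longrightarrow> valid_pairs n ws \<Longrightarrow> length ws \<le> j \<Longrightarrow> X + sc r * S (pair_prod n ws) \<in> filt j"

lemma filt_S: "valid_pairs n ws \<Longrightarrow> length ws \<le> j \<Longrightarrow> S (pair_prod n ws) \<in> filt j"
  using filt.add[OF filt.zero, of ws j 1] by (simp add: sc_1)

lemma filt_add: "Y \<in> filt j \<Longrightarrow> X \<in> filt j \<Longrightarrow> X + Y \<in> filt j"
  by (induction rule: filt.induct) (auto simp flip: add.assoc intro: filt.add)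

lemma filt_sc: "X \<in> filt j \<Longrightarrow> sc r * X \<in> filt j"
proof (induction rule: filt.induct)
  case (add X ws s)
  have "sc r * (X + sc s * S (pair_prod n ws)) = sc r * X + sc (r * s) * S (pair_prod n ws)"
    by (simp add: distrib_left sc_mult mult.assoc)
  then show ?case using add by (simp add: filt.add)
qed (simp add: filt.zero)

lemma filt_minus: "X \<in> filt j \<Longrightarrow> - X \<in> filt j"
  using filt_sc[of X j "- 1"] by (simp add: sc_minus sc_1)

lemma filt_diff: "X \<in> filt j \<Longrightarrow> Y \<in> filt j \<Longrightarrow> X - Y \<in> filt j"
  using filt_add[of "- Y" j X] filt_minus[of Y] by simp

lemma filt_sum: "(\<And>i. i \<in> I \<Longrightarrow> X i \<in> filt j) \<Longrightarrow> (\<Sum>i\<in>I. X i) \<in> filt j"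
  by (induction I rule: infinite_finite_induct) (auto intro: filt.zero filt_add)

lemma filt_mono: "X \<in> filt i \<Longrightarrow> i \<le> j \<Longrightarrow> X \<in> filt j"
  by (induction rule: filt.induct) (auto intro: filt.intros)

lemma filt_sc_commute: "X \<in> filt j \<Longrightarrow> X * sc r = sc r * X"
proof (induction rule: filt.induct)
  case (add X ws s)
  have "sc s * S (pair_prod n ws) * sc r = sc (s * r) * S (pair_prod n ws)"
    unfolding mult.assoc sc_mult sc_S[of r, symmetric] ..
  also have "\<dots> = sc r * (sc s * S (pair_prod n ws))"
    by (simp add: mult.commute[of s] sc_mult mult.assoc)
  finally have "sc s * S (pair_prod n ws) * sc r = sc r * (sc s * S (pair_prod n ws))" .
  then show ?case using add by (simp add: distrib_left distrib_right)
qed simp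

lemma filt_mult_S:
  "X \<in> filt i \<Longrightarrow> valid_pairs n ws \<Longrightarrow> length ws \<le> j \<Longrightarrow> X * S (pair_prod n ws) \<in> filt (i + j)"
proof (induction rule: filt.induct)
  case (add X us r)
  have "(X + sc r * S (pair_prod n us)) * S (pair_prod n ws) =
      X * S (pair_prod n ws) + sc r * S (pair_prod n (us @ ws))"
    using add by (simp add: distrib_right mult.assoc S_mult pair_prod_append)
  then show ?case using add by (simp add: filt.add valid_pairs_append)
qed (simp add: filt.zero)

lemma filt_mult: "Y \<in> filt j \<Longrightarrow> X \<in> filt i \<Longrightarrow> X * Y \<in> filt (i + j)"
proof (induction rule: filt.induct)
  case (add Y ws r)
  have "X * (Y + sc r * S (pair_prod n ws)) = X * Y + sc r * (X * S (pair_prod n ws))"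
    using filt_sc_commute[OF add.prems, of r] by (simp add: distrib_left flip: mult.assoc)
  then show ?case using add by (simp add: filt_add filt_sc filt_mult_S)
qed (simp add: filt.zero)

text \<open>By \<open>cycles_of_tprod\<close> a permutation of this cycle type needs at least
  \<open>sum_list l\<close> transpositions, so shorter words never meet the class. This ties the
  filtration to the degree.\<close>

lemma filt_coef:
  assumes "X \<in> filt j" "l \<in> EP" "g \<in> cycle_products l n" "j < sum_list l"
  shows "coef X g = 0"
  using assms(1)
proof (induction rule: filt.induct)
  case (add X ws r)
  have gG: "g \<in> G" using cycle_products_closed[OF assms(2,3)] .
  have pG: "pair_prod n ws \<in> G" using add by simp
  obtain cs where cs: "has_type n l cs" "g = cprod n cs" using assms by (auto simp: cycle_products_iff)
  have "cperm g \<noteq> tprod ws"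
  proof
    assume "cperm g = tprod ws"
    then have "cyc cs = tprod ws" using cs has_type_valid(2)[OF cs(1)] by (simp add: cperm_cprod)
    then have "sum_list l \<le> length ws"
      using cycles_of_tprod(1)[OF has_type_valid(1)[OF cs(1)]] add.hyps(2) has_type_sum[OF cs(1)]
      by (simp add: valid_pairs_def)
    then show False using add assms(4) by simp
  qed
  then have "g \<noteq> pair_prod n ws" "g \<noteq> zz n \<cdot>\<^bsub>n\<^esub> pair_prod n ws"
    using cperm_pair_prod[OF add.hyps(2)] pG by auto
  then show ?case using add coef_S[OF gG pG] by (simp add: coef_add coef_sc)
qed (simp add: coef_zero)

lemma filt_dcoef:
  assumes "X \<in> filt j" "l \<in> EP" "j < sum_list l" shows "dcoef X l = 0"
  unfolding dcoef_def using cycle_products_nonempty[OF assms(2)]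
  by (intro filt_coef[OF assms(1,2) _ assms(3)]) (rule someI_ex)

lemma dd_filt: assumes l: "l \<in> EP" shows "dd l \<in> filt (sum_list l)"
  unfolding dd_def
proof (rule filt_sum)
  fix g assume "g \<in> cycle_products l n"
  then obtain cs where cs: "has_type n l cs" "g = cprod n cs" using l by (auto simp: cycle_products_iff)
  obtain ws b where ws: "valid_pairs n ws" "length ws = sum_list l" "g = zs n b \<cdot>\<^bsub>n\<^esub> pair_prod n ws"
    using cprod_pairs[of cs n] has_type_valid(2)[OF cs(1)] has_type_sum[OF cs(1)] cs(2) by auto
  then have "S (pair_prod n ws) \<in> filt (sum_list l)" by (intro filt_S) auto
  then show "S g \<in> filt (sum_list l)" using ws(1,3) by (cases b) (simp_all add: S_zz filt_minus)
qed


subsection \<open>Jucys-Murphy elements\<close>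

definition M :: "nat \<Rightarrow> (cover, 'r) endo" where
  "M k = (\<Sum>i\<in>{1..<k}. S (lifted_cycle n [i, k]))"

abbreviation eps :: "(cover, 'r) endo" where
  "eps \<equiv> S \<one>\<^bsub>cover_group n\<^esub>"

definition yy :: "nat \<Rightarrow> (cover, 'r) endo" where
  "yy k = M k * M k"

lemma eps_S [simp]: "g \<in> G \<Longrightarrow> eps * S g = S g" "g \<in> G \<Longrightarrow> S g * eps = S g"
  by (simp_all add: S_mult)

lemma M_pair: "k \<in> {1..n} \<Longrightarrow> i \<in> {1..<k} \<Longrightarrow> i \<in> {1..n} \<and> i \<noteq> k"
  by auto

lemma eps_M [simp]: "k \<in> {1..n} \<Longrightarrow> eps * M k = M k" "k \<in> {1..n} \<Longrightarrow> M k * eps = M k"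
  unfolding M_def sum_distrib_left sum_distrib_right
  using M_pair by (auto intro!: sum.cong)

lemma M_graded: "k \<in> {1..n} \<Longrightarrow> M k \<in> graded True"
  unfolding M_def
proof (rule graded_sum)
  fix i assume "k \<in> {1..n}" "i \<in> {1..<k}"
  then have "i \<in> {1..n}" "k \<in> {1..n}" "i \<noteq> k" by auto
  then show "S (lifted_cycle n [i, k]) \<in> graded True"
    using graded_S[of "lifted_cycle n [i, k]"] cpar_lifted_pair by simp
qed

lemma M_filt: "k \<in> {1..n} \<Longrightarrow> M k \<in> filt 1"
  unfolding M_def
proof (rule filt_sum)
  fix i assume "k \<in> {1..n}" "i \<in> {1..<k}"
  then have "valid_pairs n [(i, k)]" and "lifted_cycle n [i, k] \<in> G" by (auto simp: valid_pairs_def)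
  then show "S (lifted_cycle n [i, k]) \<in> filt 1"
    using filt_S[of "[(i, k)]" 1] by (simp add: pair_prod_Cons)
qed

text \<open>With \<open>i\<close> and \<open>j\<close> on the same side of \<open>k\<close>, the
  transposition fixes \<open>k\<close> and permutes the indices below it. Conjugation thus permutes
  the summands of \<open>M k\<close>, each with the sign of two odd elements.\<close>

lemma S_M_anticommute:
  assumes "i \<in> {1..n}" "j \<in> {1..n}" "i \<noteq> j" "k \<in> {1..n}" "i < k \<and> j < k \<or> k < i \<and> k < j"
  shows "S (lifted_cycle n [i, j]) * M k = - (M k * S (lifted_cycle n [i, j]))"
proof -
  let ?g = "lifted_cycle n [i, j]" and ?p = "transpose i j"
  have g: "?g \<in> G" "cperm ?g = ?p" "cpar ?g" using assms cperm_lifted_pair cpar_lifted_pair by auto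
  have bij: "bij_betw ?p {1..<k} {1..<k}"
    by (rule bij_betw_byWitness[where f' = ?p]) (use assms in \<open>auto simp: transpose_def\<close>)
  have pk: "?p k = k" using assms by (auto simp: transpose_def)
  have "S ?g * M k = (\<Sum>l\<in>{1..<k}. - (S (lifted_cycle n [?p l, k]) * S ?g))"
    unfolding M_def sum_distrib_left
  proof (rule sum.cong[OF HOL.refl])
    fix l assume l: "l \<in> {1..<k}"
    then have l': "l \<in> {1..n}" "l \<noteq> k" using assms by auto
    have "?p l \<in> {1..<k}" using bij l by (auto simp: bij_betw_def)
    then have pl: "?p l \<in> {1..n}" "?p l \<noteq> k" using assms by auto
    have "?g \<cdot>\<^bsub>n\<^esub> lifted_cycle n [l, k] = zz n \<cdot>\<^bsub>n\<^esub> (lifted_cycle n [?p l, k] \<cdot>\<^bsub>n\<^esub> ?g)"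
      using mult_lifted_pair[OF g(1) l'(1) assms(4) l'(2)] g pk by simp
    then show "S ?g * S (lifted_cycle n [l, k]) = - (S (lifted_cycle n [?p l, k]) * S ?g)"
      using g(1) l' pl assms(4) by (simp add: S_mult S_zz)
  qed
  also have "\<dots> = - ((\<Sum>l\<in>{1..<k}. S (lifted_cycle n [?p l, k])) * S ?g)"
    by (simp add: sum_negf sum_distrib_right)
  also have "(\<Sum>l\<in>{1..<k}. S (lifted_cycle n [?p l, k])) = M k"
    unfolding M_def by (rule sum.reindex_bij_betw[OF bij])
  finally show ?thesis .
qed

lemma M_anticommute:
  assumes "j \<in> {1..n}" "k \<in> {1..n}" "j < k" shows "M j * M k = - (M k * M j)"
proof -
  have "M j * M k = (\<Sum>i\<in>{1..<j}. S (lifted_cycle n [i, j]) * M k)" by (simp add: M_def[of j] sum_distrib_right)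
  also have "\<dots> = (\<Sum>i\<in>{1..<j}. - (M k * S (lifted_cycle n [i, j])))"
    using assms by (intro sum.cong[OF HOL.refl] S_M_anticommute) auto
  also have "\<dots> = - (M k * M j)" by (simp add: M_def[of j] sum_distrib_left sum_negf)
  finally show ?thesis .
qed

lemma M_yy_commute:
  assumes "j \<in> {1..n}" "k \<in> {1..n}" shows "M j * yy k = yy k * M j"
proof -
  consider "j < k" | "k < j" | "j = k" by linarith
  then have "j = k \<or> M j * M k = - (M k * M j)"
    using M_anticommute[OF assms] M_anticommute[OF assms(2,1)] by cases auto
  then show ?thesis
  proof
    assume "M j * M k = - (M k * M j)"
    then show ?thesis unfolding yy_def by (rule anticommute_sq)
  qed (simp add: yy_def mult.assoc)
qed

lemma yy_commute: "j \<in> {1..n} \<Longrightarrow> k \<in> {1..n} \<Longrightarrow> yy j * yy k = yy k * yy j"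
proof -
  assume jk: "j \<in> {1..n}" "k \<in> {1..n}"
  have "M j * (M j * yy k) = yy k * M j * M j"
    unfolding M_yy_commute[OF jk] by (simp add: M_yy_commute[OF jk] flip: mult.assoc)
  then show ?thesis by (simp add: yy_def[of j] mult.assoc)
qed

definition T :: "nat \<Rightarrow> (cover, 'r) endo" where
  "T j = S (lifted_cycle n [j, Suc j])"

text \<open>Conjugation by the lifted transposition turns \<open>[i, j]\<close> into
  \<open>z [i, j + 1]\<close> for \<open>i < j\<close>, and the one remaining summand of
  \<open>M (Suc j)\<close> is \<open>T j\<close> itself, with square \<open>- eps\<close>. The
  second relation is the first multiplied by \<open>T j\<close> on both sides.\<close>

lemma T_M_step:
  assumes "1 \<le> j" "j < n"
  shows "M (Suc j) * T j = - (T j * M j) - eps" "M j * T j = - (T j * M (Suc j)) - eps"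
proof -
  let ?g = "lifted_cycle n [j, Suc j]"
  have j: "j \<in> {1..n}" "Suc j \<in> {1..n}" using assms by auto
  then have g: "?g \<in> G" "cperm ?g = transpose j (Suc j)" "cpar ?g" using cperm_lifted_pair cpar_lifted_pair by auto
  have TT: "T j * T j = - eps"
    using lifted_pair_sq[of j n "Suc j"] j g(1) S_zz[of "\<one>\<^bsub>cover_group n\<^esub>"] by (simp add: T_def S_mult)
  have "T j * M j = (\<Sum>i\<in>{1..<j}. - (S (lifted_cycle n [i, Suc j]) * T j))"
    unfolding M_def sum_distrib_left
  proof (rule sum.cong[OF HOL.refl])
    fix i assume i: "i \<in> {1..<j}"
    then have i': "i \<in> {1..n}" "i \<noteq> j" "i \<noteq> Suc j" using j by auto
    have "?g \<cdot>\<^bsub>n\<^esub> lifted_cycle n [i, j] = zz n \<cdot>\<^bsub>n\<^esub> (lifted_cycle n [i, Suc j] \<cdot>\<^bsub>n\<^esub> ?g)"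
      using mult_lifted_pair[OF g(1) i'(1) j(1) i'(2)] g i' by simp
    then show "T j * S (lifted_cycle n [i, j]) = - (S (lifted_cycle n [i, Suc j]) * T j)"
      using g(1) i' j by (simp add: T_def S_mult S_zz)
  qed
  also have "\<dots> = - ((\<Sum>i\<in>{1..<j}. S (lifted_cycle n [i, Suc j])) * T j)"
    by (simp add: sum_negf sum_distrib_right)
  also have "(\<Sum>i\<in>{1..<j}. S (lifted_cycle n [i, Suc j])) = M (Suc j) - T j"
    using assms by (simp add: M_def T_def atLeastLessThanSuc)
  finally have TM: "T j * M j = - (M (Suc j) * T j) - eps"
    by (simp add: left_diff_distrib TT)
  show 1: "M (Suc j) * T j = - (T j * M j) - eps" unfolding TM by simp
  have eT: "eps * T j = T j" "T j * eps = T j" using g by (simp_all add: T_def)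
  have "T j * (M (Suc j) * T j) * T j = T j * (- (T j * M j) - eps) * T j" unfolding 1 ..
  then have "(T j * M (Suc j)) * (T j * T j) = - ((T j * T j) * (M j * T j)) - T j * T j"
    by (simp add: right_diff_distrib left_diff_distrib mult.assoc eT)
  then have "- (T j * (M (Suc j) * eps)) = eps * M j * T j + eps"
    unfolding TT by (simp add: mult.assoc)
  then have *: "- (T j * M (Suc j)) = M j * T j + eps" using j by simp
  show "M j * T j = - (T j * M (Suc j)) - eps" unfolding * by simp
qed

lemma T_yy:
  assumes "1 \<le> j" "j < n" "k \<in> {1..n}" "k \<noteq> j" "k \<noteq> Suc j"
  shows "yy k * T j = T j * yy k"
proof -
  have *: "T j * M k = - (M k * T j)" unfolding T_def using assms by (intro S_M_anticommute) auto
  show ?thesis unfolding yy_def by (rule anticommute_sq[OF *, symmetric])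
qed

lemma T_yy_pair:
  assumes "1 \<le> j" "j < n"
  shows "(yy j + yy (Suc j)) * T j = T j * (yy j + yy (Suc j))"
    "(yy j * yy (Suc j)) * T j = T j * (yy j * yy (Suc j))"
proof -
  have j: "j \<in> {1..n}" "Suc j \<in> {1..n}" using assms by auto
  note * = two_symmetric_commute[OF T_M_step[OF assms] eps_M[OF j(1)] eps_M[OF j(2)]
      M_yy_commute[OF j(2,1), unfolded yy_def] yy_commute[OF j(2,1), unfolded yy_def]]
  show "(yy j + yy (Suc j)) * T j = T j * (yy j + yy (Suc j))"
    "(yy j * yy (Suc j)) * T j = T j * (yy j * yy (Suc j))"
    unfolding yy_def by (rule *)+
qed

definition yprod :: "(nat \<Rightarrow> nat) \<Rightarrow> nat list \<Rightarrow> (cover, 'r) endo" where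
  "yprod a ks = prod_list (map (\<lambda>k. yy k ^ a k) ks)"

text \<open>The factor \<open>eps\<close> makes the monomial with all exponents zero the unit of the
  represented algebra.\<close>

definition ymono :: "(nat \<Rightarrow> nat) \<Rightarrow> (cover, 'r) endo" where
  "ymono a = yprod a (upto1 n) * eps"

definition ind :: "nat set \<Rightarrow> nat \<Rightarrow> nat" where
  "ind I k = (if k \<in> I then 1 else 0)"

text \<open>The elementary symmetric function in the first \<open>k\<close> variables, without
  \<open>eps\<close>, so that recursion on \<open>k\<close> and commutation with \<open>T j\<close>
  can be stated for partial sums.\<close>

definition esum :: "nat \<Rightarrow> nat \<Rightarrow> (cover, 'r) endo" where
  "esum k r = (\<Sum>I\<in>{I. I \<subseteq> {1..k} \<and> card I = r}. yprod (ind I) (upto1 k))"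

definition es :: "nat \<Rightarrow> (cover, 'r) endo" where
  "es r = (\<Sum>I\<in>{I. I \<subseteq> {1..n} \<and> card I = r}. ymono (ind I))"

lemma es_esum: "es r = esum n r * eps"
  by (simp add: es_def esum_def ymono_def sum_distrib_right)

lemma yprod_Nil [simp]: "yprod a [] = 1"
  and yprod_Cons: "yprod a (k # ks) = yy k ^ a k * yprod a ks"
  and yprod_append: "yprod a (ks @ ls) = yprod a ks * yprod a ls"
  by (simp_all add: yprod_def)

lemma yprod_cong: "(\<And>k. k \<in> set ks \<Longrightarrow> a k = b k) \<Longrightarrow> yprod a ks = yprod b ks"
  unfolding yprod_def by (metis (mono_tags, lifting) map_eq_conv)

lemma subsets_Suc:
  "{I. I \<subseteq> {1..Suc k} \<and> card I = r} = {I. I \<subseteq> {1..k} \<and> card I = r} \<union>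
    (if r = 0 then {} else insert (Suc k) ` {I. I \<subseteq> {1..k} \<and> card I = r - 1})" (is "?L = ?R")
proof
  show "?L \<subseteq> ?R"
  proof
    fix I assume I: "I \<in> ?L"
    then have fin: "finite I" using finite_subset by blast
    show "I \<in> ?R"
    proof (cases "Suc k \<in> I")
      case True
      then have "card I \<noteq> 0" using fin by auto
      then have r: "r \<noteq> 0" using I by simp
      have "I - {Suc k} \<subseteq> {1..k}" using I by fastforce
      moreover have "card (I - {Suc k}) = r - 1" using I True by simp
      ultimately have "I - {Suc k} \<in> {I. I \<subseteq> {1..k} \<and> card I = r - 1}" by blast
      moreover have "I = insert (Suc k) (I - {Suc k})" using True by auto
      ultimately have "I \<in> insert (Suc k) ` {I. I \<subseteq> {1..k} \<and> card I = r - 1}" by (rule rev_image_eqI)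
      then show ?thesis using r by simp
    next
      case False
      then have "I \<subseteq> {1..k}" using I by (auto simp: le_Suc_eq)
      then show ?thesis using I by simp
    qed
  qed
  show "?R \<subseteq> ?L"
  proof
    fix I assume I: "I \<in> ?R"
    have "card (insert (Suc k) J) = Suc (card J)" if "J \<subseteq> {1..k}" for J
      using finite_subset[OF that] that by (subst card_insert_disjoint) auto
    then show "I \<in> ?L" using I by (cases r) auto
  qed
qed

lemma esum_Suc: "esum (Suc k) r = esum k r + (if r = 0 then 0 else esum k (r - 1) * yy (Suc k))"
proof -
  let ?A = "\<lambda>r. {I. I \<subseteq> {1..k} \<and> card I = r}"
  have fin: "finite (?A r)" for r by (rule finite_subset[of _ "Pow {1..k}"]) auto
  have e1: "yprod (ind I) (upto1 (Suc k)) = yprod (ind I) (upto1 k)" if "I \<subseteq> {1..k}" for I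
  proof -
    have "Suc k \<notin> I" using that by auto
    then show ?thesis by (simp add: upto1_Suc yprod_append yprod_Cons ind_def)
  qed
  have e2: "yprod (ind (insert (Suc k) I)) (upto1 (Suc k)) = yprod (ind I) (upto1 k) * yy (Suc k)" for I
  proof -
    have "yprod (ind (insert (Suc k) I)) (upto1 k) = yprod (ind I) (upto1 k)"
      by (rule yprod_cong) (auto simp: ind_def)
    then show ?thesis by (simp add: upto1_Suc yprod_append yprod_Cons ind_def[of _ "Suc k"])
  qed
  show ?thesis
  proof (cases "r = 0")
    case True
    then show ?thesis unfolding esum_def subsets_Suc using e1 by simp
  next
    case False
    have "inj_on (insert (Suc k)) (?A (r - 1))"
    proof (rule inj_onI)
      fix I J assume "I \<in> ?A (r - 1)" "J \<in> ?A (r - 1)" "insert (Suc k) I = insert (Suc k) J"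
      moreover have "Suc k \<notin> {1..k}" by simp
      ultimately show "I = J" by (metis (mono_tags, lifting) insert_ident mem_Collect_eq subsetD)
    qed
    then have "(\<Sum>I\<in>insert (Suc k) ` ?A (r - 1). yprod (ind I) (upto1 (Suc k))) =
        (\<Sum>I\<in>?A (r - 1). yprod (ind I) (upto1 k) * yy (Suc k))"
      by (subst sum.reindex) (simp_all add: e2)
    moreover have "?A r \<inter> insert (Suc k) ` ?A (r - 1) = {}" by auto
    ultimately show ?thesis unfolding esum_def subsets_Suc using False fin e1
      by (simp add: sum.union_disjoint sum_distrib_right)
  qed
qed

lemma esum_0: "esum 0 r = (if r = 0 then 1 else 0)"
proof -
  have "{I :: nat set. I \<subseteq> {1..0} \<and> card I = r} = (if r = 0 then {{}} else {})" by auto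
  then show ?thesis by (auto simp: esum_def)
qed

lemma mult_commute_T:
  "x * T j = T j * x \<Longrightarrow> y * T j = T j * y \<Longrightarrow> (x * y) * T j = T j * (x * y)"
  by (simp add: mult.assoc) (simp flip: mult.assoc)

lemma add_commute_T:
  "x * T j = T j * x \<Longrightarrow> y * T j = T j * y \<Longrightarrow> (x + y) * T j = T j * (x + y)"
  by (simp add: distrib_left distrib_right)

lemma if_commute_T:
  "x * T j = T j * x \<Longrightarrow> (if b then 0 else x) * T j = T j * (if b then 0 else x)"
  by simp

text \<open>The value \<open>k = j\<close> is excluded because \<open>yy j\<close> then occurs
  without \<open>yy (Suc j)\<close>. At \<open>k = Suc j\<close> the recursion is unfolded twice, so
  that the two squares enter only through their sum and product.\<close>

lemma esum_T:
  assumes j: "1 \<le> j" "j < n"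
  shows "k \<le> n \<Longrightarrow> k \<noteq> j \<Longrightarrow> esum k r * T j = T j * esum k r"
proof (induction k arbitrary: r rule: less_induct)
  case (less k)
  consider "k = 0" | "k = Suc j" | k' where "k = Suc k'" "k' \<noteq> j" by (cases k) auto
  then show ?case
  proof cases
    case 1
    then show ?thesis by (simp add: esum_0)
  next
    case 2
    obtain i where i: "j = Suc i" using j by (cases j) auto
    have IH: "esum i r * T j = T j * esum i r" for r using less 2 i by simp
    have eq: "esum k r = esum i r + (if r = 0 then 0 else esum i (r - 1) * (yy j + yy (Suc j))) +
        (if r < 2 then 0 else esum i (r - 2) * (yy j * yy (Suc j)))"
      using esum_Suc[of j] esum_Suc[of i] by (auto simp: 2 i distrib_left distrib_right mult.assoc less_2_cases_iff numeral_2_eq_2)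
    have a: "(esum i (r - 1) * (yy j + yy (Suc j))) * T j = T j * (esum i (r - 1) * (yy j + yy (Suc j)))"
      and b: "(esum i (r - 2) * (yy j * yy (Suc j))) * T j = T j * (esum i (r - 2) * (yy j * yy (Suc j)))"
      by (rule mult_commute_T[OF IH T_yy_pair(1)[OF j]], rule mult_commute_T[OF IH T_yy_pair(2)[OF j]])
    show ?thesis unfolding eq by (rule add_commute_T[OF add_commute_T[OF IH if_commute_T[OF a]] if_commute_T[OF b]])
  next
    case 3
    have IH: "esum k' r * T j = T j * esum k' r" for r using less 3 by simp
    have "yy k * T j = T j * yy k" using less 3 by (intro T_yy[OF j]) auto
    then have a: "(esum k' (r - 1) * yy k) * T j = T j * (esum k' (r - 1) * yy k)"
      using IH by (intro mult_commute_T)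
    have eq: "esum k r = esum k' r + (if r = 0 then 0 else esum k' (r - 1) * yy k)"
      using esum_Suc[of k'] 3 by simp
    show ?thesis unfolding eq by (rule add_commute_T[OF IH if_commute_T[OF a]])
  qed
qed

lemma yy_graded: "k \<in> {1..n} \<Longrightarrow> yy k \<in> graded False"
  unfolding yy_def using graded_mult[OF M_graded M_graded] by simp

lemma yy_filt: "k \<in> {1..n} \<Longrightarrow> yy k \<in> filt 2"
  unfolding yy_def using filt_mult[OF M_filt M_filt] by (simp add: numeral_2_eq_2)

lemma yprod_graded: "set ks \<subseteq> {1..n} \<Longrightarrow> yprod a ks * eps \<in> graded False"
proof (induction ks)
  case Nil
  then show ?case using graded_S[of "\<one>\<^bsub>cover_group n\<^esub>"] by simp
next
  case (Cons k ks)
  have "yy k ^ m * (yprod a ks * eps) \<in> graded False" for m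
  proof (induction m)
    case (Suc m)
    then show ?case using graded_mult[OF yy_graded Suc] Cons.prems by (simp add: mult.assoc)
  qed (use Cons in simp)
  then show ?case by (simp add: yprod_Cons mult.assoc)
qed

lemma yprod_filt: "set ks \<subseteq> {1..n} \<Longrightarrow> yprod a ks * eps \<in> filt (2 * (\<Sum>k\<leftarrow>ks. a k))"
proof (induction ks)
  case Nil
  then show ?case using filt_S[of "[]" 0] by simp
next
  case (Cons k ks)
  have "yy k ^ m * (yprod a ks * eps) \<in> filt (2 * m + 2 * (\<Sum>k\<leftarrow>ks. a k))" for m
  proof (induction m)
    case (Suc m)
    then show ?case using filt_mult[OF Suc yy_filt] Cons.prems by (simp add: mult.assoc)
  qed (use Cons in simp)
  then show ?case by (simp add: yprod_Cons mult.assoc distrib_left)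
qed

lemma mono_filt: "ymono a \<in> filt (2 * (\<Sum>k\<in>{1..n}. a k))"
  using yprod_filt[of "upto1 n" a] by (simp add: ymono_def sum_list_upto1)

lemma mono_graded: "ymono a \<in> graded False"
  unfolding ymono_def by (intro yprod_graded) simp

lemma es_filt: "es r \<in> filt (2 * r)"
  unfolding es_def
proof (rule filt_sum)
  fix I assume I: "I \<in> {I. I \<subseteq> {1..n} \<and> card I = r}"
  have "(\<Sum>k\<in>{1..n}. ind I k) = card ({1..n} \<inter> I)" by (simp add: ind_def sum.If_cases)
  also have "{1..n} \<inter> I = I" using I by auto
  finally show "ymono (ind I) \<in> filt (2 * r)" using mono_filt[of "ind I"] I by simp
qed

text \<open>The generator \<open>tt n j\<close> and the lifted \<open>[j, j + 1]\<close> lie over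
  the same permutation, so they agree up to \<open>z\<close>. The operators \<open>T j\<close>
  therefore detect commutation with the whole group.\<close>

lemma S_commute_of_T:
  assumes X: "\<And>j. 1 \<le> j \<Longrightarrow> j < n \<Longrightarrow> X * T j = T j * X" and e: "X * eps = X" "eps * X = X" and g: "g \<in> G"
  shows "S g * X = X * S g"
  using g
proof (induction rule: cover_induct)
  case one
  show ?case using e by simp
next
  case (zz A)
  then show ?case using S_zz[of A] by (simp add: zz_central[symmetric])
next
  case (tt A j)
  let ?g = "lifted_cycle n [j, Suc j]"
  have j: "j \<in> {1..n}" "Suc j \<in> {1..n}" "j \<noteq> Suc j" using tt by auto
  have "tt n j = ?g \<or> tt n j = zz n \<cdot>\<^bsub>n\<^esub> ?g"
    using j tt by (intro cperm_eq) (simp_all add: cperm_lifted_pair)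
  then have "S (tt n j) = T j \<or> S (tt n j) = - T j" using j S_zz[of ?g] by (auto simp: T_def)
  then have "S (tt n j) * X = X * S (tt n j)" using X[OF tt(2,3)] by auto
  then have "S A * (S (tt n j) * X) = S A * X * S (tt n j)" by (simp add: mult.assoc)
  then show ?case using tt by (simp add: S_mult[symmetric] mult.assoc)
qed

lemma eps_yprod: "set ks \<subseteq> {1..n} \<Longrightarrow> eps * yprod a ks = yprod a ks * eps"
proof (induction ks)
  case (Cons k ks)
  have "eps * yy k = yy k * eps" using Cons.prems by (simp add: yy_def mult.assoc) (simp flip: mult.assoc)
  then have "yy k ^ m * eps = eps * yy k ^ m" for m by (rule power_commuting_commutes[OF HOL.sym])
  then show ?case unfolding yprod_Cons using Cons by (intro commute_mult) auto
qed simp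

lemma eps_mono: "eps * ymono a = ymono a" "ymono a * eps = ymono a"
  by (simp_all add: ymono_def eps_yprod S_mult flip: mult.assoc) (simp_all add: mult.assoc S_mult)

lemma es_Z: "es r \<in> Z"
proof -
  have e: "es r * eps = es r" "eps * es r = es r"
    unfolding es_def sum_distrib_left sum_distrib_right by (simp_all add: eps_mono)
  have "es r * T j = T j * es r" if j: "1 \<le> j" "j < n" for j
  proof -
    have "lifted_cycle n [j, Suc j] \<in> G" using j by simp
    then have "eps * T j = T j * eps" by (simp add: T_def)
    then show ?thesis unfolding es_esum using esum_T[OF j, of n r] j by (intro mult_commute_T) auto
  qed
  then have "S g * es r = es r * S g" if "g \<in> G" for g using that e by (intro S_commute_of_T)
  moreover have "es r \<in> graded False" unfolding es_def by (intro graded_sum mono_graded)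
  ultimately show ?thesis by (simp add: Z_def)
qed

lemma yprod_mult:
  "set ks \<subseteq> {1..n} \<Longrightarrow> yprod a ks * yprod b ks = yprod (\<lambda>k. a k + b k) ks"
proof (induction ks)
  case (Cons k ks)
  have k: "k \<in> {1..n}" and ks: "set ks \<subseteq> {1..n}" using Cons.prems by auto
  have "yprod a ls * yy k ^ m = yy k ^ m * yprod a ls" if "set ls \<subseteq> {1..n}" for ls m
    using that
  proof (induction ls)
    case (Cons l ls)
    have "yy k ^ m * yy l = yy l * yy k ^ m"
      using yy_commute[OF k, of l] Cons.prems by (intro power_commuting_commutes) auto
    then have "yy l ^ a l * yy k ^ m = yy k ^ m * yy l ^ a l"
      by (intro power_commuting_commutes) (rule HOL.sym)
    then show ?case unfolding yprod_Cons using Cons by (intro commute_mult[symmetric]) auto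
  qed simp
  from commute_exchange[OF this[OF ks, of "b k"]] show ?case using Cons.IH[OF ks]
    by (simp add: yprod_Cons power_add)
qed simp

lemma mono_mult: "ymono a * ymono b = ymono (\<lambda>k. a k + b k)"
proof -
  have "ymono a * ymono b = yprod a (upto1 n) * (eps * yprod b (upto1 n)) * eps"
    by (simp add: ymono_def mult.assoc)
  also have "\<dots> = yprod a (upto1 n) * yprod b (upto1 n) * (eps * eps)"
    by (simp add: eps_yprod mult.assoc)
  finally show ?thesis by (simp add: yprod_mult ymono_def)
qed


subsection \<open>Expansion of the monomials\<close>

definition block_ok :: "nat \<Rightarrow> nat \<Rightarrow> nat list \<Rightarrow> bool" where
  "block_ok m k is \<longleftrightarrow> length is = 2 * m \<and> set is \<subseteq> {1..<k}"

definition Blocks :: "(nat \<Rightarrow> nat) \<Rightarrow> nat list \<Rightarrow> (nat \<Rightarrow> nat list) set" where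
  "Blocks a ks = {b. (\<forall>k\<in>set ks. block_ok (a k) k (b k)) \<and> (\<forall>k. k \<notin> set ks \<longrightarrow> b k = [])}"

lemma Blocks_blocks: "b \<in> Blocks a ks \<Longrightarrow> set ks \<subseteq> {1..n} \<Longrightarrow> blocks n b"
proof -
  assume *: "b \<in> Blocks a ks" "set ks \<subseteq> {1..n}"
  have "set (b k) \<subseteq> {1..<k} \<and> (k \<notin> {1..n} \<longrightarrow> b k = [])" for k
    using * by (cases "k \<in> set ks") (auto simp: Blocks_def block_ok_def)
  then show ?thesis by (simp add: blocks_def)
qed

text \<open>The trailing \<open>S g\<close> keeps the zeroth power in the span of the
  \<open>S\<close>, where \<open>1\<close> need not lie.\<close>

lemma M_power_expand:
  assumes k: "k \<in> {1..n}" and g: "g \<in> G"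
  shows "M k ^ m * S g = (\<Sum>is\<in>{is. length is = m \<and> set is \<subseteq> {1..<k}}. S (star_prod n k is \<cdot>\<^bsub>n\<^esub> g))"
proof (induction m)
  case 0
  have "{is. length is = 0 \<and> set is \<subseteq> {1..<k}} = {[]}" by auto
  then show ?case using g by simp
next
  case (Suc m)
  let ?L = "\<lambda>m. {is. length is = m \<and> set is \<subseteq> {1..<k}}"
  have "M k ^ Suc m * S g = M k * (\<Sum>is\<in>?L m. S (star_prod n k is \<cdot>\<^bsub>n\<^esub> g))"
    unfolding Suc.IH[symmetric] by (simp add: mult.assoc)
  also have "\<dots> = (\<Sum>i\<in>{1..<k}. \<Sum>is\<in>?L m. S (lifted_cycle n [i, k]) * S (star_prod n k is \<cdot>\<^bsub>n\<^esub> g))"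
    unfolding M_def by (rule sum_product)
  also have "\<dots> = (\<Sum>(i, is)\<in>{1..<k} \<times> ?L m. S (lifted_cycle n [i, k]) * S (star_prod n k is \<cdot>\<^bsub>n\<^esub> g))"
    by (rule sum.cartesian_product)
  also have "\<dots> = (\<Sum>(i, is)\<in>{1..<k} \<times> ?L m. S (star_prod n k (i # is) \<cdot>\<^bsub>n\<^esub> g))"
  proof (intro sum.cong HOL.refl, clarify)
    fix i "is" assume *: "i \<in> {1..<k}" "set is \<subseteq> {1..<k}"
    then have "lifted_cycle n [i, k] \<in> G" "star_prod n k is \<in> G" using k by (auto intro!: star_prod_closed)
    then show "S (lifted_cycle n [i, k]) * S (star_prod n k is \<cdot>\<^bsub>n\<^esub> g) = S (star_prod n k (i # is) \<cdot>\<^bsub>n\<^esub> g)"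
      using g by (simp add: S_mult star_prod_Cons cov.m_assoc)
  qed
  also have "\<dots> = (\<Sum>p\<in>{1..<k} \<times> ?L m. S (star_prod n k ((\<lambda>(i, is). i # is) p) \<cdot>\<^bsub>n\<^esub> g))"
    by (simp add: case_prod_unfold)
  also have "\<dots> = (\<Sum>is\<in>?L (Suc m). S (star_prod n k is \<cdot>\<^bsub>n\<^esub> g))"
  proof (rule sum.reindex_bij_betw)
    show "bij_betw (\<lambda>(i, is). i # is) ({1..<k} \<times> ?L m) (?L (Suc m))"
      by (rule bij_betw_byWitness[where f' = "\<lambda>is. (hd is, tl is)"]) (auto simp: length_Suc_conv)
  qed
  finally show ?case .
qed

lemma block_prod_cong: "(\<And>k. k \<in> set ks \<Longrightarrow> b k = b' k) \<Longrightarrow> block_prod n b ks = block_prod n b' ks"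
  by (induction ks) (auto simp: block_prod_Cons)

lemma yprod_expand:
  "distinct ks \<Longrightarrow> set ks \<subseteq> {1..n} \<Longrightarrow> yprod a ks * eps = (\<Sum>b\<in>Blocks a ks. S (block_prod n b ks))"
proof (induction ks)
  case Nil
  have "Blocks a [] = {\<lambda>_. []}" by (auto simp: Blocks_def)
  then show ?case by simp
next
  case (Cons k ks)
  let ?L = "{is. block_ok (a k) k is}"
  have k: "k \<in> {1..n}" "k \<notin> set ks" and ks: "set ks \<subseteq> {1..n}" using Cons.prems by auto
  have yM: "yy k ^ a k = M k ^ (2 * a k)" by (simp add: yy_def power_mult power2_eq_square)
  have "yprod a (k # ks) * eps = yy k ^ a k * (\<Sum>b\<in>Blocks a ks. S (block_prod n b ks))"
    using Cons by (simp add: yprod_Cons mult.assoc)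
  also have "\<dots> = (\<Sum>b\<in>Blocks a ks. \<Sum>is\<in>?L. S (star_prod n k is \<cdot>\<^bsub>n\<^esub> block_prod n b ks))"
    unfolding sum_distrib_left yM block_ok_def using Blocks_blocks[OF _ ks] ks
    by (intro sum.cong[OF HOL.refl] M_power_expand[OF k(1)]) simp
  also have "\<dots> = (\<Sum>(b, is)\<in>Blocks a ks \<times> ?L. S (star_prod n k is \<cdot>\<^bsub>n\<^esub> block_prod n b ks))"
    by (rule sum.cartesian_product)
  also have "\<dots> = (\<Sum>p\<in>Blocks a ks \<times> ?L. S (block_prod n ((\<lambda>(b, is). b(k := is)) p) (k # ks)))"
  proof (intro sum.cong HOL.refl, clarify)
    fix b "is"
    have "block_prod n (b(k := is)) ks = block_prod n b ks" using k(2) by (intro block_prod_cong) auto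
    then show "S (star_prod n k is \<cdot>\<^bsub>n\<^esub> block_prod n b ks) = S (block_prod n (b(k := is)) (k # ks))"
      by (simp add: block_prod_Cons)
  qed
  also have "\<dots> = (\<Sum>b\<in>Blocks a (k # ks). S (block_prod n b (k # ks)))"
  proof (rule sum.reindex_bij_betw)
    show "bij_betw (\<lambda>(b, is). b(k := is)) (Blocks a ks \<times> ?L) (Blocks a (k # ks))"
    proof (rule bij_betw_byWitness[where f' = "\<lambda>b. (b(k := []), b k)"])
      show "\<forall>p\<in>Blocks a ks \<times> ?L. (\<lambda>b. (b(k := []), b k)) ((\<lambda>(b, is). b(k := is)) p) = p"
        using k(2) by (auto simp: Blocks_def)
    qed (use k(2) in \<open>auto simp: Blocks_def split: if_splits\<close>)
  qed
  finally show ?case .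
qed

lemma mono_expand: "ymono a = (\<Sum>b\<in>Blocks a (upto1 n). S (block_prod n b (upto1 n)))"
  unfolding ymono_def by (rule yprod_expand) simp_all

end


subsection \<open>Multisets of exponents\<close>

text \<open>The exponent vectors of one symmetric group orbit. Zero exponents are recorded, so
  \<open>\<mu>\<close> is a partition padded by zeros to \<open>n\<close> entries and
  \<open>nz\<close> counts its parts.\<close>

definition Ty :: "nat \<Rightarrow> nat multiset \<Rightarrow> (nat \<Rightarrow> nat) set" where
  "Ty n \<mu> = {a. (\<forall>k. k \<notin> {1..n} \<longrightarrow> a k = 0) \<and> image_mset a (mset_set {1..n}) = \<mu>}"

definition nz :: "nat multiset \<Rightarrow> nat" where
  "nz \<mu> = size (filter_mset (\<lambda>x. 0 < x) \<mu>)"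

lemma finite_Ty: "finite (Ty n \<mu>)"
proof (rule finite_subset)
  show "Ty n \<mu> \<subseteq> {a. \<forall>k. (k \<in> {1..n} \<longrightarrow> a k \<in> set_mset \<mu>) \<and> (k \<notin> {1..n} \<longrightarrow> a k = 0)}"
    by (auto simp: Ty_def)
qed (rule finite_set_of_finite_funs, auto)

lemma Ty_size: "a \<in> Ty n \<mu> \<Longrightarrow> size \<mu> = n"
  by (auto simp: Ty_def)

lemma Ty_sum: "a \<in> Ty n \<mu> \<Longrightarrow> (\<Sum>k\<in>{1..n}. a k) = sum_mset \<mu>"
  by (auto simp: Ty_def sum_unfold_sum_mset)

lemma Ty_filter:
  assumes "a \<in> Ty n \<mu>"
  shows "filter_mset (\<lambda>x. 0 < x) \<mu> = image_mset a (mset_set {k \<in> {1..n}. 0 < a k})"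
proof -
  have "filter_mset (\<lambda>x. 0 < x) (image_mset a (mset_set {1..n})) = image_mset a (filter_mset (\<lambda>k. 0 < a k) (mset_set {1..n}))"
    by (simp add: filter_mset_image_mset)
  then show ?thesis using assms by (simp add: Ty_def filter_mset_mset_set)
qed

lemma Ty_nz: "a \<in> Ty n \<mu> \<Longrightarrow> card {k \<in> {1..n}. 0 < a k} = nz \<mu>"
  by (simp add: nz_def Ty_filter)

lemma nz_le: "nz \<mu> \<le> size \<mu>"
  unfolding nz_def by (rule size_filter_mset_lesseq)

lemma mset_split_zero: "\<mu> = filter_mset (\<lambda>x. 0 < x) \<mu> + replicate_mset (size \<mu> - nz \<mu>) (0 :: nat)"
  unfolding nz_def
proof (induction \<mu>)
  case (add x \<mu>)
  have "size (filter_mset (\<lambda>x. 0 < x) \<mu>) \<le> size \<mu>" by (rule size_filter_mset_lesseq)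
  then show ?case using add by (cases "x = 0") (simp_all add: Suc_diff_le)
qed simp

lemma sum_mset_pred: "sum_mset \<mu> = sum_mset (image_mset (\<lambda>x. x - 1) \<mu>) + nz (\<mu> :: nat multiset)"
  unfolding nz_def by (induction \<mu>) auto

lemma nz_zero: "nz \<mu> = 0 \<Longrightarrow> sum_mset \<mu> = 0"
proof -
  assume "nz \<mu> = 0"
  then have "filter_mset (\<lambda>x. 0 < x) \<mu> = {#}" by (simp add: nz_def)
  then have "sum_mset \<mu> = sum_mset (replicate_mset (size \<mu> - nz \<mu>) 0)" using mset_split_zero[of \<mu>] by simp
  then show ?thesis by simp
qed

lemma Ty_permute:
  assumes "a \<in> Ty n \<mu>" "p permutes {1..n}" shows "a \<circ> p \<in> Ty n \<mu>"
proof -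
  have "image_mset (a \<circ> p) (mset_set {1..n}) = image_mset a (mset_set (p ` {1..n}))"
    using permutes_inj_on[OF assms(2)] by (simp add: multiset.map_comp flip: image_mset_mset_set)
  then show ?thesis using assms permutes_image[OF assms(2)] permutes_not_in[OF assms(2)] by (simp add: Ty_def)
qed

lemma Ty_related:
  assumes "a \<in> Ty n \<mu>" "b \<in> Ty n \<mu>" shows "\<exists>p. p permutes {1..n} \<and> a = b \<circ> p"
proof -
  have eq: "image_mset a (mset_set {1..n}) = image_mset b (mset_set {1..n})" using assms by (simp add: Ty_def)
  obtain p where p: "p permutes {1..n}" "\<forall>x\<in>{1..n}. a x = b (p x)"
    using image_mset_eq_implies_permutes[OF finite_atLeastAtMost eq] by blast
  have "a x = (b \<circ> p) x" for x
    using p assms permutes_not_in[OF p(1)] by (cases "x \<in> {1..n}") (auto simp: Ty_def)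
  then show ?thesis using p(1) by blast
qed

lemma sum_const_card: "finite A \<Longrightarrow> (\<Sum>x\<in>A. c) = (\<Sum>j<card A. c :: 'a::comm_monoid_add)"
  by (induction A rule: finite_induct) (simp_all add: add.commute)

text \<open>The index set of the terms of \<open>es l * mm \<rho>\<close>; \<open>shifted\<close>
  adds the two exponent vectors of a term.\<close>

definition Q :: "nat \<Rightarrow> nat \<Rightarrow> nat multiset \<Rightarrow> (nat set \<times> (nat \<Rightarrow> nat)) set" where
  "Q n l \<rho> = {I. I \<subseteq> {1..n} \<and> card I = l} \<times> Ty n \<rho>"

definition shifted :: "nat set \<times> (nat \<Rightarrow> nat) \<Rightarrow> nat \<Rightarrow> nat" where
  "shifted = (\<lambda>(I, a) k. (if k \<in> I then 1 else 0) + a k)"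

lemma finite_Q: "finite (Q n l \<rho>)"
proof -
  have "finite {I. I \<subseteq> {1..n} \<and> card I = l}" by (rule finite_subset[of _ "Pow {1..n}"]) auto
  then show ?thesis by (simp add: Q_def finite_Ty)
qed

lemma shifted_Ty: "q \<in> Q n l \<rho> \<Longrightarrow> shifted q \<in> Ty n (image_mset (shifted q) (mset_set {1..n}))"
  by (auto simp: Q_def shifted_def Ty_def)

text \<open>A permutation that carries \<open>b\<close> to \<open>b'\<close> carries the pairs
  along, so the multiplicity of a monomial in the product depends only on its type.\<close>

lemma card_shifted_fibre:
  assumes "b \<in> Ty n \<nu>" "b' \<in> Ty n \<nu>"
  shows "card {q \<in> Q n l \<rho>. shifted q = b} = card {q \<in> Q n l \<rho>. shifted q = b'}"
proof -
  have le: "card {q \<in> Q n l \<rho>. shifted q = b} \<le> card {q \<in> Q n l \<rho>. shifted q = b'}"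
    if bb: "b \<in> Ty n \<nu>" "b' \<in> Ty n \<nu>" for b b'
  proof -
    obtain p where p: "p permutes {1..n}" "b' = b \<circ> p" using Ty_related[OF bb(2,1)] by blast
    let ?f = "\<lambda>(I, a). (p -` I, a \<circ> p)"
    have surj: "surj p" using p(1) by (rule permutes_surj)
    have inj: "inj_on ?f {q \<in> Q n l \<rho>. shifted q = b}"
    proof (rule inj_onI, clarify)
      fix I a J c assume "p -` I = p -` J" "a \<circ> p = c \<circ> p"
      then show "I = J \<and> a = c" using surj by (metis surj_image_vimage_eq surj_fun_eq)
    qed
    have "?f ` {q \<in> Q n l \<rho>. shifted q = b} \<subseteq> {q \<in> Q n l \<rho>. shifted q = b'}"
    proof clarify
      fix I a assume q: "(I, a) \<in> Q n l \<rho>" "b = shifted (I, a)"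
      have I: "I \<subseteq> {1..n}" "card I = l" and a: "a \<in> Ty n \<rho>" using q(1) by (auto simp: Q_def)
      have "p -` I \<subseteq> {1..n}" using I(1) permutes_in_image[OF p(1)] by auto
      moreover have "card (p -` I) = l" using I(2) permutes_inj[OF p(1)] surj by (simp add: card_vimage_inj)
      ultimately have "(p -` I, a \<circ> p) \<in> Q n l \<rho>" using Ty_permute[OF a p(1)] by (simp add: Q_def)
      moreover have "shifted (p -` I, a \<circ> p) = b'" by (auto simp: p(2) q(2) shifted_def fun_eq_iff)
      ultimately show "(p -` I, a \<circ> p) \<in> Q n l \<rho> \<and> shifted (p -` I, a \<circ> p) = b'" by blast
    qed
    then show ?thesis using card_inj_on_le[OF inj] finite_Q by simp
  qed
  show ?thesis using le[OF assms] le[OF assms(2,1)] by simp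
qed

text \<open>The set in \<open>q\<close> raises as many exponents as \<open>\<mu>\<close> has nonzero
  entries, and it lies in the new support. If the support is no larger, the two are equal; every
  exponent in it is then a raised one, and raising undoes the subtraction of 1.\<close>

lemma shifted_type:
  assumes \<mu>: "size \<mu> = n" and q: "q \<in> Q n (nz \<mu>) (image_mset (\<lambda>x. x - 1) \<mu>)" and \<nu>: "shifted q \<in> Ty n \<nu>"
  shows "sum_mset \<nu> = sum_mset \<mu>" "nz \<mu> \<le> nz \<nu>" "nz \<nu> = nz \<mu> \<Longrightarrow> \<nu> = \<mu>"
proof -
  let ?\<rho> = "image_mset (\<lambda>x. x - 1) \<mu>"
  obtain I a where I: "q = (I, a)" "I \<subseteq> {1..n}" "card I = nz \<mu>" "a \<in> Ty n ?\<rho>" using q by (auto simp: Q_def)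
  have sh: "shifted q = (\<lambda>k. (if k \<in> I then 1 else 0) + a k)" by (simp add: I shifted_def)
  have "(\<Sum>k\<in>{1..n}. shifted q k) = card ({1..n} \<inter> I) + (\<Sum>k\<in>{1..n}. a k)"
    by (simp add: sh sum.distrib sum.If_cases)
  also have "{1..n} \<inter> I = I" using I(2) by auto
  finally show "sum_mset \<nu> = sum_mset \<mu>" using I(3) Ty_sum[OF I(4)] Ty_sum[OF \<nu>] sum_mset_pred[of \<mu>] by simp
  have sub: "I \<subseteq> {k \<in> {1..n}. 0 < shifted q k}" using I(2) by (auto simp: sh)
  then have "card I \<le> card {k \<in> {1..n}. 0 < shifted q k}" by (intro card_mono) auto
  then show "nz \<mu> \<le> nz \<nu>" using Ty_nz[OF \<nu>] I(3) by simp
  assume eq: "nz \<nu> = nz \<mu>"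
  have Isupp: "I = {k \<in> {1..n}. 0 < shifted q k}"
    by (rule card_subset_eq[OF _ sub]) (use Ty_nz[OF \<nu>] I(3) eq in simp_all)
  have a0: "a k = 0" if "k \<in> {1..n}" "k \<notin> I" for k
  proof -
    have "k \<in> I" if "0 < shifted q k" using that \<open>k \<in> {1..n}\<close> by (subst Isupp) simp
    then have "\<not> 0 < shifted q k" using \<open>k \<notin> I\<close> by blast
    then show ?thesis by (simp add: sh)
  qed
  have fin: "finite I" using I(2) finite_subset by blast
  have "mset_set {1..n} = mset_set I + mset_set ({1..n} - I)"
    using I(2) fin by (subst mset_set_Union[symmetric]) (auto simp: Un_absorb1)
  moreover have "image_mset a (mset_set ({1..n} - I)) = replicate_mset (n - nz \<mu>) 0"
  proof -
    have "image_mset a (mset_set ({1..n} - I)) = image_mset (\<lambda>_. 0) (mset_set ({1..n} - I))"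
      by (rule image_mset_cong) (use a0 in auto)
    then show ?thesis using I(2,3) fin by (simp add: image_mset_const_eq card_Diff_subset)
  qed
  ultimately have "?\<rho> = image_mset a (mset_set I) + replicate_mset (n - nz \<mu>) 0"
    using I(4) by (simp add: Ty_def)
  moreover have "?\<rho> = image_mset (\<lambda>x. x - 1) (filter_mset (\<lambda>x. 0 < x) \<mu>) + replicate_mset (n - nz \<mu>) 0"
    by (subst mset_split_zero[of \<mu>]) (simp add: \<mu>)
  ultimately have "image_mset a (mset_set I) = image_mset (\<lambda>x. x - 1) (filter_mset (\<lambda>x. 0 < x) \<mu>)" by simp
  then have "image_mset Suc (image_mset a (mset_set I)) =
      image_mset Suc (image_mset (\<lambda>x. x - 1) (filter_mset (\<lambda>x. 0 < x) \<mu>))" by simp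
  also have "\<dots> = image_mset (\<lambda>x. x) (filter_mset (\<lambda>x. 0 < x) \<mu>)"
    unfolding multiset.map_comp by (rule image_mset_cong) auto
  finally have 1: "image_mset Suc (image_mset a (mset_set I)) = filter_mset (\<lambda>x. 0 < x) \<mu>" by simp
  have "filter_mset (\<lambda>x. 0 < x) \<nu> = image_mset (shifted q) (mset_set I)"
    using Ty_filter[OF \<nu>] Isupp by simp
  also have "\<dots> = image_mset Suc (image_mset a (mset_set I))"
    unfolding multiset.map_comp by (rule image_mset_cong) (use fin in \<open>auto simp: sh\<close>)
  finally have "filter_mset (\<lambda>x. 0 < x) \<nu> = filter_mset (\<lambda>x. 0 < x) \<mu>" using 1 by simp
  then show "\<nu> = \<mu>" using mset_split_zero[of \<mu>] mset_split_zero[of \<nu>] Ty_size[OF \<nu>] \<mu> eq by metis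
qed

text \<open>The set of a pair in the fibre lies in the support of \<open>b\<close> and has the same
  size, so it is the support, and the other exponents are those of \<open>b\<close> lowered by
  one.\<close>

lemma shifted_fibre_self:
  assumes b: "b \<in> Ty n \<mu>"
  shows "card {q \<in> Q n (nz \<mu>) (image_mset (\<lambda>x. x - 1) \<mu>). shifted q = b} = 1"
proof -
  let ?I = "{k \<in> {1..n}. 0 < b k}" and ?a = "\<lambda>k. b k - 1"
  have "?a \<in> Ty n (image_mset (\<lambda>x. x - 1) \<mu>)"
    using b by (auto simp: Ty_def multiset.map_comp comp_def)
  then have 1: "(?I, ?a) \<in> Q n (nz \<mu>) (image_mset (\<lambda>x. x - 1) \<mu>)" using Ty_nz[OF b] by (auto simp: Q_def)
  have b0: "b k = 0" if "k \<notin> {1..n}" for k using b that unfolding Ty_def by blast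
  have 2: "shifted (?I, ?a) = b"
  proof
    fix k show "shifted (?I, ?a) k = b k" using b0[of k] by (cases "k \<in> {1..n}") (auto simp: shifted_def)
  qed
  have "q = (?I, ?a)" if q: "q \<in> Q n (nz \<mu>) (image_mset (\<lambda>x. x - 1) \<mu>)" "shifted q = b" for q
  proof -
    obtain J c where J: "q = (J, c)" "J \<subseteq> {1..n}" "card J = nz \<mu>" using q(1) by (auto simp: Q_def)
    have bJ: "b k = (if k \<in> J then 1 else 0) + c k" for k using q(2) J(1) by (auto simp: shifted_def)
    then have sub: "J \<subseteq> ?I" using J(2) by auto
    have JI: "J = ?I"
      by (rule card_subset_eq[OF _ sub]) (use Ty_nz[OF b] J(3) in simp_all)
    moreover have "c k = b k - 1" for k using bJ[of k] JI b0[of k] by (cases "k \<in> {1..n}") (auto split: if_splits)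
    ultimately show ?thesis using J(1) by auto
  qed
  then have "{q \<in> Q n (nz \<mu>) (image_mset (\<lambda>x. x - 1) \<mu>). shifted q = b} = {(?I, ?a)}" using 1 2 by blast
  then show ?thesis by simp
qed

text \<open>The exponents \<open>l / 2\<close> padded by zeros: the type of the monomial symmetric
  function whose leading term is \<open>d_l\<close> up to sign.\<close>

definition half_type :: "nat \<Rightarrow> nat list \<Rightarrow> nat multiset" where
  "half_type n l = image_mset (\<lambda>x. x div 2) (mset l) + replicate_mset (n - length l) 0"

lemma half_type:
  assumes "l \<in> even_partitions n"
  shows "size (half_type n l) = n" "nz (half_type n l) = length l" "2 * sum_mset (half_type n l) = sum_list l"
    "filter_mset (\<lambda>x. 0 < x) (half_type n l) = image_mset (\<lambda>x. x div 2) (mset l)"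
proof -
  have pos: "\<forall>x\<in>set l. 0 < x \<and> even x" and len: "length l \<le> n" using assms by (auto simp: even_partitions_def)
  show "size (half_type n l) = n" using len by (simp add: half_type_def)
  have "filter_mset (\<lambda>x. 0 < x) (image_mset (\<lambda>x. x div 2) (mset l)) = image_mset (\<lambda>x. x div 2) (mset l)"
    unfolding filter_mset_eq_conv using pos by (auto elim!: evenE)
  then show f: "filter_mset (\<lambda>x. 0 < x) (half_type n l) = image_mset (\<lambda>x. x div 2) (mset l)"
    by (simp add: half_type_def)
  then show "nz (half_type n l) = length l" by (simp add: nz_def)
  have "2 * sum_mset (image_mset (\<lambda>x. x div 2) (mset l)) = sum_list l"
    using pos by (induction l) auto
  then show "2 * sum_mset (half_type n l) = sum_list l" by (simp add: half_type_def)
qed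


lemma has_type_mset: "has_type n l cs \<Longrightarrow> mset (map length cs) = mset (map Suc l)"
  by (simp add: has_type_def)


subsection \<open>Monomial symmetric functions of the squared Jucys-Murphy elements\<close>

context spin
begin

definition mm :: "nat multiset \<Rightarrow> (cover, 'r) endo" where
  "mm \<mu> = (\<Sum>a\<in>Ty n \<mu>. ymono a)"

lemma mm_filt: "mm \<mu> \<in> filt (2 * sum_mset \<mu>)"
  unfolding mm_def using mono_filt Ty_sum by (intro filt_sum) metis

lemma es_mult_mm: "es l * mm \<rho> = (\<Sum>q\<in>Q n l \<rho>. ymono (shifted q))"
  unfolding es_def mm_def sum_product Q_def sum.cartesian_product
  by (intro sum.cong) (auto simp: mono_mult shifted_def ind_def)

text \<open>Grouped by fibres, all monomials of type \<open>\<nu>\<close> occur equally often; the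
  common multiplicity is written as a repeated sum.\<close>

lemma shifted_sum:
  assumes "b \<in> Ty n \<nu>"
  shows "(\<Sum>q\<in>{q \<in> Q n l \<rho>. shifted q \<in> Ty n \<nu>}. ymono (shifted q)) =
    (\<Sum>j<card {q \<in> Q n l \<rho>. shifted q = b}. mm \<nu>)"
proof -
  let ?Q = "{q \<in> Q n l \<rho>. shifted q \<in> Ty n \<nu>}" and ?N = "card {q \<in> Q n l \<rho>. shifted q = b}"
  have fin: "finite ?Q" using finite_Q by simp
  have "shifted ` ?Q \<subseteq> Ty n \<nu>" by auto
  from sum.group[OF fin finite_Ty this]
  have "(\<Sum>q\<in>?Q. ymono (shifted q)) = (\<Sum>c\<in>Ty n \<nu>. \<Sum>q\<in>{q \<in> ?Q. shifted q = c}. ymono (shifted q))" by (rule HOL.sym)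
  also have "\<dots> = (\<Sum>c\<in>Ty n \<nu>. \<Sum>j<?N. ymono c)"
  proof (rule sum.cong[OF HOL.refl])
    fix c assume c: "c \<in> Ty n \<nu>"
    then have eq: "{q \<in> ?Q. shifted q = c} = {q \<in> Q n l \<rho>. shifted q = c}" by auto
    have "(\<Sum>q\<in>{q \<in> ?Q. shifted q = c}. ymono (shifted q)) = (\<Sum>q\<in>{q \<in> Q n l \<rho>. shifted q = c}. ymono c)"
      unfolding eq by (rule sum.cong) auto
    also have "\<dots> = (\<Sum>j<card {q \<in> Q n l \<rho>. shifted q = c}. ymono c)"
      using finite_Q by (intro sum_const_card) simp
    also have "card {q \<in> Q n l \<rho>. shifted q = c} = ?N" using c assms by (rule card_shifted_fibre)
    finally show "(\<Sum>q\<in>{q \<in> ?Q. shifted q = c}. ymono (shifted q)) = (\<Sum>j<?N. ymono c)" .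
  qed
  also have "\<dots> = (\<Sum>j<?N. mm \<nu>)" unfolding mm_def by (rule sum.swap)
  finally show ?thesis .
qed

text \<open>One step of the fundamental theorem of symmetric polynomials: multiplying by \<open>e\<^sub>l\<close>, where \<open>l\<close> is the
  number of variables occurring, produces a given monomial symmetric function once, and otherwise only
  ones with more variables.\<close>

lemma mm_step:
  assumes \<mu>: "size \<mu> = n"
    and C: "0 \<in> C" "\<And>X Y. X \<in> C \<Longrightarrow> Y \<in> C \<Longrightarrow> X + Y \<in> C" "\<And>X. X \<in> C \<Longrightarrow> - X \<in> C"
    and prod: "es (nz \<mu>) * mm (image_mset (\<lambda>x. x - 1) \<mu>) \<in> C"
    and more: "\<And>\<nu>. size \<nu> = n \<Longrightarrow> sum_mset \<nu> = sum_mset \<mu> \<Longrightarrow> nz \<mu> < nz \<nu> \<Longrightarrow> mm \<nu> \<in> C"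
  shows "mm \<mu> \<in> C"
proof (cases "Ty n \<mu> = {}")
  case True
  then show ?thesis using C(1) by (simp add: mm_def)
next
  case False
  then obtain b where b: "b \<in> Ty n \<mu>" by blast
  let ?\<rho> = "image_mset (\<lambda>x. x - 1) \<mu>"
  let ?Q = "Q n (nz \<mu>) ?\<rho>"
  let ?t = "\<lambda>q. image_mset (shifted q) (mset_set {1..n})"
  let ?T = "insert \<mu> (?t ` ?Q)"
  let ?W = "\<lambda>\<nu>. \<Sum>q\<in>{q \<in> ?Q. ?t q = \<nu>}. ymono (shifted q)"
  have Asum: "sum f I \<in> C" if "\<And>i. i \<in> I \<Longrightarrow> f i \<in> C" for f and I :: "nat multiset set"
    using that by (induction I rule: infinite_finite_induct) (auto intro: C)
  have Asum': "(\<Sum>j<m. X) \<in> C" if "X \<in> C" for X and m :: nat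
    using that by (induction m) (auto intro: C)
  have t: "?t q = \<nu> \<longleftrightarrow> shifted q \<in> Ty n \<nu>" if "q \<in> ?Q" for q \<nu>
    using shifted_Ty[OF that] by (auto simp: Ty_def)
  have Weq: "?W \<nu> = (\<Sum>q\<in>{q \<in> ?Q. shifted q \<in> Ty n \<nu>}. ymono (shifted q))" for \<nu>
  proof (rule sum.cong)
    show "{q \<in> ?Q. ?t q = \<nu>} = {q \<in> ?Q. shifted q \<in> Ty n \<nu>}" using t by blast
  qed simp
  have "es (nz \<mu>) * mm ?\<rho> = (\<Sum>q\<in>?Q. ymono (shifted q))" by (rule es_mult_mm)
  also have "\<dots> = (\<Sum>\<nu>\<in>?T. ?W \<nu>)" by (rule sum.group[symmetric]) (auto simp: finite_Q)
  also have "\<dots> = ?W \<mu> + (\<Sum>\<nu>\<in>?T - {\<mu>}. ?W \<nu>)" using finite_Q by (intro sum.remove) auto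
  also have "?W \<mu> = mm \<mu>" unfolding Weq shifted_sum[OF b] shifted_fibre_self[OF b] by simp
  finally have eq: "mm \<mu> = es (nz \<mu>) * mm ?\<rho> + - (\<Sum>\<nu>\<in>?T - {\<mu>}. ?W \<nu>)" by simp
  have "?W \<nu> \<in> C" if \<nu>: "\<nu> \<in> ?T - {\<mu>}" for \<nu>
  proof -
    obtain q where q: "q \<in> ?Q" "?t q = \<nu>" using \<nu> by blast
    then have s: "shifted q \<in> Ty n \<nu>" using t by blast
    note st = shifted_type[OF \<mu> q(1) s]
    have "nz \<mu> < nz \<nu>" using st(2,3) \<nu> by force
    then have "mm \<nu> \<in> C" using more st(1) Ty_size[OF s] by blast
    then show ?thesis unfolding Weq shifted_sum[OF s] by (rule Asum')
  qed
  then have "(\<Sum>\<nu>\<in>?T - {\<mu>}. ?W \<nu>) \<in> C" by (rule Asum)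
  then show ?thesis unfolding eq using C prod by blast
qed

lemma mm_zero: "size \<mu> = n \<Longrightarrow> nz \<mu> = 0 \<Longrightarrow> mm \<mu> = eps"
proof -
  assume "size \<mu> = n" "nz \<mu> = 0"
  then have "filter_mset (\<lambda>x. 0 < x) \<mu> = {#}" by (simp add: nz_def)
  then have "\<mu> = {#} + replicate_mset (size \<mu> - nz \<mu>) 0" using mset_split_zero[of \<mu>] by metis
  then have \<mu>: "\<mu> = replicate_mset n 0" using \<open>size \<mu> = n\<close> \<open>nz \<mu> = 0\<close> by simp
  have "Ty n \<mu> = {\<lambda>_. 0}"
  proof
    show "Ty n \<mu> \<subseteq> {\<lambda>_. 0}"
    proof
      fix a assume a: "a \<in> Ty n \<mu>"
      have "a k = 0" for k
      proof (cases "k \<in> {1..n}")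
        case True
        then have "a k \<in># image_mset a (mset_set {1..n})" by auto
        also have "image_mset a (mset_set {1..n}) = replicate_mset n 0" using a \<mu> by (simp add: Ty_def)
        finally show ?thesis by (simp split: if_splits)
      qed (use a in \<open>auto simp: Ty_def\<close>)
      then show "a \<in> {\<lambda>_. 0}" by auto
    qed
  qed (auto simp: Ty_def \<mu> image_mset_const_eq)
  moreover have "yprod (\<lambda>_. 0) ks = 1" for ks by (induction ks) (simp_all add: yprod_Cons)
  ultimately show ?thesis by (simp add: mm_def ymono_def)
qed

text \<open>Centrality is inherited from the \<open>es r\<close>: the step \<open>mm_step\<close> is
  applied with \<open>Z\<close> itself as the closed set.\<close>

lemma mm_Z: "size \<mu> = n \<Longrightarrow> mm \<mu> \<in> Z"
\<comment> \<open>Since \<open>n - nz \<mu>\<close> is at most \<open>n\<close>, the factor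
  \<open>Suc n\<close> makes the measure lexicographic: lower degree first, then more
  variables.\<close>
proof (induction "sum_mset \<mu> * Suc n + (n - nz \<mu>)" arbitrary: \<mu> rule: less_induct)
  case less
  show ?case
  proof (cases "nz \<mu> = 0")
    case True
    then show ?thesis using mm_zero less.prems Z_one by simp
  next
    case False
    have le: "nz \<mu> \<le> n" using nz_le[of \<mu>] less.prems by simp
    let ?\<rho> = "image_mset (\<lambda>x. x - 1) \<mu>"
    have "sum_mset ?\<rho> < sum_mset \<mu>" using sum_mset_pred[of \<mu>] False by simp
    then have "sum_mset ?\<rho> * Suc n + Suc n \<le> sum_mset \<mu> * Suc n"
      by (metis Suc_leI add.commute mult_Suc mult_le_mono1)
    then have "mm ?\<rho> \<in> Z" using less.prems by (intro less.hyps) auto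
    then have "es (nz \<mu>) * mm ?\<rho> \<in> Z" using es_Z by (intro Z_mult)
    moreover have "mm \<nu> \<in> Z" if "size \<nu> = n" "sum_mset \<nu> = sum_mset \<mu>" "nz \<mu> < nz \<nu>" for \<nu>
      using that nz_le[of \<nu>] by (intro less.hyps) auto
    ultimately show ?thesis
      using mm_step[OF less.prems, of Z] Z_zero Z_add Z_minus by blast
  qed
qed


subsection \<open>Leading coefficients\<close>

lemma coef_mm: "coef (mm \<mu>) g = (\<Sum>a\<in>Ty n \<mu>. \<Sum>b\<in>Blocks a (upto1 n). coef (S (block_prod n b (upto1 n))) g)"
  by (simp add: mm_def mono_expand coef_sum)

lemma Blocks_data:
  assumes a: "a \<in> Ty n \<mu>" and b: "b \<in> Blocks a (upto1 n)"
  shows "blocks n b" "length (b k) = 2 * a k" "(\<Sum>k\<in>{1..n}. length (b k)) = 2 * sum_mset \<mu>"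
    "card (centres n b) = nz \<mu>" "length (block_cycles b (upto1 n)) = nz \<mu>"
    "mset (map length (block_cycles b (upto1 n))) = image_mset (\<lambda>x. Suc (2 * x)) (filter_mset (\<lambda>x. 0 < x) \<mu>)"
proof -
  show "blocks n b" using Blocks_blocks[OF b] by simp
  show len: "length (b k) = 2 * a k" for k
    using a b by (cases "k \<in> {1..n}") (auto simp: Ty_def Blocks_def block_ok_def)
  then show "(\<Sum>k\<in>{1..n}. length (b k)) = 2 * sum_mset \<mu>"
    using Ty_sum[OF a] by (simp flip: sum_distrib_left)
  have ne: "b k \<noteq> [] \<longleftrightarrow> 0 < a k" for k using len[of k] by (cases "a k") auto
  then have c: "centres n b = {k \<in> {1..n}. 0 < a k}" by (auto simp: centres_def)
  then show "card (centres n b) = nz \<mu>" using Ty_nz[OF a] by simp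
  have "mset (map length (block_cycles b (upto1 n))) = image_mset (\<lambda>k. Suc (2 * a k)) (mset (filter (\<lambda>k. 0 < a k) (upto1 n)))"
    by (simp add: block_cycles_def ne len comp_def)
  also have "mset (filter (\<lambda>k. 0 < a k) (upto1 n)) = mset_set {k \<in> {1..n}. 0 < a k}"
    using mset_set_set[of "filter (\<lambda>k. 0 < a k) (upto1 n)"] by simp
  also have "image_mset (\<lambda>k. Suc (2 * a k)) (mset_set {k \<in> {1..n}. 0 < a k}) =
      image_mset (\<lambda>x. Suc (2 * x)) (filter_mset (\<lambda>x. 0 < x) \<mu>)"
    by (simp add: Ty_filter[OF a] multiset.map_comp comp_def)
  finally show m: "mset (map length (block_cycles b (upto1 n))) = image_mset (\<lambda>x. Suc (2 * x)) (filter_mset (\<lambda>x. 0 < x) \<mu>)" .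
  show "length (block_cycles b (upto1 n)) = nz \<mu>"
    using arg_cong[OF m, of size] by (simp add: nz_def)
qed

lemma block_cycles_odd:
  assumes "a \<in> Ty n \<mu>" "b \<in> Blocks a (upto1 n)" shows "\<forall>c\<in>set (block_cycles b (upto1 n)). odd (length c)"
  using Blocks_data(2)[OF assms] by (auto simp: block_cycles_def)

lemma finite_Blocks: "finite (Blocks a (upto1 n))"
proof (rule finite_subset)
  let ?L = "{is. set is \<subseteq> {1..n} \<and> length is \<le> 2 * (\<Sum>k\<in>{1..n}. a k)}"
  show "Blocks a (upto1 n) \<subseteq> {b. \<forall>k. (k \<in> {1..n} \<longrightarrow> b k \<in> ?L) \<and> (k \<notin> {1..n} \<longrightarrow> b k = [])}"
  proof (clarify, intro conjI impI)
    fix b k assume b: "b \<in> Blocks a (upto1 n)"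
    show "k \<notin> {1..n} \<Longrightarrow> b k = []" using b by (auto simp: Blocks_def)
    assume k: "k \<in> {1..n}"
    then have "a k \<le> (\<Sum>k\<in>{1..n}. a k)" by (intro member_le_sum) auto
    then show "b k \<in> ?L" using b k by (fastforce simp: Blocks_def block_ok_def)
  qed
  show "finite {b. \<forall>k. (k \<in> {1..n} \<longrightarrow> b k \<in> ?L) \<and> (k \<notin> {1..n} \<longrightarrow> b k = [])}"
    by (intro finite_set_of_finite_funs finite_lists_length_le) auto
qed

text \<open>A nonzero coefficient means that the block product and \<open>cprod n cs\<close> lie
  over the same permutation. The number of transpositions then equals the degree, so the
  factorization is minimal and \<open>block_factorization\<close> applies.\<close>

lemma leading_term:
  assumes a: "a \<in> Ty n \<mu>" and b: "b \<in> Blocks a (upto1 n)" and l: "l \<in> EP" and deg: "sum_list l = 2 * sum_mset \<mu>"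
    and cs: "has_type n l cs" and ne: "coef (S (block_prod n b (upto1 n))) (cprod n cs) \<noteq> 0"
  shows "length l \<le> nz \<mu>"
    and "length l = nz \<mu> \<Longrightarrow> valid_cycles n (block_cycles b (upto1 n)) \<and>
      cyc (block_cycles b (upto1 n)) = cyc cs \<and> mset (map Suc l) = image_mset (\<lambda>x. Suc (2 * x)) (filter_mset (\<lambda>x. 0 < x) \<mu>)"
proof -
  let ?p = "block_prod n b (upto1 n)" and ?bc = "block_cycles b (upto1 n)"
  note B = Blocks_data[OF a b]
  note v = has_type_valid[OF cs]
  have g: "cprod n cs \<in> G" using v by simp
  have p: "?p \<in> G" using B(1) by simp
  have "cprod n cs = ?p \<or> cprod n cs = zz n \<cdot>\<^bsub>n\<^esub> ?p" using ne coef_S[OF g p] by (auto split: if_splits)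
  then have "cperm (cprod n cs) = cperm ?p" using p by auto
  then have w: "cyc cs = tprod (block_pairs b (upto1 n))"
    using v(2) B(1) by (simp add: cperm_cprod cperm_block_prod)
  have eq: "sum_list (map (\<lambda>c. length c - 1) cs) = (\<Sum>k\<in>{1..n}. length (b k))"
    using has_type_sum[OF cs] deg B(3) by simp
  have len: "length cs = length l" using cs unfolding has_type_def by (metis length_map)
  show "length l \<le> nz \<mu>" using block_factorization(2)[OF B(1) v(1) w eq] B(4) len by simp
  assume "length l = nz \<mu>"
  then have vb: "valid_cycles n ?bc" using block_factorization(3)[OF B(1) v(1) w eq] B(4) len by simp
  have "cperm ?p = cyc ?bc"
    using block_prod_cycles[OF B(1) _ vb] vb by (simp add: cperm_cprod valid_cycles_def)
  then have cyc: "cyc ?bc = cyc cs" using w B(1) by (simp add: cperm_block_prod)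
  then have "mset (map length ?bc) = mset (map length cs)"
    using cprod_unique[OF vb v(1) block_cycles_odd[OF a b] _ cyc] has_type_odd[OF l cs] by blast
  then show "valid_cycles n ?bc \<and> cyc ?bc = cyc cs \<and>
      mset (map Suc l) = image_mset (\<lambda>x. Suc (2 * x)) (filter_mset (\<lambda>x. 0 < x) \<mu>)"
    using vb cyc B(6) has_type_mset[OF cs] by simp
qed

text \<open>Some single term of the expansion must contribute, and \<open>leading_term\<close>
  restricts it. This is the triangularity: in top degree only the doubled type attains the full
  number of parts.\<close>

lemma dcoef_mm_nonzero:
  assumes l: "l \<in> EP" and deg: "sum_list l = 2 * sum_mset \<mu>" and ne: "dcoef (mm \<mu>) l \<noteq> 0"
  shows "length l \<le> nz \<mu>" "length l = nz \<mu> \<Longrightarrow> mset l = image_mset (\<lambda>x. 2 * x) (filter_mset (\<lambda>x. 0 < x) \<mu>)"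
proof -
  let ?g = "SOME g. g \<in> cycle_products l n"
  have "?g \<in> cycle_products l n" using cycle_products_nonempty[OF l] by (rule someI_ex)
  then obtain cs where cs: "has_type n l cs" "?g = cprod n cs" using l by (auto simp: cycle_products_iff)
  have "coef (mm \<mu>) (cprod n cs) \<noteq> 0" using ne cs(2) by (simp add: dcoef_def)
  then obtain a b where ab: "a \<in> Ty n \<mu>" "b \<in> Blocks a (upto1 n)"
    "coef (S (block_prod n b (upto1 n))) (cprod n cs) \<noteq> 0"
    unfolding coef_mm by (meson sum.not_neutral_contains_not_neutral)
  note L = leading_term[OF ab(1,2) l deg cs(1) ab(3)]
  show "length l \<le> nz \<mu>" by (rule L(1))
  assume "length l = nz \<mu>"
  then have "image_mset Suc (mset l) = image_mset Suc (image_mset (\<lambda>x. 2 * x) (filter_mset (\<lambda>x. 0 < x) \<mu>))"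
    using L(2) by (simp add: multiset.map_comp comp_def)
  then show "mset l = image_mset (\<lambda>x. 2 * x) (filter_mset (\<lambda>x. 0 < x) \<mu>)"
    using multiset.inj_map[of Suc] by (simp add: inj_def)
qed

text \<open>\<open>blocks_exist\<close> supplies a choice of transpositions with the required cycles
  and \<open>blocks_unique\<close> excludes all others. A single term remains, with one sign for
  each part.\<close>

lemma dcoef_mm_half_type:
  assumes l: "l \<in> EP" shows "dcoef (mm (half_type n l)) l = (if odd (length l) then - 1 else 1)"
proof -
  let ?\<mu> = "half_type n l" and ?u = "upto1 n"
  note H = half_type[OF l]
  let ?g = "SOME g. g \<in> cycle_products l n"
  have gl: "?g \<in> cycle_products l n" using cycle_products_nonempty[OF l] by (rule someI_ex)
  then have gG: "?g \<in> G" using cycle_products_closed[OF l] by blast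
  obtain cs where cs: "has_type n l cs" "?g = cprod n cs" using gl l by (auto simp: cycle_products_iff)
  note v = has_type_valid[OF cs(1)]
  obtain b where b: "blocks n b" "valid_cycles n (block_cycles b ?u)" "cyc (block_cycles b ?u) = cyc cs"
    using blocks_exist[OF v(1)] by blast
  \<comment> \<open>The cycles of \<open>b\<close> have the same entries as those of
    \<open>cs\<close>, hence the same lengths. Odd cycles mean blocks of even length, as the squares
    \<open>yy k\<close> require.\<close>
  have odd: "odd (length c)" if c: "c \<in> set (block_cycles b ?u)" for c
  proof -
    have hd: "hd c \<in> set c" using valid_cyclesD(5)[OF b(2) c] by simp
    have "cyc cs (hd c) \<noteq> hd c"
      using cyc_moves[OF valid_cyclesD(1)[OF b(2)] c valid_cyclesD(7)[OF b(2) c] hd] b(3) by simp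
    then have "hd c \<in> set (concat cs)" using cyc_outside by blast
    then obtain d where d: "d \<in> set cs" "hd c \<in> set d" by auto
    have "set c = set d" by (rule cycles_meet(1)[OF b(2) v(1) b(3) c d(1) hd d(2)])
    then have "length c = length d"
      using distinct_card valid_cyclesD(6)[OF b(2) c] valid_cyclesD(6)[OF v(1) d(1)] by metis
    then show ?thesis using has_type_odd[OF l cs(1) d(1)] by simp
  qed
  have uniq: "cprod n (block_cycles b ?u) = cprod n cs \<and> mset (map length (block_cycles b ?u)) = mset (map length cs)"
    using odd has_type_odd[OF l cs(1)] by (intro cprod_unique[OF b(2) v(1) _ _ b(3)]) auto
  define a where "a = (\<lambda>k. length (b k) div 2)"
  have ev: "length (b k) = 2 * a k" for k
  proof (cases "b k = []")
    case False
    then have "k \<in> {1..n}" using b(1) by (auto simp: blocks_def)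
    then have "k # rev (b k) \<in> set (block_cycles b ?u)" using False by (auto simp: block_cycles_def)
    then show ?thesis using odd by (fastforce simp: a_def)
  qed (simp add: a_def)
  let ?\<nu> = "image_mset a (mset_set {1..n})"
  have a\<nu>: "a \<in> Ty n ?\<nu>" using b(1) by (auto simp: Ty_def a_def blocks_def)
  have ba: "b \<in> Blocks a ?u" using b(1) ev by (auto simp: Blocks_def block_ok_def blocks_def)
  note D = Blocks_data[OF a\<nu> ba]
  have "image_mset (\<lambda>x. Suc (2 * x)) (filter_mset (\<lambda>x. 0 < x) ?\<nu>) = mset (map Suc l)"
    using D(6) uniq has_type_mset[OF cs(1)] by simp
  also have "\<dots> = image_mset (\<lambda>x. Suc (2 * x)) (image_mset (\<lambda>x. x div 2) (mset l))"
    using l by (auto simp: multiset.map_comp even_partitions_def intro!: image_mset_cong)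
  finally have f\<nu>: "filter_mset (\<lambda>x. 0 < x) ?\<nu> = filter_mset (\<lambda>x. 0 < x) ?\<mu>"
    unfolding H(4) using multiset.inj_map[of "\<lambda>x. Suc (2 * x)"] by (simp add: inj_def)
  then have "nz ?\<nu> = nz ?\<mu>" by (simp add: nz_def)
  then have "?\<nu> = ?\<mu>" using mset_split_zero[of ?\<nu>] mset_split_zero[of ?\<mu>] f\<nu> H(1) Ty_size[OF a\<nu>] by metis
  then have aT: "a \<in> Ty n ?\<mu>" using a\<nu> by simp
  have deg: "sum_list l = 2 * sum_mset ?\<mu>" using H(3) by simp
  let ?c = "\<lambda>b. coef (S (block_prod n b ?u)) ?g"
  \<comment> \<open>Block lengths determine exponents, so uniqueness of the block function also
    fixes the monomial.\<close>
  have only: "b' = b \<and> a' = a" if ab': "a' \<in> Ty n ?\<mu>" "b' \<in> Blocks a' ?u" "?c b' \<noteq> 0" for a' b'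
  proof -
    have "valid_cycles n (block_cycles b' ?u) \<and> cyc (block_cycles b' ?u) = cyc cs"
      using leading_term(2)[OF ab'(1,2) l deg cs(1)] ab'(3) cs(2) H(2) by simp
    then have "b' = b"
      using blocks_unique[OF Blocks_data(1)[OF ab'(1,2)] b(1) _ b(2)] b(3) by simp
    moreover have "a' k = a k" for k using Blocks_data(2)[OF ab'(1,2), of k] ev[of k] calculation by simp
    ultimately show ?thesis by auto
  qed
  have inner: "(\<Sum>b'\<in>Blocks a' ?u. ?c b') = (if a' = a then ?c b else 0)" if a': "a' \<in> Ty n ?\<mu>" for a'
  proof (cases "a' = a")
    case True
    have "(\<Sum>b'\<in>Blocks a ?u. ?c b') = (\<Sum>b'\<in>{b}. ?c b')"
      by (rule sum.mono_neutral_right) (use ba only[OF aT] finite_Blocks in auto)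
    then show ?thesis using True by simp
  next
    case False
    then have "?c b' = 0" if "b' \<in> Blocks a' ?u" for b' using only[OF a' that] by blast
    then show ?thesis using False by simp
  qed
  have "dcoef (mm ?\<mu>) l = (\<Sum>a'\<in>Ty n ?\<mu>. if a' = a then ?c b else 0)"
    unfolding dcoef_def coef_mm using inner by (intro sum.cong) auto
  also have "\<dots> = ?c b" using aT by (simp add: finite_Ty)
  also have "block_prod n b ?u = zs n (odd (length l)) \<cdot>\<^bsub>n\<^esub> ?g"
    using block_prod_cycles[OF b(1) _ b(2)] uniq cs(2) Blocks_data(5)[OF aT ba] H(2) by simp
  also have "coef (S (zs n (odd (length l)) \<cdot>\<^bsub>n\<^esub> ?g)) ?g = (if odd (length l) then - 1 else 1)"
    using gG coef_S[OF gG gG] by (simp add: S_zz coef_minus)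
  finally show ?thesis .
qed

end


section \<open>Generation of the even center\<close>

context spin
begin

lemma dcoef_diff: "dcoef (X - Y) l = dcoef X l - dcoef Y l"
  and dcoef_sc: "dcoef (sc r * X) l = r * dcoef X l"
  by (simp_all add: dcoef_def coef_diff coef_sc)

lemma dcoef_dd: "l \<in> EP \<Longrightarrow> l' \<in> EP \<Longrightarrow> dcoef (dd l') l = (if l = l' then 1 else 0)"
  using dcoef_sum[of l "{l'}" "\<lambda>_. 1"] by (simp add: sc_1)

lemma even_partition_zero: "l \<in> EP \<Longrightarrow> sum_list l = 0 \<Longrightarrow> l = []"
  by (cases l) (auto simp: even_partitions_def)

lemma dd_Nil: "dd [] = eps"
proof -
  have "cycle_products [] n = {\<one>\<^bsub>cover_group n\<^esub>}" by (auto simp: cycle_products_def)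
  then show ?thesis by (simp add: dd_def)
qed

lemma basis_closed:
  assumes "X \<in> Z" and C: "0 \<in> C" "\<And>X Y. X \<in> C \<Longrightarrow> Y \<in> C \<Longrightarrow> X + Y \<in> C" "\<And>r X. X \<in> C \<Longrightarrow> sc r * X \<in> C"
    and "\<And>l. l \<in> EP \<Longrightarrow> dcoef X l \<noteq> 0 \<Longrightarrow> dd l \<in> C"
  shows "X \<in> C"
proof -
  have Csum: "sum f I \<in> C" if "\<And>i. i \<in> I \<Longrightarrow> f i \<in> C" for f and I :: "nat list set"
    using that by (induction I rule: infinite_finite_induct) (auto intro: C)
  have "sc (dcoef X l) * dd l \<in> C" if "l \<in> EP" for l
    using assms(5)[OF that] C by (cases "dcoef X l = 0") (auto simp: sc_0)
  then show ?thesis using Csum[of EP "\<lambda>l. sc (dcoef X l) * dd l"] even_center_basis[OF assms(1)] by simp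
qed

text \<open>The leading terms of \<open>d\<^sub>\<lambda>\<close> and of the monomial symmetric function of type \<open>\<lambda>/2\<close> agree up to sign and
  up to partitions with fewer parts, so both the degree and the number of parts drive the induction.\<close>

theorem Z_generated:
  assumes one: "eps \<in> C" and add: "\<And>X Y. X \<in> C \<Longrightarrow> Y \<in> C \<Longrightarrow> X + Y \<in> C"
    and mult: "\<And>X Y. X \<in> C \<Longrightarrow> Y \<in> C \<Longrightarrow> X * Y \<in> C" and sc: "\<And>r X. X \<in> C \<Longrightarrow> sc r * X \<in> C"
    and gen: "\<And>r. r \<in> {1..n} \<Longrightarrow> gs r \<in> C" "\<And>r. r \<in> {1..n} \<Longrightarrow> gs r \<in> Z"
      "\<And>r. r \<in> {1..n} \<Longrightarrow> es r - gs r \<in> filt (2 * r - 1)"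
  shows "Z \<subseteq> C"
proof -
  have minus: "- X \<in> C" if "X \<in> C" for X using sc[OF that, of "- 1"] by (simp add: sc_minus sc_1)
  have zero: "0 \<in> C" using sc[OF one, of 0] by (simp add: sc_0)
  have dd: "dd l \<in> C" if "l \<in> EP" for l
    using that
  proof (induction "sum_list l * Suc n + length l" arbitrary: l rule: less_induct)
    case (less l)
    have llen: "length l \<le> n" using less.prems by (simp add: even_partitions_def)
    have IH: "dd m \<in> C" if "m \<in> EP" "sum_list m < sum_list l \<or> sum_list m = sum_list l \<and> length m < length l" for m
    proof (rule less.hyps[OF _ that(1)])
      have "length m \<le> n" using that(1) by (simp add: even_partitions_def)
      moreover have "sum_list m * Suc n + Suc n \<le> sum_list l * Suc n" if "sum_list m < sum_list l"
        using mult_le_mono1[of "Suc (sum_list m)" "sum_list l" "Suc n"] that by simp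
      ultimately show "sum_list m * Suc n + length m < sum_list l * Suc n + length l"
        using that(2) by auto
    qed
    show ?case
    proof (cases "sum_list l = 0")
      case True
      then show ?thesis using even_partition_zero[OF less.prems] dd_Nil one by simp
    next
      case False
      note H = half_type[OF less.prems]
      define k where "k = sum_mset (half_type n l)"
      have k: "sum_list l = 2 * k" "1 \<le> k" using H(3) False unfolding k_def by linarith+
      \<comment> \<open>Central elements of lower filtration involve only basis elements of smaller
        degree, which the outer induction provides.\<close>
      have low: "X \<in> C" if X: "X \<in> Z" "X \<in> filt (2 * k - 1)" for X
      proof (rule basis_closed[OF X(1) zero add sc])
        fix m assume m: "m \<in> EP" "dcoef X m \<noteq> 0"
        then have "sum_list m \<le> 2 * k - 1" using filt_dcoef[OF X(2) m(1)] by force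
        then show "dd m \<in> C" using k by (intro IH[OF m(1)]) auto
      qed
      \<comment> \<open>Within one degree the induction descends from many variables to few, since
        the error terms in \<open>mm_step\<close> have more variables.\<close>
      have mmC: "mm \<mu> \<in> C" if "size \<mu> = n" "sum_mset \<mu> = k" for \<mu>
        using that
      proof (induction "n - nz \<mu>" arbitrary: \<mu> rule: less_induct)
        case (less \<mu>)
        let ?\<rho> = "image_mset (\<lambda>x. x - 1) \<mu>"
        have nz: "1 \<le> nz \<mu>" "nz \<mu> \<le> n"
          using nz_zero[of \<mu>] nz_le[of \<mu>] less.prems k(2) by (auto simp: Suc_le_eq)
        have \<rho>: "sum_mset ?\<rho> + nz \<mu> = k" using sum_mset_pred[of \<mu>] less.prems by simp
        have \<rho>Z: "mm ?\<rho> \<in> Z" using less.prems by (intro mm_Z) simp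
        have \<rho>F: "mm ?\<rho> \<in> filt (2 * sum_mset ?\<rho>)" by (rule mm_filt)
        have "mm ?\<rho> \<in> C" using \<rho> nz by (intro low[OF \<rho>Z] filt_mono[OF \<rho>F]) linarith
        then have 1: "gs (nz \<mu>) * mm ?\<rho> \<in> C" using nz by (intro mult gen(1)) auto
        \<comment> \<open>Replacing \<open>es\<close> by \<open>gs\<close> lowers the filtration, so
          the error stays below degree \<open>2 * k\<close> and falls under
          \<open>low\<close>.\<close>
        have "(es (nz \<mu>) - gs (nz \<mu>)) * mm ?\<rho> \<in> filt (2 * nz \<mu> - 1 + 2 * sum_mset ?\<rho>)"
          using nz by (intro filt_mult \<rho>F gen(3)) auto
        also have "2 * nz \<mu> - 1 + 2 * sum_mset ?\<rho> = 2 * k - 1" using \<rho> nz by linarith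
        finally have "(es (nz \<mu>) - gs (nz \<mu>)) * mm ?\<rho> \<in> C"
          using nz by (intro low Z_mult Z_diff es_Z \<rho>Z gen(2)) auto
        from add[OF 1 this] have "es (nz \<mu>) * mm ?\<rho> \<in> C" by (simp add: left_diff_distrib)
        moreover have "mm \<nu> \<in> C" if "size \<nu> = n" "sum_mset \<nu> = sum_mset \<mu>" "nz \<mu> < nz \<nu>" for \<nu>
          using that nz_le[of \<nu>] less.prems by (intro less.hyps) auto
        ultimately show ?case using mm_step[OF less.prems(1), of C] zero add minus by blast
      qed
      \<comment> \<open>The leading coefficient is its own inverse, so \<open>dd l\<close> can be
        solved for without a division.\<close>
      let ?s = "if odd (length l) then - 1 else (1 :: 'r)"
      let ?X = "mm (half_type n l) - sc ?s * dd l"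
      have XZ: "?X \<in> Z" using less.prems H(1) by (intro Z_diff mm_Z Z_sc dd_Z)
      have XF: "?X \<in> filt (2 * k)"
        using mm_filt[of "half_type n l"] dd_filt[OF less.prems] k(1) by (intro filt_diff filt_sc) (simp_all add: k_def)
      have "?X \<in> C"
      proof (rule basis_closed[OF XZ zero add sc])
        fix m assume m: "m \<in> EP" "dcoef ?X m \<noteq> 0"
        have le: "sum_list m \<le> 2 * k" using filt_dcoef[OF XF m(1)] m(2) by force
        have ml: "m \<noteq> l"
          using m(2) dcoef_mm_half_type[OF less.prems] dcoef_dd[OF less.prems less.prems]
          by (auto simp: dcoef_diff dcoef_sc)
        show "dd m \<in> C"
        proof (rule IH[OF m(1)], cases "sum_list m = sum_list l")
          case True
          then have deg: "sum_list m = 2 * sum_mset (half_type n l)" using k by (simp add: k_def)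
          have ne: "dcoef (mm (half_type n l)) m \<noteq> 0"
            using m(2) ml dcoef_dd[OF m(1) less.prems] by (simp add: dcoef_diff dcoef_sc)
          note D = dcoef_mm_nonzero[OF m(1) deg ne, unfolded H(2,4)]
          have "length m \<noteq> length l"
          proof
            assume "length m = length l"
            then have "mset m = image_mset (\<lambda>x. 2 * (x div 2)) (mset l)"
              using D(2) by (simp add: multiset.map_comp comp_def)
            also have "\<dots> = image_mset (\<lambda>x. x) (mset l)"
              using less.prems by (intro image_mset_cong) (auto simp: even_partitions_def)
            finally have "mset m = mset l" by simp
            then have "m = l"
              using m(1) less.prems by (intro sorted_ge_mset_unique) (auto simp: even_partitions_def)
            then show False using ml by simp
          qed
          then show "sum_list m < sum_list l \<or> sum_list m = sum_list l \<and> length m < length l"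
            using D(1) True by simp
        next
          case False
          then show "sum_list m < sum_list l \<or> sum_list m = sum_list l \<and> length m < length l"
            using le k by simp
        qed
      qed
      moreover have "mm (half_type n l) \<in> C" using H(1) by (intro mmC) (simp_all add: k_def)
      ultimately have "sc ?s * (mm (half_type n l) + - ?X) \<in> C" by (intro sc add minus)
      also have "sc ?s * (mm (half_type n l) + - ?X) = sc (?s * ?s) * dd l" by (simp add: sc_mult mult.assoc)
      also have "?s * ?s = 1" by simp
      finally show ?thesis by (simp add: sc_1)
    qed
  qed
  show ?thesis
  proof
    fix X assume "X \<in> Z"
    then show "X \<in> C" by (rule basis_closed[OF _ zero add sc]) (assumption | rule dd)+
  qed
qed


subsection \<open>Back to the spin group algebra\<close>

lemma jm_Th:
  assumes k: "k \<in> {1..n}"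
  shows "(jm n k :: 'r spin) \<in> carrier B \<and> Th (jm n k) = M k"
proof -
  have c: "spin_of n (lifted_cycle n [i, k]) \<in> carrier B" if "i \<in> {1..<k}" for i
    using k that by (intro spin_of_closed lifted_pair_closed) auto
  then have "Th (jm n k) = (\<Sum>i\<in>{1..<k}. Th (spin_of n (lifted_cycle n [i, k])))"
    unfolding jm_def by (intro Th_finsum) auto
  also have "\<dots> = M k" unfolding M_def
    using k by (intro sum.cong Th_spin_of lifted_pair_closed) auto
  finally show ?thesis using c unfolding jm_def by (auto intro!: B.finsum_closed)
qed

lemma elem_sym_term:
  assumes "set xs \<subseteq> {1..n}"
  defines "t \<equiv> foldr (\<lambda>i y. (jm n i [^]\<^bsub>B\<^esub> (2::nat)) \<otimes>\<^bsub>B\<^esub> y) xs \<one>\<^bsub>B\<^esub>"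
  shows "t \<in> carrier B \<and> Th t = prod_list (map yy xs) * eps"
  using assms(1) unfolding t_def
proof (induction xs)
  case Nil
  then show ?case by (simp add: Th_one)
next
  case (Cons i xs)
  then have j: "(jm n i :: 'r spin) \<in> carrier B" "Th (jm n i) = M i" using jm_Th[of i] by auto
  then have "jm n i [^]\<^bsub>B\<^esub> (2::nat) = jm n i \<otimes>\<^bsub>B\<^esub> (jm n i :: 'r spin)" by (simp add: numeral_2_eq_2)
  then show ?case using Cons j by (simp add: Th_mult yy_def mult.assoc)
qed

lemma elem_sym_Th: "(elem_sym r n :: 'r spin) \<in> carrier B \<and> Th (elem_sym r n) = es r"
proof -
  let ?I = "{I. I \<subseteq> {1..n} \<and> card I = r}"
  let ?t = "\<lambda>I. foldr (\<lambda>i y. (jm n i [^]\<^bsub>B\<^esub> (2::nat)) \<otimes>\<^bsub>B\<^esub> y) (sorted_list_of_set I) \<one>\<^bsub>B\<^esub>"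
  have fin: "finite ?I" by (rule finite_subset[of _ "Pow {1..n}"]) auto
  have t: "?t I \<in> carrier B \<and> Th (?t I) = prod_list (map yy (sorted_list_of_set I)) * eps" if "I \<in> ?I" for I
  proof (rule elem_sym_term)
    have "finite I" using that finite_subset by blast
    then show "set (sorted_list_of_set I) \<subseteq> {1..n}" using that by simp
  qed
  have "Th (elem_sym r n) = (\<Sum>I\<in>?I. Th (?t I))"
    unfolding elem_sym_def using t fin by (intro Th_finsum) auto
  also have "\<dots> = (\<Sum>I\<in>?I. ymono (ind I))"
  proof (rule sum.cong[OF HOL.refl])
    fix I assume I: "I \<in> ?I"
    \<comment> \<open>\<open>elem_sym\<close> multiplies along the sorted list of \<open>I\<close>,
      while \<open>ymono\<close> runs through all of \<open>1..n\<close> with exponents 0 and 1. The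
      filtered list connects the two.\<close>
    have "sorted_list_of_set (set (filter (\<lambda>k. k \<in> I) (upto1 n))) = filter (\<lambda>k. k \<in> I) (upto1 n)"
      by (intro sorted_list_of_set.idem_if_sorted_distinct sorted_wrt_filter distinct_filter)
        (simp_all add: upto1_def del: upt_Suc)
    moreover have "set (filter (\<lambda>k. k \<in> I) (upto1 n)) = I" using I by auto
    ultimately have "sorted_list_of_set I = filter (\<lambda>k. k \<in> I) (upto1 n)" by simp
    moreover have "prod_list (map yy (filter (\<lambda>k. k \<in> I) ks)) = yprod (ind I) ks" for ks
      by (induction ks) (auto simp: yprod_Cons ind_def)
    ultimately show "Th (?t I) = ymono (ind I)" using t[OF I] by (simp add: ymono_def)
  qed
  finally have "Th (elem_sym r n) = es r" by (simp add: es_def)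
  moreover have "(elem_sym r n :: 'r spin) \<in> carrier B"
    unfolding elem_sym_def using t by (intro B.finsum_closed) auto
  ultimately show ?thesis by simp
qed

lemma d_elem_Th:
  assumes l: "l \<in> EP" shows "(d_elem l n :: 'r spin) \<in> carrier B \<and> Th (d_elem l n) = dd l"
proof -
  have c: "spin_of n g \<in> carrier B" if "g \<in> cycle_products l n" for g
    using cycle_products_closed[OF l that] by simp
  have "Th (d_elem l n) = (\<Sum>g\<in>cycle_products l n. Th (spin_of n g))"
    unfolding d_elem_def using c finite_cycle_products[OF l] by (intro Th_finsum) auto
  also have "\<dots> = dd l" unfolding dd_def
    using cycle_products_closed[OF l] by (intro sum.cong Th_spin_of) auto
  finally show ?thesis using c unfolding d_elem_def by (auto intro!: B.finsum_closed)
qed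

lemma d_comb_Th:
  assumes L: "L \<subseteq> EP"
  shows "(d_comb n L c :: 'r spin) \<in> carrier B \<and> Th (d_comb n L c) = (\<Sum>l\<in>L. sc (c l) * dd l)"
proof -
  let ?t = "\<lambda>l. scalar n (c l) \<otimes>\<^bsub>B\<^esub> d_elem l n"
  have t: "?t l \<in> carrier B \<and> Th (?t l) = sc (c l) * dd l" if "l \<in> L" for l
  proof -
    have l: "l \<in> EP" using that L by blast
    have "eps * dd l = dd l"
      unfolding dd_def sum_distrib_left using cycle_products_closed[OF l] by (intro sum.cong) auto
    then show ?thesis using d_elem_Th[OF l] by (simp add: Th_mult Th_scalar mult.assoc)
  qed
  have "Th (d_comb n L c) = (\<Sum>l\<in>L. Th (?t l))"
    unfolding d_comb_def using t finite_subset[OF L finite_even_partitions] by (intro Th_finsum) auto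
  then show ?thesis using t unfolding d_comb_def by (auto intro!: B.finsum_closed)
qed

text \<open>\<open>d_coeffs\<close> is a definite description: existence comes from
  \<open>even_center_basis\<close>, and uniqueness from reading off coefficients with
  \<open>dcoef_sum\<close>.\<close>

lemma d_coeffs_eq:
  assumes x: "x \<in> carrier B" "Th x \<in> Z"
  shows "d_coeffs n x = (\<lambda>l. if l \<in> EP then dcoef (Th x) l else 0)"
  unfolding d_coeffs_def
proof (rule the_equality)
  let ?c = "\<lambda>l. if l \<in> EP then dcoef (Th x) l else 0"
  have "Th (d_comb n EP ?c) = (\<Sum>l\<in>EP. sc (?c l) * dd l)" using d_comb_Th[of EP ?c] by simp
  also have "\<dots> = (\<Sum>l\<in>EP. sc (dcoef (Th x) l) * dd l)" by (rule sum.cong) auto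
  also have "\<dots> = Th x" by (rule even_center_basis[OF x(2), symmetric])
  finally have "x = d_comb n EP ?c" using x(1) d_comb_Th[of EP ?c] by (intro Th_inj) auto
  then show "(\<forall>l. l \<notin> EP \<longrightarrow> ?c l = 0) \<and> x = d_comb n EP ?c" by simp
next
  fix c assume c: "(\<forall>l. l \<notin> EP \<longrightarrow> c l = 0) \<and> x = d_comb n EP c"
  then have "Th x = (\<Sum>l\<in>EP. sc (c l) * dd l)" using d_comb_Th[of EP c] by simp
  then show "c = (\<lambda>l. if l \<in> EP then dcoef (Th x) l else 0)"
    using c dcoef_sum[of _ EP c] by (auto simp: fun_eq_iff)
qed

lemma top_term_Th:
  "(top_term r n :: 'r spin) \<in> carrier B \<and>
    Th (top_term r n) = (\<Sum>l\<in>{l \<in> EP. sum_list l = 2 * r}. sc (dcoef (es r) l) * dd l)"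
proof -
  let ?L = "{l \<in> EP. sum_list l = 2 * r}"
  have e: "(elem_sym r n :: 'r spin) \<in> carrier B" "Th (elem_sym r n) = es r" using elem_sym_Th by auto
  have "top_term r n = d_comb n ?L (d_coeffs n (elem_sym r n :: 'r spin))"
    by (simp add: top_term_def degree_component_def)
  also have "\<dots> = d_comb n ?L (\<lambda>l. if l \<in> EP then dcoef (es r) l else 0)"
    using d_coeffs_eq[OF e(1)] es_Z unfolding e(2) by simp
  finally have t: "top_term r n = d_comb n ?L (\<lambda>l. if l \<in> EP then dcoef (es r) l else 0)" .
  have "(\<Sum>l\<in>?L. sc (if l \<in> EP then dcoef (es r) l else 0) * dd l) = (\<Sum>l\<in>?L. sc (dcoef (es r) l) * dd l)"
    by (rule sum.cong) auto
  then show ?thesis unfolding t using d_comb_Th[of ?L] by auto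
qed

text \<open>\<open>es_filt\<close> removes all components above degree \<open>2 * r\<close>, so
  beside the top term only lower degrees remain.\<close>

lemma top_term_diff:
  fixes r :: nat
  assumes "1 \<le> r"
  defines "t \<equiv> (\<Sum>l\<in>{l \<in> EP. sum_list l = 2 * r}. sc (dcoef (es r) l) * dd l)"
  shows "t \<in> Z" "es r - t \<in> filt (2 * r - 1)"
proof -
  let ?L = "{l \<in> EP. sum_list l = 2 * r}"
  show "t \<in> Z" unfolding t_def by (intro Z_sum Z_sc dd_Z) simp
  have "es r = (\<Sum>l\<in>EP. sc (dcoef (es r) l) * dd l)" by (rule even_center_basis[OF es_Z])
  also have "\<dots> = (\<Sum>l\<in>EP - ?L. sc (dcoef (es r) l) * dd l) + t"
    unfolding t_def by (rule sum.subset_diff) (auto simp: finite_even_partitions)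
  finally have "es r - t = (\<Sum>l\<in>EP - ?L. sc (dcoef (es r) l) * dd l)" by (simp add: diff_eq_eq)
  also have "\<dots> \<in> filt (2 * r - 1)"
  proof (rule filt_sum)
    fix l assume l: "l \<in> EP - ?L"
    show "sc (dcoef (es r) l) * dd l \<in> filt (2 * r - 1)"
    proof (cases "sum_list l < 2 * r")
      case True
      then show ?thesis using l by (intro filt_sc filt_mono[OF dd_filt]) auto
    next
      case False
      then have "dcoef (es r) l = 0" using l by (intro filt_dcoef[OF es_filt]) auto
      then show ?thesis by (simp add: sc_0 filt.zero)
    qed
  qed
  finally show "es r - t \<in> filt (2 * r - 1)" .
qed

text \<open>\<open>Th\<close> is injective and identifies the even center as the preimage of
  \<open>Z\<close>. One inclusion is closure of \<open>Z\<close> under the ring operations; the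
  other is \<open>Z_generated\<close>, applied to the image of the generated ring.\<close>

lemma even_center_generated:
  assumes g: "\<And>r. r \<in> {1..n} \<Longrightarrow> g r \<in> carrier B" "\<And>r. r \<in> {1..n} \<Longrightarrow> Th (g r) \<in> Z"
    "\<And>r. r \<in> {1..n} \<Longrightarrow> es r - Th (g r) \<in> filt (2 * r - 1)"
  shows "(even_center n :: 'r spin set) = generated_algebra n {g r |r. r \<in> {1..n}}"
proof
  let ?H = "range (scalar n) \<union> {g r |r. r \<in> {1..n}}"
  let ?R = "generate_ring B ?H"
  have R: "x \<in> carrier B \<and> Th x \<in> Z" if "x \<in> ?R" for x
    using that
  proof (induction rule: generate_ring.induct)
    case (incl x)
    have "Th (scalar n r) \<in> Z" for r unfolding Th_scalar by (intro Z_sc Z_one)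
    then show ?case using incl g by auto
  qed (auto simp: Th_one Z_one Th_minus Z_minus Th_add Z_add Th_mult Z_mult)
  then show "generated_algebra n {g r |r. r \<in> {1..n}} \<subseteq> (even_center n :: 'r spin set)"
    unfolding generated_algebra_def by (auto simp: Th_even_center)
  \<comment> \<open>Scalars of the generated algebra are elements with image
    \<open>sc r * eps\<close>; the \<open>eps\<close> is absorbed by the image of
    \<open>x\<close>.\<close>
  have sc_in: "sc r * X \<in> Th ` ?R" if X: "X \<in> Th ` ?R" for r X
  proof -
    obtain x where x: "x \<in> ?R" "X = Th x" using X by blast
    obtain f where "X = lin f" using R[OF x(1)] x(2) by (auto simp: Z_def graded_def)
    then have "eps * X = X"
      using R[OF x(1)] x(2) Th_mult[OF B.one_closed, of x] by (simp add: Th_one)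
    then have "sc r * X = Th (scalar n r \<otimes>\<^bsub>B\<^esub> x)"
      using R[OF x(1)] x(2) by (simp add: Th_mult Th_scalar mult.assoc)
    moreover have "scalar n r \<otimes>\<^bsub>B\<^esub> x \<in> ?R"
      by (intro generate_ring.eng_mult x(1) generate_ring.incl) blast
    ultimately show ?thesis by blast
  qed
  have "Z \<subseteq> Th ` ?R"
  proof (rule Z_generated[where gs = "\<lambda>r. Th (g r)"])
    show "eps \<in> Th ` ?R" unfolding Th_one[symmetric] by (intro imageI generate_ring.one)
    fix X Y assume "X \<in> Th ` ?R" "Y \<in> Th ` ?R"
    then obtain x y where xy: "x \<in> ?R" "y \<in> ?R" "X = Th x" "Y = Th y" by blast
    then have "X + Y = Th (x \<oplus>\<^bsub>B\<^esub> y)" "X * Y = Th (x \<otimes>\<^bsub>B\<^esub> y)" using R by (simp_all add: Th_add Th_mult)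
    then show "X + Y \<in> Th ` ?R" "X * Y \<in> Th ` ?R"
      using generate_ring.eng_add[OF xy(1,2)] generate_ring.eng_mult[OF xy(1,2)] by blast+
  next
    fix r assume r: "r \<in> {1..n}"
    then have "g r \<in> ?R" by (intro generate_ring.incl) blast
    then show "Th (g r) \<in> Th ` ?R" by (rule imageI)
    show "Th (g r) \<in> Z" "es r - Th (g r) \<in> filt (2 * r - 1)" using r g by simp_all
  qed (rule sc_in)
  show "even_center n \<subseteq> generated_algebra n {g r |r. r \<in> {1..n}}"
  proof
    fix x :: "'r spin" assume "x \<in> even_center n"
    then have x: "x \<in> carrier B" "Th x \<in> Z" by (auto simp: Th_even_center)
    then obtain y where "y \<in> ?R" "Th x = Th y" using \<open>Z \<subseteq> Th ` ?R\<close> by blast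
    then have "x = y" using x R by (intro Th_inj) auto
    then show "x \<in> generated_algebra n {g r |r. r \<in> {1..n}}"
      using \<open>y \<in> ?R\<close> by (simp add: generated_algebra_def)
  qed
qed

end

theorem theorem5p6:
  fixes n :: nat
  assumes "n \<ge> 1"
    and "\<exists>h::'r::{comm_ring, comm_monoid_mult}. (1 + 1) * h = 1"
  shows "(even_center n :: 'r spin set) = generated_algebra n {elem_sym r n |r. r \<in> {1..n}}
    \<and> (even_center n :: 'r spin set) = generated_algebra n {top_term r n |r. r \<in> {1..n}}"
proof -
  obtain h :: 'r where "(1 + 1) * h = 1" using assms(2) by blast
  then interpret spin n h by unfold_locales
  \<comment> \<open>Here the generators map to the \<open>es r\<close> themselves, so the difference
    required to have lower filtration is 0.\<close>
  have "(even_center n :: 'r spin set) = generated_algebra n {elem_sym r n |r. r \<in> {1..n}}"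
    using elem_sym_Th es_Z by (intro even_center_generated) (simp_all add: filt.zero)
  moreover have "(even_center n :: 'r spin set) = generated_algebra n {top_term r n |r. r \<in> {1..n}}"
    using top_term_Th top_term_diff by (intro even_center_generated) auto
  ultimately show ?thesis by blast
qed

end
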